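(* Let $\mu$ be a Borel probability measure on $\mathbb{R}^n$. Let $\rho\in L^1(\mathbb{R}^n)\cap W^{\infty,\infty}(\mathbb{R}^n)$ be positive (i.e. $\rho(x)>0$ for all $x\in\mathbb{R}^n$) with $\int_{\mathbb{R}^n}\rho(x)\,dx=1$ and such that, for some $m_0>n$, $\rho(x)\ge|x|^{-m_0}$ whenever $|x|\ge1$. For $\varepsilon\in]0,1]$ set $\rho_\varepsilon(x)=\varepsilon^{-n}\rho(x/\varepsilon)$ and $h_\varepsilon:=\mu*\rho_\varepsilon$, i.e. $h_\varepsilon(x)=\int_{\mathbb{R}^n}\rho_\varepsilon(x-y)\,d\mu(y)$. Then: (1) $h_\varepsilon$ is positive, and setting $\phi_\varepsilon:=\sqrt{h_\varepsilon}$, the net $(\phi_\varepsilon)_{\varepsilon\in]0,1]}$ represents an element $\phi\in\mathcal{G}(\mathbb{R}^n)$ such that $\phi^2\approx\mu$. (2) There exists a generalized function $g\in\mathcal{G}_{L^2}(\mathbb{R}^n)$, with representative $(g_\varepsilon)_{\varepsilon\in]0,1]}$, such that $g^2\approx\mu$ and such that for every bounded open subset $\Omega\subseteq\mathbb{R}^n$ the class of $(g_\varepsilon|_\Omega)_{\varepsilon\in]0,1]}$ in $\mathcal{G}(\Omega)$ is equal to $\phi|_\Omega$.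
   Context: Here $W^{\infty,\infty}(\mathbb{R}^n)=\{h\in C^\infty(\mathbb{R}^n):\partial^\alpha h\in L^\infty(\mathbb{R}^n)\ \forall\alpha\in\mathbb{N}^n\}$ and $H^\infty(\mathbb{R}^n)=\{h\in C^\infty(\mathbb{R}^n):\partial^\alpha h\in L^2(\mathbb{R}^n)\ \forall\alpha\in\mathbb{N}^n\}$, where $\mathbb{N}$ includes $0$. Generalized functions based on a space $E$. Let $E$ be a locally convex topological vector space with topology given by seminorms $(p_j)_{j\in J}$. Put $$\mathcal{M}_E=\{(u_\varepsilon)_\varepsilon\in E^{]0,1]}:\forall j\in J\ \exists N\in\mathbb{N}:\ p_j(u_\varepsilon)=O(\varepsilon^{-N})\ (\varepsilon\to0)\},$$ $$\mathcal{N}_E=\{(u_\varepsilon)_\varepsilon\in E^{]0,1]}:\forall j\in J\ \forall q\in\mathbb{N}:\ p_j(u_\varepsilon)=O(\varepsilon^{q})\ (\varepsilon\to0)\},$$ and $\mathcal{G}_E=\mathcal{M}_E/\mathcal{N}_E$, with operations (including products when $E$ is an algebra) defined componentwise in $\varepsilon$. A net in the class $u\in\mathcal{G}_E$ is called a representative of $u$. - For $\Omega\subseteq\mathbb{R}^n$ open, $\mathcal{G}(\Omega):=\mathcal{G}_E$ with $E=C^\infty(\Omega)$ carrying the topology of uniform convergence of all derivatives on compact subsets of $\Omega$ (the special Colombeau algebra). For $u\in\mathcal{G}(\mathbb{R}^n)$ with representative $(u_\varepsilon)$, the restriction $u|_\Omega\in\mathcal{G}(\Omega)$ is the class of $(u_\varepsilon|_\Omega)$.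 - $\mathcal{G}_{L^2}(\mathbb{R}^n):=\mathcal{G}_E$ with $E=H^\infty(\mathbb{R}^n)$ and the norms $\|h\|_{H^k}=\big(\sum_{|\alpha|\le k}\|\partial^\alpha h\|_{L^2}^2\big)^{1/2}$, $k\in\mathbb{N}$. Association: for $E\subseteq\mathcal{D}'(\Omega)$, $u\in\mathcal{G}_E$ and $w\in\mathcal{D}'(\Omega)$, one writes $u\approx w$ if $u_\varepsilon\to w$ in $\mathcal{D}'(\Omega)$ as $\varepsilon\to0$ for any (hence every) representative $(u_\varepsilon)$ of $u$. Here a Borel probability measure on $\mathbb{R}^n$ is regarded as a distribution on $\mathbb{R}^n$. *)

theory Defs
  imports
    "HOL-Probability.Probability"
    "HOL-Library.Landau_Symbols"
    "HOL-Library.Function_Algebras"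
begin

section \<open>Partial derivatives and smooth functions\<close>

definition partial :: "'n::finite \<Rightarrow> (real ^ 'n \<Rightarrow> 'b::real_normed_vector) \<Rightarrow> real ^ 'n \<Rightarrow> 'b" where
  "partial i f x = vector_derivative (\<lambda>t. f (x + t *\<^sub>R axis i 1)) (at 0)"

fun Ck_on :: "nat \<Rightarrow> (real ^ 'n::finite) set \<Rightarrow> (real ^ 'n \<Rightarrow> 'b::real_normed_vector) \<Rightarrow> bool" where
  "Ck_on 0 \<Omega> f \<longleftrightarrow> continuous_on \<Omega> f"
| "Ck_on (Suc k) \<Omega> f \<longleftrightarrow> continuous_on \<Omega> f \<and>
     (\<forall>i. (\<forall>x\<in>\<Omega>. (\<lambda>t. f (x + t *\<^sub>R axis i 1)) differentiable at 0) \<and> Ck_on k \<Omega> (partial i f))"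

text \<open>Meant for open \<open>\<Omega>\<close> only; then it depends only on the values of \<open>f\<close> on \<open>\<Omega>\<close>.\<close>

definition smooth_on :: "(real ^ 'n::finite) set \<Rightarrow> (real ^ 'n \<Rightarrow> 'b::real_normed_vector) \<Rightarrow> bool" where
  "smooth_on \<Omega> f \<longleftrightarrow> (\<forall>k. Ck_on k \<Omega> f)"

text \<open>The multi-index derivative. The index type carries no order, so some sequence of
  indices in which each \<open>i\<close> occurs \<open>\<alpha> i\<close> times is chosen; for smooth functions
  the result does not depend on the choice, by the symmetry of iterated partial derivatives.\<close>

definition mpartial :: "('n::finite \<Rightarrow> nat) \<Rightarrow> (real ^ 'n \<Rightarrow> 'b::real_normed_vector) \<Rightarrow> real ^ 'n \<Rightarrow> 'b" where
  "mpartial \<alpha> f = foldr partial (SOME xs. \<forall>i. count_list xs i = \<alpha> i) f"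

lemma multi_index_sequence_exists: "\<exists>xs. \<forall>i::'n::finite. count_list xs i = \<alpha> i"
proof -
  have "finite {i. \<alpha> i > 0}" by simp
  then have "count (Abs_multiset \<alpha>) = \<alpha>" by (rule count_Abs_multiset)
  then obtain M where "count M = \<alpha>" ..
  moreover obtain xs where "mset xs = M" using ex_mset by blast
  ultimately have "\<forall>i. count_list xs i = \<alpha> i" by (metis count_mset)
  then show ?thesis ..
qed

definition multi_indices :: "nat \<Rightarrow> ('n::finite \<Rightarrow> nat) set" where
  "multi_indices k = {\<alpha>. (\<Sum>i\<in>UNIV. \<alpha> i) \<le> k}"

lemma finite_multi_indices: "finite (multi_indices k :: ('n::finite \<Rightarrow> nat) set)"
proof (rule finite_subset)
  show "multi_indices k \<subseteq> (\<Pi>\<^sub>E i\<in>(UNIV :: 'n set). {..k})"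
  proof
    fix \<alpha> :: "'n \<Rightarrow> nat" assume *: "\<alpha> \<in> multi_indices k"
    have "\<alpha> i \<le> k" for i
    proof -
      have "\<alpha> i \<le> (\<Sum>i\<in>UNIV. \<alpha> i)" by (rule member_le_sum) simp_all
      also have "\<dots> \<le> k" using * by (simp add: multi_indices_def)
      finally show ?thesis .
    qed
    then show "\<alpha> \<in> (\<Pi>\<^sub>E i\<in>(UNIV :: 'n set). {..k})" by (simp add: PiE_UNIV_domain)
  qed
  show "finite (\<Pi>\<^sub>E i\<in>(UNIV :: 'n set). {..k})" by (rule finite_PiE) simp_all
qed

section \<open>Function spaces\<close>

definition in_Linf :: "(real ^ 'n::finite \<Rightarrow> 'b::real_normed_vector) \<Rightarrow> bool" where
  "in_Linf f \<longleftrightarrow> f \<in> borel_measurable lebesgue \<and> (\<exists>C. AE x in lebesgue. norm (f x) \<le> C)"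

definition in_L2 :: "(real ^ 'n::finite \<Rightarrow> complex) \<Rightarrow> bool" where
  "in_L2 f \<longleftrightarrow> f \<in> borel_measurable lebesgue \<and> integrable lebesgue (\<lambda>x. (norm (f x))\<^sup>2)"

definition L2_norm :: "(real ^ 'n::finite \<Rightarrow> complex) \<Rightarrow> real" where
  "L2_norm f = sqrt (\<integral>x. (norm (f x))\<^sup>2 \<partial>lebesgue)"

definition W_inf_inf :: "(real ^ 'n::finite \<Rightarrow> 'b::real_normed_vector) set" where
  "W_inf_inf = {f. smooth_on UNIV f \<and> (\<forall>\<alpha>. in_Linf (mpartial \<alpha> f))}"

definition H_norm :: "nat \<Rightarrow> (real ^ 'n::finite \<Rightarrow> complex) \<Rightarrow> real" where
  "H_norm k f = sqrt (\<Sum>\<alpha>\<in>multi_indices k. (L2_norm (mpartial \<alpha> f))\<^sup>2)"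

record 'e lcs =
  elems :: "'e set"
  seminorms :: "('e \<Rightarrow> real) set"

definition H_inf :: "(real ^ 'n::finite \<Rightarrow> complex) lcs" where
  "H_inf = \<lparr>elems = {f. smooth_on UNIV f \<and> (\<forall>\<alpha>. in_L2 (mpartial \<alpha> f))},
            seminorms = range H_norm\<rparr>"

text \<open>Functions on \<open>\<Omega>\<close> are represented by their extensions by zero to the whole space.
  Empty \<open>K\<close> is left out because the supremum of the empty set of reals is unspecified.\<close>

definition C_inf :: "(real ^ 'n::finite) set \<Rightarrow> (real ^ 'n \<Rightarrow> complex) lcs" where
  "C_inf \<Omega> = \<lparr>elems = {f. smooth_on \<Omega> f \<and> (\<forall>x. x \<notin> \<Omega> \<longrightarrow> f x = 0)},
              seminorms = {\<lambda>f. (SUP x\<in>K. norm (mpartial \<alpha> f x)) | K \<alpha>.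
                             compact K \<and> K \<noteq> {} \<and> K \<subseteq> \<Omega>}\<rparr>"

definition restr :: "'a set \<Rightarrow> ('a \<Rightarrow> complex) \<Rightarrow> 'a \<Rightarrow> complex" where
  "restr \<Omega> f x = (if x \<in> \<Omega> then f x else 0)"

section \<open>Generalized functions based on a locally convex space\<close>

text \<open>A net indexed by \<open>]0,1]\<close> is a function on the reals whose values outside
  \<open>{0<..1}\<close> are ignored; nets differing only there are identified by \<open>net_equiv\<close>.\<close>

definition moderate_nets :: "'e lcs \<Rightarrow> (real \<Rightarrow> 'e) set" where
  "moderate_nets E = {u. (\<forall>\<epsilon>\<in>{0<..1}. u \<epsilon> \<in> elems E) \<and>
     (\<forall>p\<in>seminorms E. \<exists>N::nat. (\<lambda>\<epsilon>. p (u \<epsilon>)) \<in> O[at_right 0](\<lambda>\<epsilon>. 1 / \<epsilon> ^ N))}"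

definition null_nets :: "'e lcs \<Rightarrow> (real \<Rightarrow> 'e) set" where
  "null_nets E = {u. (\<forall>\<epsilon>\<in>{0<..1}. u \<epsilon> \<in> elems E) \<and>
     (\<forall>p\<in>seminorms E. \<forall>q::nat. (\<lambda>\<epsilon>. p (u \<epsilon>)) \<in> O[at_right 0](\<lambda>\<epsilon>. \<epsilon> ^ q))}"

definition net_equiv :: "'e::minus lcs \<Rightarrow> ((real \<Rightarrow> 'e) \<times> (real \<Rightarrow> 'e)) set" where
  "net_equiv E = {(u, v). u \<in> moderate_nets E \<and> v \<in> moderate_nets E \<and>
     (\<lambda>\<epsilon>. u \<epsilon> - v \<epsilon>) \<in> null_nets E}"

definition gen_functions :: "'e::minus lcs \<Rightarrow> (real \<Rightarrow> 'e) set set" where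
  "gen_functions E = moderate_nets E // net_equiv E"

definition net_class :: "'e::minus lcs \<Rightarrow> (real \<Rightarrow> 'e) \<Rightarrow> (real \<Rightarrow> 'e) set" where
  "net_class E u = net_equiv E `` {u}"

definition gen_mult :: "'e::{minus,times} lcs \<Rightarrow> (real \<Rightarrow> 'e) set \<Rightarrow> (real \<Rightarrow> 'e) set \<Rightarrow> (real \<Rightarrow> 'e) set" where
  "gen_mult E U V = (\<Union>u\<in>U. \<Union>v\<in>V. net_class E (\<lambda>\<epsilon>. u \<epsilon> * v \<epsilon>))"

definition gen_restrict :: "(real ^ 'n::finite) set \<Rightarrow> (real \<Rightarrow> real ^ 'n \<Rightarrow> complex) set
    \<Rightarrow> (real \<Rightarrow> real ^ 'n \<Rightarrow> complex) set" where
  "gen_restrict \<Omega> U = (\<Union>u\<in>U. net_class (C_inf \<Omega>) (\<lambda>\<epsilon>. restr \<Omega> (u \<epsilon>)))"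

section \<open>Distributions and association\<close>

definition test_functions :: "(real ^ 'n::finite) set \<Rightarrow> (real ^ 'n \<Rightarrow> complex) set" where
  "test_functions \<Omega> = {\<psi>. smooth_on UNIV \<psi> \<and> compact (closure {x. \<psi> x \<noteq> 0}) \<and>
     closure {x. \<psi> x \<noteq> 0} \<subseteq> \<Omega>}"

text \<open>Continuity is expressed by the usual seminorm estimates on each compact set.
  Only the values on \<open>test_functions \<Omega>\<close> matter.\<close>

definition distributions :: "(real ^ 'n::finite) set \<Rightarrow> ((real ^ 'n \<Rightarrow> complex) \<Rightarrow> complex) set" where
  "distributions \<Omega> = {w.
     (\<forall>\<psi>\<in>test_functions \<Omega>. \<forall>\<eta>\<in>test_functions \<Omega>. w (\<lambda>x. \<psi> x + \<eta> x) = w \<psi> + w \<eta>) \<and>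
     (\<forall>c. \<forall>\<psi>\<in>test_functions \<Omega>. w (\<lambda>x. c * \<psi> x) = c * w \<psi>) \<and>
     (\<forall>K. compact K \<and> K \<subseteq> \<Omega> \<longrightarrow> (\<exists>C k. \<forall>\<psi>\<in>test_functions \<Omega>. closure {x. \<psi> x \<noteq> 0} \<subseteq> K \<longrightarrow>
        norm (w \<psi>) \<le> C * (\<Sum>\<alpha>\<in>multi_indices k. SUP x. norm (mpartial \<alpha> \<psi> x))))}"

definition fun_distr :: "(real ^ 'n::finite \<Rightarrow> complex) \<Rightarrow> (real ^ 'n \<Rightarrow> complex) \<Rightarrow> complex" where
  "fun_distr f \<psi> = (\<integral>x. f x * \<psi> x \<partial>lebesgue)"

definition measure_distr :: "(real ^ 'n::finite) measure \<Rightarrow> (real ^ 'n \<Rightarrow> complex) \<Rightarrow> complex" where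
  "measure_distr \<mu> \<psi> = (\<integral>x. \<psi> x \<partial>\<mu>)"

text \<open>Association of a class \<open>U\<close> with \<open>w\<close>. The condition \<open>U \<noteq> {}\<close> makes the quantification
  over all representatives amount to ``some and hence every representative''.\<close>

definition associated :: "(real ^ 'n::finite) set \<Rightarrow> (real \<Rightarrow> real ^ 'n \<Rightarrow> complex) set
    \<Rightarrow> ((real ^ 'n \<Rightarrow> complex) \<Rightarrow> complex) \<Rightarrow> bool" where
  "associated \<Omega> U w \<longleftrightarrow> w \<in> distributions \<Omega> \<and> U \<noteq> {} \<and>
     (\<forall>u\<in>U. \<forall>\<psi>\<in>test_functions \<Omega>. ((\<lambda>\<epsilon>. fun_distr (u \<epsilon>) \<psi>) \<longlongrightarrow> w \<psi>) (at_right 0))"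

section \<open>Regularization of a measure\<close>

definition scaled :: "(real ^ 'n::finite \<Rightarrow> real) \<Rightarrow> real \<Rightarrow> real ^ 'n \<Rightarrow> real" where
  "scaled \<rho> \<epsilon> x = \<rho> (x /\<^sub>R \<epsilon>) / \<epsilon> ^ CARD('n)"

definition measure_convolve :: "(real ^ 'n::finite) measure \<Rightarrow> (real ^ 'n \<Rightarrow> real) \<Rightarrow> real ^ 'n \<Rightarrow> real" where
  "measure_convolve \<mu> f x = (\<integral>y. f (x - y) \<partial>\<mu>)"

end

theory Submission
  imports Defs
begin

text \<open>All bounds are taken relative to the weight \<open>(1 + |x|) / \<epsilon>\<close>. Nets whose derivatives are bounded by
  powers of this weight, uniformly in \<open>\<epsilon>\<close> and \<open>x\<close>, form an algebra that is closed under reciprocals and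
  square roots as long as the reciprocal itself satisfies such a bound. The net \<open>h\<close> belongs to it because all
  derivatives of \<open>\<rho>\<close> are bounded, and its reciprocal is bounded by a power of the weight because
  \<open>\<rho>\<close> decays at most polynomially and \<open>\<mu>\<close> has mass at least \<open>1/2\<close> on some ball. Hence \<open>sqrt h\<close> is
  moderate. Multiplying it by a smooth cutoff that is \<open>1\<close> for \<open>|x| \<le> 1/\<epsilon>\<close> and \<open>0\<close> for \<open>|x| \<ge> 2/\<epsilon>\<close> gives
  moderate Sobolev norms and changes nothing on a bounded set once \<open>\<epsilon>\<close> is small. The limits follow from
  Fubini's theorem and dominated convergence.\<close>

section \<open>Calculus of partial derivatives\<close>

text \<open>The square root is not smooth at 0, and \<open>h\<close> may tend to 0 both as
  \<epsilon> shrinks and as |x| grows, so a lower bound for \<open>h\<close> has to be tracked in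
  both variables. This explains the weight: its denominator absorbs the factors 1/\<epsilon>
  produced by rescaling and by each differentiation, its numerator the decay of \<rho>. Growth in x
  does no harm to Sobolev norms, because after the cutoff the support lies in the ball of radius
  2/\<epsilon>, where the weight is at most 3/\<epsilon>^2 and whose volume is a multiple of
  \<epsilon>^(-n). Two further obstacles shape the text. \<open>mpartial\<close> differentiates in
  an unspecified order, so membership in \<open>W_inf_inf\<close> bounds one order per multi-index;
  symmetry of mixed partials is what extends the bounds to arbitrary iterated derivatives of \<rho>.
  And association concerns every representative of a product class. The perturbations between
  representatives are measured by L2 integrals against a test function, a quantity that the
  seminorms of either space, \<open>C_inf\<close> or \<open>H_inf\<close>, control directly.\<close>

definition has_partial :: "'n::finite \<Rightarrow> (real ^ 'n \<Rightarrow> 'b::real_normed_vector) \<Rightarrow> 'b \<Rightarrow> real ^ 'n \<Rightarrow> bool" where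
  "has_partial i f d x \<longleftrightarrow> ((\<lambda>t. f (x + t *\<^sub>R axis i 1)) has_vector_derivative d) (at 0)"

lemma partial_eqI: "has_partial i f d x \<Longrightarrow> partial i f x = d"
  unfolding has_partial_def partial_def by (rule vector_derivative_at)

text \<open>\<open>partial\<close> has a value at every point, meaningful or not, whereas
  \<open>has_partial\<close> also asserts existence and accepts explicit candidates. This
  equivalence links it to the differentiability clause of \<open>Ck_on\<close>.\<close>

lemma has_partial_partial:
  "(\<lambda>t. f (x + t *\<^sub>R axis i 1)) differentiable at 0 \<longleftrightarrow> has_partial i f (partial i f x) x"
  unfolding has_partial_def partial_def
  by (meson differentiableI_vector vector_derivative_works)

lemma has_partial_cong:
  assumes "open \<Omega>" "x \<in> \<Omega>" "\<And>y. y \<in> \<Omega> \<Longrightarrow> f y = g y" "has_partial i f d x"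
  shows "has_partial i g d x"
  unfolding has_partial_def
proof (rule has_vector_derivative_transform_within_open)
  show "((\<lambda>t. f (x + t *\<^sub>R axis i 1)) has_vector_derivative d) (at 0)"
    using assms(4) by (simp add: has_partial_def)
  show "open ((\<lambda>t. x + t *\<^sub>R axis i 1) -` \<Omega>)"
    by (rule open_vimage[OF assms(1)]) (intro continuous_intros)
qed (use assms in auto)

text \<open>No differentiability is involved: \<open>vector_derivative\<close> is a choice among the
  admissible derivatives, and near x both functions admit the same ones. Where none exists the two
  choices still agree.\<close>

lemma partial_cong:
  assumes "open \<Omega>" "x \<in> \<Omega>" "\<And>y. y \<in> \<Omega> \<Longrightarrow> f y = g y"
  shows "partial i f x = partial i g x"
proof -
  have "has_partial i f d x \<longleftrightarrow> has_partial i g d x" for d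
    using has_partial_cong[of \<Omega> x f g i d] has_partial_cong[of \<Omega> x g f i d] assms by auto
  then show ?thesis
    by (simp add: partial_def vector_derivative_def has_partial_def)
qed

lemma foldr_partial_cong:
  assumes "open \<Omega>" "\<And>y. y \<in> \<Omega> \<Longrightarrow> f y = g y" "x \<in> \<Omega>"
  shows "foldr partial xs f x = foldr partial xs g x"
  using assms(3)
  by (induction xs arbitrary: x) (auto intro: assms partial_cong[OF assms(1)])

lemma has_partial_linear:
  assumes "bounded_linear L" "has_partial i f d x"
  shows "has_partial i (\<lambda>x. L (f x)) (L d) x"
  using bounded_linear.has_vector_derivative[OF assms(1)] assms(2) by (simp add: has_partial_def)

lemma has_partial_add:
  "has_partial i f d x \<Longrightarrow> has_partial i g e x \<Longrightarrow> has_partial i (\<lambda>x. f x + g x) (d + e) x"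
  by (simp add: has_partial_def has_vector_derivative_add)

lemma has_partial_mult:
  fixes f g :: "real ^ 'n::finite \<Rightarrow> 'b::real_normed_algebra"
  assumes "has_partial i f d x" "has_partial i g e x"
  shows "has_partial i (\<lambda>x. f x * g x) (f x * e + d * g x) x"
  using has_vector_derivative_mult[of "\<lambda>t. f (x + t *\<^sub>R axis i 1)" d 0 UNIV "\<lambda>t. g (x + t *\<^sub>R axis i 1)" e] assms
  by (simp add: has_partial_def)

lemma has_partial_compose:
  assumes "(F has_real_derivative D) (at (f x))" "has_partial i f d x"
  shows "has_partial i (\<lambda>x. F (f x)) (D * d) x"
proof -
  have "((F \<circ> (\<lambda>t. f (x + t *\<^sub>R axis i 1))) has_real_derivative D * d) (at 0)"
    by (rule DERIV_chain) (use assms in \<open>simp_all add: has_partial_def has_real_derivative_iff_has_vector_derivative\<close>)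
  then show ?thesis
    by (simp add: has_partial_def has_real_derivative_iff_has_vector_derivative o_def)
qed

section \<open>Functions of class C^k: locality and linear operations\<close>

lemma Ck_on_imp_continuous_on: "Ck_on k \<Omega> f \<Longrightarrow> continuous_on \<Omega> f"
  by (cases k) auto

lemma Ck_on_cong:
  assumes "open \<Omega>" "\<And>y. y \<in> \<Omega> \<Longrightarrow> f y = g y" "Ck_on k \<Omega> f"
  shows "Ck_on k \<Omega> g"
  using assms(2,3)
proof (induction k arbitrary: f g)
  case 0
  then show ?case by (simp cong: continuous_on_cong)
next
  case (Suc k)
  have "has_partial i g (partial i g x) x" if "x \<in> \<Omega>" for x i
  proof -
    have "has_partial i f (partial i f x) x"
      using Suc.prems(2) that by (auto simp: has_partial_partial)
    moreover have "partial i f x = partial i g x"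
      by (rule partial_cong[OF assms(1) that Suc.prems(1)])
    ultimately have "has_partial i f (partial i g x) x" by simp
    then show ?thesis by (rule has_partial_cong[OF assms(1) that Suc.prems(1), rotated])
  qed
  moreover have "Ck_on k \<Omega> (partial i g)" for i
  proof (rule Suc.IH)
    show "Ck_on k \<Omega> (partial i f)" using Suc.prems(2) by simp
    show "partial i f y = partial i g y" if "y \<in> \<Omega>" for y
      by (rule partial_cong[OF assms(1) that Suc.prems(1)])
  qed
  moreover have "continuous_on \<Omega> g"
    using Suc.prems by (simp cong: continuous_on_cong)
  ultimately show ?case by (simp add: has_partial_partial)
qed

text \<open>Lets a derivative be given by a formula valid on \<Omega> only:
  \<open>partial i f\<close> and \<open>f'\<close> may differ elsewhere, which \<open>Ck_on\<close>
  on an open set does not see.\<close>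

lemma Ck_on_SucI:
  assumes "open \<Omega>" "continuous_on \<Omega> f"
    and "\<And>i. \<exists>f'. Ck_on k \<Omega> f' \<and> (\<forall>x\<in>\<Omega>. has_partial i f (f' x) x)"
  shows "Ck_on (Suc k) \<Omega> f"
proof -
  have "(\<forall>x\<in>\<Omega>. has_partial i f (partial i f x) x) \<and> Ck_on k \<Omega> (partial i f)" for i
  proof -
    obtain f' where f': "Ck_on k \<Omega> f'" "\<forall>x\<in>\<Omega>. has_partial i f (f' x) x" using assms(3) by blast
    then have eq: "partial i f x = f' x" if "x \<in> \<Omega>" for x using that partial_eqI by blast
    then show ?thesis using f' Ck_on_cong[OF assms(1) _ f'(1), of "partial i f"] by auto
  qed
  then show ?thesis using assms(2) by (simp add: has_partial_partial)
qed

lemma Ck_on_SucE: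
  assumes "Ck_on (Suc k) \<Omega> f"
  obtains "continuous_on \<Omega> f" "\<And>i. Ck_on k \<Omega> (partial i f)"
    "\<And>i x. x \<in> \<Omega> \<Longrightarrow> has_partial i f (partial i f x) x"
  using assms by (auto simp: has_partial_partial)

lemma Ck_on_linear:
  assumes "open \<Omega>" "bounded_linear L" "Ck_on k \<Omega> f"
  shows "Ck_on k \<Omega> (\<lambda>x. L (f x))"
  using assms(3)
proof (induction k arbitrary: f)
  case 0
  then show ?case by (simp add: bounded_linear.continuous_on[OF assms(2)])
next
  case (Suc k)
  show ?case
  proof (rule Ck_on_SucI[OF assms(1)])
    show "continuous_on \<Omega> (\<lambda>x. L (f x))"
      using Ck_on_imp_continuous_on[OF Suc.prems] by (rule bounded_linear.continuous_on[OF assms(2)])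
    show "\<exists>f'. Ck_on k \<Omega> f' \<and> (\<forall>x\<in>\<Omega>. has_partial i (\<lambda>x. L (f x)) (f' x) x)" for i
      by (rule exI[of _ "\<lambda>x. L (partial i f x)"])
        (use Suc.prems in \<open>auto elim!: Ck_on_SucE simp: Suc.IH has_partial_linear[OF assms(2)]
          simp del: Ck_on.simps\<close>)
  qed
qed

lemma Ck_on_add:
  assumes "open \<Omega>" "Ck_on k \<Omega> f" "Ck_on k \<Omega> g"
  shows "Ck_on k \<Omega> (\<lambda>x. f x + g x)"
  using assms(2,3)
proof (induction k arbitrary: f g)
  case 0
  then show ?case by (simp add: continuous_on_add)
next
  case (Suc k)
  show ?case
  proof (rule Ck_on_SucI[OF assms(1)])
    show "continuous_on \<Omega> (\<lambda>x. f x + g x)"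
      by (intro continuous_on_add Suc.prems[THEN Ck_on_imp_continuous_on])
    show "\<exists>f'. Ck_on k \<Omega> f' \<and> (\<forall>x\<in>\<Omega>. has_partial i (\<lambda>x. f x + g x) (f' x) x)" for i
      by (rule exI[of _ "\<lambda>x. partial i f x + partial i g x"])
        (use Suc.prems in \<open>auto elim!: Ck_on_SucE simp: Suc.IH has_partial_add
          simp del: Ck_on.simps\<close>)
  qed
qed

lemma Ck_on_subset: "Ck_on k \<Omega> f \<Longrightarrow> \<Omega>' \<subseteq> \<Omega> \<Longrightarrow> Ck_on k \<Omega>' f"
  by (induction k arbitrary: f) (auto intro: continuous_on_subset)

lemma smooth_on_continuous_on: "smooth_on \<Omega> f \<Longrightarrow> continuous_on \<Omega> f"
  unfolding smooth_on_def using Ck_on_imp_continuous_on by blast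

lemma smooth_on_subset: "smooth_on \<Omega> f \<Longrightarrow> \<Omega>' \<subseteq> \<Omega> \<Longrightarrow> smooth_on \<Omega>' f"
  by (auto simp: smooth_on_def intro: Ck_on_subset)

lemma smooth_on_cong:
  "smooth_on \<Omega> f \<Longrightarrow> open \<Omega> \<Longrightarrow> (\<And>y. y \<in> \<Omega> \<Longrightarrow> f y = g y) \<Longrightarrow> smooth_on \<Omega> g"
  unfolding smooth_on_def using Ck_on_cong by blast

lemma smooth_on_add:
  "open \<Omega> \<Longrightarrow> smooth_on \<Omega> f \<Longrightarrow> smooth_on \<Omega> g \<Longrightarrow> smooth_on \<Omega> (\<lambda>x. f x + g x)"
  by (simp add: smooth_on_def Ck_on_add)

lemma smooth_on_linear:
  "open \<Omega> \<Longrightarrow> bounded_linear L \<Longrightarrow> smooth_on \<Omega> f \<Longrightarrow> smooth_on \<Omega> (\<lambda>x. L (f x))"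
  by (simp add: smooth_on_def Ck_on_linear)

lemma smooth_on_partial: "smooth_on \<Omega> f \<Longrightarrow> smooth_on \<Omega> (partial i f)"
  unfolding smooth_on_def
proof
  fix k assume "\<forall>k. Ck_on k \<Omega> f"
  then have "Ck_on (Suc k) \<Omega> f" by blast
  then show "Ck_on k \<Omega> (partial i f)" by simp
qed

lemma smooth_on_foldr_partial: "smooth_on \<Omega> f \<Longrightarrow> smooth_on \<Omega> (foldr partial xs f)"
  by (induction xs) (auto intro: smooth_on_partial)

lemma smooth_on_has_partial: "smooth_on \<Omega> f \<Longrightarrow> x \<in> \<Omega> \<Longrightarrow> has_partial i f (partial i f x) x"
  unfolding smooth_on_def by (auto dest: spec[of _ "Suc 0"] simp: has_partial_partial)

text \<open>\<open>foldr\<close> applies the head of the list last, so the induction hypothesis is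
  an identity of functions on \<Omega>; since \<Omega> is open, it may be differentiated once
  more.\<close>

lemma foldr_partial_linear:
  assumes "open \<Omega>" "bounded_linear L" "smooth_on \<Omega> f" "x \<in> \<Omega>"
  shows "foldr partial xs (\<lambda>x. L (f x)) x = L (foldr partial xs f x)"
  using assms(4)
proof (induction xs arbitrary: x)
  case (Cons i xs)
  have "partial i (foldr partial xs (\<lambda>x. L (f x))) x = partial i (\<lambda>x. L (foldr partial xs f x)) x"
    by (rule partial_cong[OF assms(1) Cons.prems Cons.IH])
  also have "\<dots> = L (partial i (foldr partial xs f) x)"
    by (rule partial_eqI, rule has_partial_linear[OF assms(2)], rule smooth_on_has_partial[OF _ Cons.prems],
        rule smooth_on_foldr_partial[OF assms(3)])
  finally show ?case by simp
qed simp

lemma foldr_partial_add: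
  assumes "open \<Omega>" "smooth_on \<Omega> f" "smooth_on \<Omega> g" "x \<in> \<Omega>"
  shows "foldr partial xs (\<lambda>x. f x + g x) x = foldr partial xs f x + foldr partial xs g x"
  using assms(4)
proof (induction xs arbitrary: x)
  case (Cons i xs)
  have "partial i (foldr partial xs (\<lambda>x. f x + g x)) x
      = partial i (\<lambda>x. foldr partial xs f x + foldr partial xs g x) x"
    by (rule partial_cong[OF assms(1) Cons.prems Cons.IH])
  also have "\<dots> = partial i (foldr partial xs f) x + partial i (foldr partial xs g) x"
    by (rule partial_eqI, rule has_partial_add;
        rule smooth_on_has_partial[OF _ Cons.prems], rule smooth_on_foldr_partial, fact)
  finally show ?case by simp
qed simp

section \<open>Nets of temperate growth\<close>

text \<open>For \<epsilon> in ]0,1] the value is at least 1, so exponents may be enlarged freely,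
  and sums and products of bounds remain bounds of the same kind.\<close>

definition weight :: "real \<Rightarrow> real ^ 'n::finite \<Rightarrow> real" where
  "weight \<epsilon> x = (1 + norm x) / \<epsilon>"

definition growth :: "(real \<Rightarrow> real ^ 'n::finite \<Rightarrow> 'b::real_normed_vector) \<Rightarrow> bool" where
  "growth u \<longleftrightarrow> (\<exists>C N. \<forall>\<epsilon>\<in>{0<..1}. \<forall>x. norm (u \<epsilon> x) \<le> C * weight \<epsilon> x ^ N)"

text \<open>Derivatives enter as existential witnesses, so closure proofs can supply formulas such
  as the product rule. The constants may depend on the derivative in question, but not on \<epsilon>
  or x.\<close>

fun temperate :: "nat \<Rightarrow> (real \<Rightarrow> real ^ 'n::finite \<Rightarrow> 'b::real_normed_vector) \<Rightarrow> bool" where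
  "temperate 0 u \<longleftrightarrow> growth u \<and> (\<forall>\<epsilon>\<in>{0<..1}. continuous_on UNIV (u \<epsilon>))"
| "temperate (Suc k) u \<longleftrightarrow> temperate 0 u \<and>
     (\<forall>i. \<exists>v. temperate k v \<and> (\<forall>\<epsilon>\<in>{0<..1}. \<forall>x. has_partial i (u \<epsilon>) (v \<epsilon> x) x))"

lemma weight_ge_1: "\<epsilon> \<in> {0<..1} \<Longrightarrow> weight \<epsilon> x \<ge> 1"
  by (simp add: weight_def divide_simps) (smt (verit) norm_ge_zero)

lemma growthI:
  "(\<And>\<epsilon> x. \<epsilon> \<in> {0<..1} \<Longrightarrow> norm (u \<epsilon> x) \<le> C * weight \<epsilon> x ^ N) \<Longrightarrow> growth u"
  unfolding growth_def by blast

lemma growthE: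
  assumes "growth u"
  obtains C N where "C \<ge> 0" "\<And>\<epsilon> x. \<epsilon> \<in> {0<..1} \<Longrightarrow> norm (u \<epsilon> x) \<le> C * weight \<epsilon> x ^ N"
proof -
  obtain C N where CN: "\<And>\<epsilon> x. \<epsilon> \<in> {0<..1} \<Longrightarrow> norm (u \<epsilon> x) \<le> C * weight \<epsilon> x ^ N"
    using assms unfolding growth_def by blast
  show thesis
  proof (rule that[of "\<bar>C\<bar>" N])
    fix \<epsilon> :: real and x :: "real ^ 'a" assume "\<epsilon> \<in> {0<..1}"
    then show "norm (u \<epsilon> x) \<le> \<bar>C\<bar> * weight \<epsilon> x ^ N"
      using CN[of \<epsilon> x] weight_ge_1[of \<epsilon> x]
      by (smt (verit) mult_right_mono zero_le_power)
  qed simp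
qed

lemma growth_mono:
  "growth u \<Longrightarrow> (\<And>\<epsilon> x. \<epsilon> \<in> {0<..1} \<Longrightarrow> norm (v \<epsilon> x) \<le> norm (u \<epsilon> x)) \<Longrightarrow> growth v"
  unfolding growth_def by (meson order_trans)

lemma growth_bounded:
  assumes "\<And>\<epsilon> x. \<epsilon> \<in> {0<..1} \<Longrightarrow> norm (u \<epsilon> x) \<le> C"
  shows "growth u"
  by (rule growthI[of _ C 0]) (use assms in simp)

lemma growth_add:
  assumes "growth u" "growth v"
  shows "growth (\<lambda>\<epsilon> x. u \<epsilon> x + v \<epsilon> x)"
proof -
  obtain C N where C: "C \<ge> 0" "\<And>\<epsilon> x. \<epsilon> \<in> {0<..1} \<Longrightarrow> norm (u \<epsilon> x) \<le> C * weight \<epsilon> x ^ N"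
    using growthE[OF assms(1)] by blast
  obtain D M where D: "D \<ge> 0" "\<And>\<epsilon> x. \<epsilon> \<in> {0<..1} \<Longrightarrow> norm (v \<epsilon> x) \<le> D * weight \<epsilon> x ^ M"
    using growthE[OF assms(2)] by blast
  show ?thesis
  \<comment> \<open>The sum is merely a convenient exponent above both \<open>N\<close> and
    \<open>M\<close>; powers of the weight increase with the exponent.\<close>
  proof (rule growthI[of _ "C + D" "N + M"])
    fix \<epsilon> :: real and x :: "real ^ 'a" assume e: "\<epsilon> \<in> {0<..1}"
    have "weight \<epsilon> x ^ N \<le> weight \<epsilon> x ^ (N + M)" "weight \<epsilon> x ^ M \<le> weight \<epsilon> x ^ (N + M)"
      by (auto intro!: power_increasing weight_ge_1[OF e])
    then have "C * weight \<epsilon> x ^ N \<le> C * weight \<epsilon> x ^ (N + M)" "D * weight \<epsilon> x ^ M \<le> D * weight \<epsilon> x ^ (N + M)"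
      using C(1) D(1) by (auto intro: mult_left_mono)
    then show "norm (u \<epsilon> x + v \<epsilon> x) \<le> (C + D) * weight \<epsilon> x ^ (N + M)"
      using norm_triangle_ineq[of "u \<epsilon> x" "v \<epsilon> x"] C(2)[OF e, of x] D(2)[OF e, of x]
      by (simp add: algebra_simps)
  qed
qed

lemma growth_mult:
  fixes u v :: "real \<Rightarrow> real ^ 'n::finite \<Rightarrow> 'b::real_normed_algebra"
  assumes "growth u" "growth v"
  shows "growth (\<lambda>\<epsilon> x. u \<epsilon> x * v \<epsilon> x)"
proof -
  obtain C N where C: "C \<ge> 0" "\<And>\<epsilon> x. \<epsilon> \<in> {0<..1} \<Longrightarrow> norm (u \<epsilon> x) \<le> C * weight \<epsilon> x ^ N"
    using growthE[OF assms(1)] by blast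
  obtain D M where D: "D \<ge> 0" "\<And>\<epsilon> x. \<epsilon> \<in> {0<..1} \<Longrightarrow> norm (v \<epsilon> x) \<le> D * weight \<epsilon> x ^ M"
    using growthE[OF assms(2)] by blast
  show ?thesis
  proof (rule growthI[of _ "C * D" "N + M"])
    fix \<epsilon> :: real and x :: "real ^ 'n" assume e: "\<epsilon> \<in> {0<..1}"
    have "norm (u \<epsilon> x * v \<epsilon> x) \<le> norm (u \<epsilon> x) * norm (v \<epsilon> x)" by (rule norm_mult_ineq)
    also have "\<dots> \<le> (C * weight \<epsilon> x ^ N) * (D * weight \<epsilon> x ^ M)"
      using weight_ge_1[OF e, of x] C(1) by (intro mult_mono C(2)[OF e] D(2)[OF e]) auto
    finally show "norm (u \<epsilon> x * v \<epsilon> x) \<le> C * D * weight \<epsilon> x ^ (N + M)"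
      by (simp add: power_add mult_ac)
  qed
qed

lemma growth_linear:
  assumes "bounded_linear L" "growth u"
  shows "growth (\<lambda>\<epsilon> x. L (u \<epsilon> x))"
proof -
  obtain C N where C: "C \<ge> 0" "\<And>\<epsilon> x. \<epsilon> \<in> {0<..1} \<Longrightarrow> norm (u \<epsilon> x) \<le> C * weight \<epsilon> x ^ N"
    using growthE[OF assms(2)] by blast
  obtain K where K: "K \<ge> 0" "\<And>y. norm (L y) \<le> norm y * K"
    using bounded_linear.nonneg_bounded[OF assms(1)] by blast
  have "norm (L (u \<epsilon> x)) \<le> (C * K) * weight \<epsilon> x ^ N" if "\<epsilon> \<in> {0<..1}" for \<epsilon> x
    using K(2)[of "u \<epsilon> x"] mult_right_mono[OF C(2)[OF that, of x] K(1)] by (simp add: mult_ac)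
  then show ?thesis by (rule growthI)
qed

lemma temperate_growth: "temperate k u \<Longrightarrow> growth u"
  by (cases k) auto

lemma temperate_continuous: "temperate k u \<Longrightarrow> \<epsilon> \<in> {0<..1} \<Longrightarrow> continuous_on UNIV (u \<epsilon>)"
  by (cases k) auto

lemma temperate_SucI:
  assumes "growth u" "\<And>\<epsilon>. \<epsilon> \<in> {0<..1} \<Longrightarrow> continuous_on UNIV (u \<epsilon>)"
    and "\<And>i. temperate k (v i)" "\<And>i \<epsilon> x. \<epsilon> \<in> {0<..1} \<Longrightarrow> has_partial i (u \<epsilon>) (v i \<epsilon> x) x"
  shows "temperate (Suc k) u"
  unfolding temperate.simps using assms by blast

lemma temperate_SucE:
  assumes "temperate (Suc k) u"
  obtains v where "\<And>i. temperate k (v i)" "\<And>i \<epsilon> x. \<epsilon> \<in> {0<..1} \<Longrightarrow> has_partial i (u \<epsilon>) (v i \<epsilon> x) x"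
proof -
  have "\<forall>i. \<exists>v. temperate k v \<and> (\<forall>\<epsilon>\<in>{0<..1}. \<forall>x. has_partial i (u \<epsilon>) (v \<epsilon> x) x)"
    using assms by simp
  then obtain v where "\<forall>i. temperate k (v i) \<and> (\<forall>\<epsilon>\<in>{0<..1}. \<forall>x. has_partial i (u \<epsilon>) (v i \<epsilon> x) x)"
    by (rule choice[THEN exE])
  then show thesis by (intro that[of v]) blast+
qed

section \<open>The algebra of temperate nets\<close>

lemma temperate_Suc_imp: "temperate (Suc k) u \<Longrightarrow> temperate k u"
proof (induction k arbitrary: u)
  case (Suc k)
  obtain v where v: "\<And>i. temperate (Suc k) (v i)"
    "\<And>i \<epsilon> x. \<epsilon> \<in> {0<..1} \<Longrightarrow> has_partial i (u \<epsilon>) (v i \<epsilon> x) x"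
    using temperate_SucE[OF Suc.prems] by metis
  show ?case
    by (rule temperate_SucI[of _ _ v])
      (use temperate_growth[OF Suc.prems] temperate_continuous[OF Suc.prems] v Suc.IH in auto)
qed simp

text \<open>Meant for prefactors that depend on \<epsilon> alone, such as \<epsilon>^2 in the
  cutoff. For them the hypothesis amounts to a bound by a power of 1/\<epsilon>, as x = 0
  shows.\<close>

lemma temperate_coeff:
  assumes "growth (\<lambda>\<epsilon> x :: real ^ 'n::finite. c \<epsilon>)"
  shows "temperate k (\<lambda>\<epsilon> x :: real ^ 'n. c \<epsilon>)"
proof (cases k)
  case 0
  then show ?thesis using assms by simp
next
  case (Suc k)
  \<comment> \<open>All derivatives of a coefficient net are the zero net, which is therefore
    settled first at every order.\<close>
  have "temperate k (\<lambda>\<epsilon> x :: real ^ 'n. 0 :: 'a)" for k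
  proof (induction k)
    case 0
    then show ?case by (simp add: growth_bounded[of _ 0])
  next
    case (Suc k)
    then show ?case
      by (intro temperate_SucI[of _ _ "\<lambda>_ _ _. 0"]) (auto simp: has_partial_def intro: growth_bounded[of _ 0])
  qed
  with assms show ?thesis
    unfolding Suc by (intro temperate_SucI[of _ _ "\<lambda>_ _ _. 0"]) (auto simp: has_partial_def)
qed

lemma temperate_const: "temperate k (\<lambda>_ _. c)"
  by (rule temperate_coeff) (rule growth_bounded[of _ "norm c"], simp)

lemma temperate_add:
  "temperate k u \<Longrightarrow> temperate k v \<Longrightarrow> temperate k (\<lambda>\<epsilon> x. u \<epsilon> x + v \<epsilon> x)"
proof (induction k arbitrary: u v)
  case 0
  then show ?case by (auto intro: growth_add continuous_on_add)
next
  case (Suc k)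
  obtain u' where u': "\<And>i. temperate k (u' i)"
    "\<And>i \<epsilon> x. \<epsilon> \<in> {0<..1} \<Longrightarrow> has_partial i (u \<epsilon>) (u' i \<epsilon> x) x"
    using temperate_SucE[OF Suc.prems(1)] by metis
  obtain v' where v': "\<And>i. temperate k (v' i)"
    "\<And>i \<epsilon> x. \<epsilon> \<in> {0<..1} \<Longrightarrow> has_partial i (v \<epsilon>) (v' i \<epsilon> x) x"
    using temperate_SucE[OF Suc.prems(2)] by metis
  show ?case
    by (rule temperate_SucI[of _ _ "\<lambda>i \<epsilon> x. u' i \<epsilon> x + v' i \<epsilon> x"])
      (use Suc u' v' in \<open>auto intro!: has_partial_add growth_add continuous_on_add
        dest: temperate_growth temperate_continuous simp del: temperate.simps\<close>)
qed

lemma temperate_mult: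
  fixes u v :: "real \<Rightarrow> real ^ 'n::finite \<Rightarrow> 'b::real_normed_algebra"
  shows "temperate k u \<Longrightarrow> temperate k v \<Longrightarrow> temperate k (\<lambda>\<epsilon> x. u \<epsilon> x * v \<epsilon> x)"
proof (induction k arbitrary: u v)
  case 0
  then show ?case by (auto intro: growth_mult continuous_on_mult)
next
  case (Suc k)
  obtain u' where u': "\<And>i. temperate k (u' i)"
    "\<And>i \<epsilon> x. \<epsilon> \<in> {0<..1} \<Longrightarrow> has_partial i (u \<epsilon>) (u' i \<epsilon> x) x"
    using temperate_SucE[OF Suc.prems(1)] by metis
  obtain v' where v': "\<And>i. temperate k (v' i)"
    "\<And>i \<epsilon> x. \<epsilon> \<in> {0<..1} \<Longrightarrow> has_partial i (v \<epsilon>) (v' i \<epsilon> x) x"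
    using temperate_SucE[OF Suc.prems(2)] by metis
  have "temperate k u" "temperate k v" using Suc.prems temperate_Suc_imp by auto
  then show ?case
    by (intro temperate_SucI[of _ _ "\<lambda>i \<epsilon> x. u \<epsilon> x * v' i \<epsilon> x + u' i \<epsilon> x * v \<epsilon> x"])
      (use Suc u' v' in \<open>auto intro!: has_partial_mult growth_mult continuous_on_mult temperate_add
        dest: temperate_growth temperate_continuous simp del: temperate.simps\<close>)
qed

lemma temperate_linear:
  assumes "bounded_linear L"
  shows "temperate k u \<Longrightarrow> temperate k (\<lambda>\<epsilon> x. L (u \<epsilon> x))"
proof (induction k arbitrary: u)
  case 0
  then show ?case by (auto intro: growth_linear[OF assms] bounded_linear.continuous_on[OF assms])
next
  case (Suc k)
  obtain u' where u': "\<And>i. temperate k (u' i)"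
    "\<And>i \<epsilon> x. \<epsilon> \<in> {0<..1} \<Longrightarrow> has_partial i (u \<epsilon>) (u' i \<epsilon> x) x"
    using temperate_SucE[OF Suc.prems(1)] by metis
  show ?case
    by (rule temperate_SucI[of _ _ "\<lambda>i \<epsilon> x. L (u' i \<epsilon> x)"])
      (use Suc u' in \<open>auto intro!: has_partial_linear[OF assms] growth_linear[OF assms]
        bounded_linear.continuous_on[OF assms] dest: temperate_growth temperate_continuous
        simp del: temperate.simps\<close>)
qed

lemma temperate_sum:
  assumes "finite I" "\<And>j. j \<in> I \<Longrightarrow> temperate k (u j)"
  shows "temperate k (\<lambda>\<epsilon> x. \<Sum>j\<in>I. u j \<epsilon> x)"
  using assms by (induction I rule: finite_induct) (simp_all add: temperate_const temperate_add)

text \<open>The derivative -(1/u)^2 u' is a product of nets already known to be temperate of one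
  order less. Hence a bound on 1/u itself is all that has to be supplied; bounds on its derivatives
  follow.\<close>

lemma temperate_inverse:
  fixes u :: "real \<Rightarrow> real ^ 'n::finite \<Rightarrow> real"
  assumes "growth (\<lambda>\<epsilon> x. inverse (u \<epsilon> x))" "\<And>\<epsilon> x. \<epsilon> \<in> {0<..1} \<Longrightarrow> u \<epsilon> x \<noteq> 0"
  shows "temperate k u \<Longrightarrow> temperate k (\<lambda>\<epsilon> x. inverse (u \<epsilon> x))"
proof (induction k)
  case 0
  then show ?case using assms by (auto intro!: continuous_on_inverse)
next
  case (Suc k)
  obtain u' where u': "\<And>i. temperate k (u' i)"
    "\<And>i \<epsilon> x. \<epsilon> \<in> {0<..1} \<Longrightarrow> has_partial i (u \<epsilon>) (u' i \<epsilon> x) x"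
    using temperate_SucE[OF Suc.prems(1)] by metis
  have IH: "temperate k (\<lambda>\<epsilon> x. inverse (u \<epsilon> x))"
    using Suc.IH temperate_Suc_imp[OF Suc.prems] by blast
  show ?case
  proof (rule temperate_SucI[of _ _ "\<lambda>i \<epsilon> x. - (inverse (u \<epsilon> x) * inverse (u \<epsilon> x)) * u' i \<epsilon> x"])
    show "temperate k (\<lambda>\<epsilon> x. - (inverse (u \<epsilon> x) * inverse (u \<epsilon> x)) * u' i \<epsilon> x)" for i
      by (intro temperate_mult temperate_linear[OF bounded_linear_minus[OF bounded_linear_ident]] IH u')
    show "has_partial i (\<lambda>x. inverse (u \<epsilon> x)) (- (inverse (u \<epsilon> x) * inverse (u \<epsilon> x)) * u' i \<epsilon> x) x"
      if "\<epsilon> \<in> {0<..1}" for i \<epsilon> x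
      by (rule has_partial_compose[OF _ u'(2)[OF that]])
        (use DERIV_inverse[OF assms(2)[OF that, of x]] in \<open>simp add: power2_eq_square\<close>)
  qed (use assms temperate_continuous[OF Suc.prems] in \<open>auto intro!: continuous_on_inverse\<close>)
qed

text \<open>The estimate sqrt t \<le> 1 + t keeps the exponent a natural number.\<close>

lemma growth_sqrt:
  fixes u :: "real \<Rightarrow> real ^ 'n::finite \<Rightarrow> real"
  assumes "growth u" "\<And>\<epsilon> x. \<epsilon> \<in> {0<..1} \<Longrightarrow> u \<epsilon> x \<ge> 0"
  shows "growth (\<lambda>\<epsilon> x. sqrt (u \<epsilon> x))"
proof (rule growth_mono)
  show "growth (\<lambda>\<epsilon> x. 1 + u \<epsilon> x)"
    by (rule growth_add[OF growth_bounded[of _ 1] assms(1)]) simp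
  fix \<epsilon> :: real and x :: "real ^ 'n" assume "\<epsilon> \<in> {0<..1}"
  then have "u \<epsilon> x \<ge> 0" by (rule assms(2))
  then have "sqrt (u \<epsilon> x) \<le> 1 + u \<epsilon> x"
    by (intro real_le_lsqrt) (auto simp: power2_eq_square algebra_simps)
  then show "norm (sqrt (u \<epsilon> x)) \<le> norm (1 + u \<epsilon> x)" using \<open>u \<epsilon> x \<ge> 0\<close> by simp
qed

text \<open>Writing 1/sqrt u as sqrt u times 1/u expresses the derivative through the net sqrt u
  itself, covered by the induction hypothesis, and through 1/u, covered by
  \<open>temperate_inverse\<close>.\<close>

lemma temperate_sqrt:
  fixes u :: "real \<Rightarrow> real ^ 'n::finite \<Rightarrow> real"
  assumes "growth (\<lambda>\<epsilon> x. inverse (u \<epsilon> x))" "\<And>\<epsilon> x. \<epsilon> \<in> {0<..1} \<Longrightarrow> u \<epsilon> x > 0"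
  shows "temperate k u \<Longrightarrow> temperate k (\<lambda>\<epsilon> x. sqrt (u \<epsilon> x))"
proof (induction k)
  case 0
  then show ?case using assms by (auto intro!: continuous_on_real_sqrt growth_sqrt less_imp_le)
next
  case (Suc k)
  obtain u' where u': "\<And>i. temperate k (u' i)"
    "\<And>i \<epsilon> x. \<epsilon> \<in> {0<..1} \<Longrightarrow> has_partial i (u \<epsilon>) (u' i \<epsilon> x) x"
    using temperate_SucE[OF Suc.prems(1)] by metis
  have u: "temperate k u" by (rule temperate_Suc_imp[OF Suc.prems])
  have IH: "temperate k (\<lambda>\<epsilon> x. sqrt (u \<epsilon> x))" by (rule Suc.IH[OF u])
  have inv: "temperate k (\<lambda>\<epsilon> x. inverse (u \<epsilon> x))"
    by (rule temperate_inverse[OF assms(1) _ u]) (rule assms(2)[THEN less_imp_neq, symmetric])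
  show ?case
  proof (rule temperate_SucI[of _ _ "\<lambda>i \<epsilon> x. (1/2 * (sqrt (u \<epsilon> x) * inverse (u \<epsilon> x))) * u' i \<epsilon> x"])
    show "temperate k (\<lambda>\<epsilon> x. (1/2 * (sqrt (u \<epsilon> x) * inverse (u \<epsilon> x))) * u' i \<epsilon> x)" for i
      by (intro temperate_mult temperate_const IH inv u')
    show "has_partial i (\<lambda>x. sqrt (u \<epsilon> x)) ((1/2 * (sqrt (u \<epsilon> x) * inverse (u \<epsilon> x))) * u' i \<epsilon> x) x"
      if "\<epsilon> \<in> {0<..1}" for i \<epsilon> x
    proof (rule has_partial_compose[OF _ u'(2)[OF that]])
      have "inverse (sqrt (u \<epsilon> x)) / 2 = 1/2 * (sqrt (u \<epsilon> x) * inverse (u \<epsilon> x))"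
        using assms(2)[OF that, of x] by (simp add: field_simps)
      then show "(sqrt has_real_derivative 1/2 * (sqrt (u \<epsilon> x) * inverse (u \<epsilon> x))) (at (u \<epsilon> x))"
        using DERIV_real_sqrt[OF assms(2)[OF that, of x]] by simp
    qed
  qed (use assms temperate_continuous[OF Suc.prems] temperate_growth[OF Suc.prems] in
      \<open>auto intro!: continuous_on_real_sqrt growth_sqrt less_imp_le\<close>)
qed

lemma has_partial_coordinate: "has_partial i (\<lambda>x. x $ j) (if i = j then 1 else 0) x"
  unfolding has_partial_def
  by (auto intro!: derivative_eq_intros simp: axis_def simp flip: has_real_derivative_iff_has_vector_derivative)

lemma growth_coordinate: "growth (\<lambda>\<epsilon> x. x $ j)"
proof (rule growthI[of _ 1 1])
  fix \<epsilon> :: real and x :: "real ^ 'a" assume e: "\<epsilon> \<in> {0<..1}"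
  have "\<bar>x $ j\<bar> \<le> 1 + norm x" using component_le_norm_cart[of x j] by simp
  also have "\<dots> \<le> weight \<epsilon> x"
    unfolding weight_def using e mult_left_le[of \<epsilon> "1 + norm x"] by (simp add: field_simps)
  finally show "norm (x $ j) \<le> 1 * weight \<epsilon> x ^ 1" by simp
qed

lemma temperate_coordinate: "temperate k (\<lambda>\<epsilon> x. x $ j)"
proof (cases k)
  case 0
  then show ?thesis by (auto intro: growth_coordinate continuous_intros)
next
  case (Suc k)
  show ?thesis unfolding Suc
    by (rule temperate_SucI[of _ _ "\<lambda>i _ _. if i = j then 1 else 0"])
      (auto intro!: growth_coordinate temperate_const has_partial_coordinate continuous_intros split del: if_split)
qed

text \<open>The squared norm is a polynomial in the coordinates; the norm is not differentiable at
  0. This is why the cutoff is built from squares.\<close>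

lemma temperate_norm_sq: "temperate k (\<lambda>\<epsilon> x. (norm x)\<^sup>2)"
proof -
  have "(norm x)\<^sup>2 = (\<Sum>j\<in>UNIV. x $ j * x $ j)" for x :: "real ^ 'a"
    by (simp add: norm_vec_def L2_set_def sum_nonneg power2_eq_square)
  then show ?thesis by (simp add: temperate_sum temperate_mult temperate_coordinate)
qed

lemma temperate_Ck_on: "temperate k u \<Longrightarrow> \<epsilon> \<in> {0<..1} \<Longrightarrow> Ck_on k UNIV (u \<epsilon>)"
proof (induction k arbitrary: u)
  case (Suc k)
  obtain v where v: "\<And>i. temperate k (v i)"
    "\<And>i \<epsilon> x. \<epsilon> \<in> {0<..1} \<Longrightarrow> has_partial i (u \<epsilon>) (v i \<epsilon> x) x"
    using temperate_SucE[OF Suc.prems(1)] by metis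
  show ?case
    by (rule Ck_on_SucI) (use v Suc temperate_continuous[OF Suc.prems(1)] in blast)+
qed simp

text \<open>Two nets occur because the witness for the first derivative agrees with
  \<open>partial i (u' \<epsilon>)\<close> for \<epsilon> in ]0,1] only. The induction removes the
  last index, since \<open>foldr\<close> applies that one first.\<close>

lemma temperate_growth_foldr_partial:
  assumes "temperate (length xs) u" "\<And>\<epsilon>. \<epsilon> \<in> {0<..1} \<Longrightarrow> u \<epsilon> = u' \<epsilon>"
  shows "growth (\<lambda>\<epsilon>. foldr partial xs (u' \<epsilon>))"
  using assms
proof (induction xs arbitrary: u u' rule: rev_induct)
  case Nil
  then have "growth u" by simp
  then show ?case by (rule growth_mono) (simp add: Nil)
next
  case (snoc i xs)
  obtain v where v: "\<And>i. temperate (length xs) (v i)"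
    "\<And>i \<epsilon> x. \<epsilon> \<in> {0<..1} \<Longrightarrow> has_partial i (u \<epsilon>) (v i \<epsilon> x) x"
    using temperate_SucE[of "length xs" u] snoc.prems(1) by auto
  have "growth (\<lambda>\<epsilon>. foldr partial xs (partial i (u' \<epsilon>)))"
  proof (rule snoc.IH[OF v(1)])
    show "v i \<epsilon> = partial i (u' \<epsilon>)" if "\<epsilon> \<in> {0<..1}" for \<epsilon>
      using partial_eqI[OF v(2)[OF that]] snoc.prems(2)[OF that] by auto
  qed
  then show ?case by simp
qed

section \<open>Symmetry of iterated partial derivatives\<close>

text \<open>Moves the base point along the axis from parameter 0 to \<open>s\<close>, so that the
  mean value theorem can be used on a segment.\<close>

lemma has_partial_imp_DERIV:
  fixes f :: "real ^ 'n::finite \<Rightarrow> real"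
  assumes "has_partial i f d (y + s *\<^sub>R axis i 1)"
  shows "((\<lambda>s. f (y + s *\<^sub>R axis i 1)) has_real_derivative d) (at s)"
proof -
  have "((\<lambda>t. f (y + (t + s) *\<^sub>R axis i 1)) has_real_derivative d) (at 0)"
    using assms unfolding has_partial_def has_real_derivative_iff_has_vector_derivative
    by (simp add: scaleR_add_left add_ac)
  then show ?thesis
    using DERIV_shift[of "\<lambda>s. f (y + s *\<^sub>R axis i 1)" d 0 s] by simp
qed

text \<open>The mean value theorem is used twice: in direction i on the increment of f in direction
  j, then in direction j on \<open>partial i f\<close>. The second difference is symmetric in i and
  j although the right-hand side is not, and this yields the symmetry of mixed partials.\<close>

lemma second_difference_mean_value:
  fixes f :: "real ^ 'n::finite \<Rightarrow> real"
  assumes "smooth_on UNIV f" "h > 0"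
  shows "\<exists>p. dist p x \<le> 2 * h \<and>
    f (x + h *\<^sub>R axis i 1 + h *\<^sub>R axis j 1) - f (x + h *\<^sub>R axis i 1) - f (x + h *\<^sub>R axis j 1) + f x
      = h * h * partial j (partial i f) p"
proof -
  define \<phi> where "\<phi> s = f (x + h *\<^sub>R axis j 1 + s *\<^sub>R axis i 1) - f (x + s *\<^sub>R axis i 1)" for s
  have "\<exists>\<xi>. 0 < \<xi> \<and> \<xi> < h \<and> \<phi> h - \<phi> 0 = (h - 0) *
    (partial i f (x + h *\<^sub>R axis j 1 + \<xi> *\<^sub>R axis i 1) - partial i f (x + \<xi> *\<^sub>R axis i 1))"
  proof (rule MVT2[OF assms(2)])
    show "(\<phi> has_real_derivative
      partial i f (x + h *\<^sub>R axis j 1 + s *\<^sub>R axis i 1) - partial i f (x + s *\<^sub>R axis i 1)) (at s)" for s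
      unfolding \<phi>_def
      by (rule DERIV_diff; rule has_partial_imp_DERIV; rule smooth_on_has_partial[OF assms(1)]; simp)
  qed
  then obtain \<xi> where \<xi>: "0 < \<xi>" "\<xi> < h" "\<phi> h - \<phi> 0 = h *
    (partial i f (x + h *\<^sub>R axis j 1 + \<xi> *\<^sub>R axis i 1) - partial i f (x + \<xi> *\<^sub>R axis i 1))"
    by auto
  define \<psi> where "\<psi> t = partial i f (x + \<xi> *\<^sub>R axis i 1 + t *\<^sub>R axis j 1)" for t
  have "\<exists>\<eta>. 0 < \<eta> \<and> \<eta> < h \<and> \<psi> h - \<psi> 0 = (h - 0) *
    partial j (partial i f) (x + \<xi> *\<^sub>R axis i 1 + \<eta> *\<^sub>R axis j 1)"
    unfolding \<psi>_def
    by (rule MVT2[OF assms(2)], rule has_partial_imp_DERIV,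
        rule smooth_on_has_partial[OF smooth_on_partial[OF assms(1)]]) simp
  then obtain \<eta> where \<eta>: "0 < \<eta>" "\<eta> < h" "\<psi> h - \<psi> 0 = h *
    partial j (partial i f) (x + \<xi> *\<^sub>R axis i 1 + \<eta> *\<^sub>R axis j 1)"
    by auto
  let ?p = "x + \<xi> *\<^sub>R axis i 1 + \<eta> *\<^sub>R axis j 1"
  have "dist ?p x = norm (\<xi> *\<^sub>R axis i (1::real) + \<eta> *\<^sub>R axis j 1)"
    by (simp add: dist_norm)
  also have "\<dots> \<le> norm (\<xi> *\<^sub>R axis i (1::real)) + norm (\<eta> *\<^sub>R axis j (1::real))"
    by (rule norm_triangle_ineq)
  also have "\<dots> \<le> 2 * h" using \<xi> \<eta> using \<xi> \<eta> by simp
  finally have "dist ?p x \<le> 2 * h" .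
  moreover have "\<phi> h - \<phi> 0 = h * (\<psi> h - \<psi> 0)"
    using \<xi>(3) by (simp add: \<psi>_def add_ac)
  then have "\<phi> h - \<phi> 0 = h * h * partial j (partial i f) ?p"
    using \<eta>(3) by simp
  ultimately show ?thesis
    by (intro exI[of _ ?p]) (simp add: \<phi>_def algebra_simps)
qed

lemma partial_commute:
  fixes f :: "real ^ 'n::finite \<Rightarrow> real"
  assumes "smooth_on UNIV f"
  shows "partial i (partial j f) = partial j (partial i f)"
proof
  fix x
  define h where "h n = inverse (real (Suc n))" for n
  have h: "h n > 0" "h \<longlonglongrightarrow> 0" for n
    unfolding h_def by (simp_all only: LIMSEQ_inverse_real_of_nat) simp
  \<comment> \<open>Both iterated partials represent the same second difference, each at its own
    intermediate point. As \<open>h n\<close> tends to 0 the points tend to x, and continuity of the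
    second partials finishes the argument.\<close>
  have "\<exists>p q. dist p x \<le> 2 * h n \<and> dist q x \<le> 2 * h n \<and>
      partial j (partial i f) p = partial i (partial j f) q" for n
  proof -
    obtain p where p: "dist p x \<le> 2 * h n"
      "f (x + h n *\<^sub>R axis i 1 + h n *\<^sub>R axis j 1) - f (x + h n *\<^sub>R axis i 1) - f (x + h n *\<^sub>R axis j 1) + f x
        = h n * h n * partial j (partial i f) p"
      using second_difference_mean_value[OF assms h(1)] by metis
    obtain q where q: "dist q x \<le> 2 * h n"
      "f (x + h n *\<^sub>R axis j 1 + h n *\<^sub>R axis i 1) - f (x + h n *\<^sub>R axis j 1) - f (x + h n *\<^sub>R axis i 1) + f x
        = h n * h n * partial i (partial j f) q"
      using second_difference_mean_value[OF assms h(1)] by metis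
    have "h n * h n * partial j (partial i f) p = h n * h n * partial i (partial j f) q"
      unfolding p(2)[symmetric] q(2)[symmetric] by (simp add: algebra_simps)
    then show ?thesis using p(1) q(1) h(1)[of n] by auto
  qed
  then have "\<forall>n. \<exists>p q. dist p x \<le> 2 * h n \<and> dist q x \<le> 2 * h n \<and>
      partial j (partial i f) p = partial i (partial j f) q" by blast
  from choice[OF this] obtain p where "\<forall>n. \<exists>q. dist (p n) x \<le> 2 * h n \<and> dist q x \<le> 2 * h n \<and>
      partial j (partial i f) (p n) = partial i (partial j f) q" by blast
  from choice[OF this] obtain q where pq: "\<And>n. dist (p n) x \<le> 2 * h n" "\<And>n. dist (q n) x \<le> 2 * h n"
      "\<And>n. partial j (partial i f) (p n) = partial i (partial j f) (q n)" by blast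
  have lim: "r \<longlonglongrightarrow> x" if "\<And>n. dist (r n) x \<le> 2 * h n" for r
  proof -
    have "(\<lambda>n. 2 * h n) \<longlonglongrightarrow> 0" by (rule tendsto_mult_right_zero[OF h(2)])
    then have "(\<lambda>n. dist (r n) x) \<longlonglongrightarrow> 0"
      by (rule tendsto_sandwich[OF _ _ tendsto_const, rotated 2])
        (rule always_eventually, rule allI, fact that zero_le_dist)+
    then show ?thesis by (rule tendsto_dist_iff[THEN iffD2])
  qed
  have cont: "continuous_on UNIV (partial k (partial l f))" for k l
    by (intro smooth_on_continuous_on smooth_on_partial assms)
  have "(\<lambda>n. partial j (partial i f) (p n)) \<longlonglongrightarrow> partial j (partial i f) x"
    "(\<lambda>n. partial i (partial j f) (q n)) \<longlonglongrightarrow> partial i (partial j f) x"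
    by (rule continuous_on_tendsto_compose[OF cont lim]; use pq in simp)+
  then show "partial i (partial j f) x = partial j (partial i f) x"
    unfolding pq(3) using LIMSEQ_unique by blast
qed

text \<open>Needed because \<open>mpartial\<close> picks its index list by choice. The head of
  \<open>xs\<close> is located in \<open>ys\<close> and commuted past everything to its
  left.\<close>

lemma foldr_partial_mset:
  fixes f :: "real ^ 'n::finite \<Rightarrow> real"
  assumes "smooth_on UNIV f" "mset xs = mset ys"
  shows "foldr partial xs f = foldr partial ys f"
  using assms(2)
proof (induction xs arbitrary: ys)
  case (Cons i xs)
  then have "i \<in> set ys" by (metis list.set_intros(1) set_mset_mset)
  then obtain us vs where ys: "ys = us @ i # vs" by (meson split_list)
  have "foldr partial us (partial i g) = partial i (foldr partial us g)"
    if "smooth_on UNIV g" for us and g :: "real ^ 'n \<Rightarrow> real"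
  proof (induction us)
    case (Cons j us)
    then show ?case
      using partial_commute[OF smooth_on_foldr_partial[OF that]] by simp
  qed simp
  from this[OF smooth_on_foldr_partial[OF assms(1)]]
  have "foldr partial ys f = partial i (foldr partial (us @ vs) f)"
    by (simp add: ys)
  moreover have "foldr partial xs f = foldr partial (us @ vs) f"
    by (rule Cons.IH) (use Cons.prems ys in simp)
  ultimately show ?case by simp
qed simp

section \<open>Smooth functions with bounded derivatives\<close>

text \<open>Index lists replace multi-indices, and bounds hold everywhere instead of almost
  everywhere. In this form the class is visibly stable under \<open>partial\<close>: append the
  index to the list.\<close>

definition bounded_smooth :: "(real ^ 'n::finite \<Rightarrow> real) \<Rightarrow> bool" where
  "bounded_smooth f \<longleftrightarrow> smooth_on UNIV f \<and> (\<forall>xs. \<exists>C. \<forall>x. \<bar>foldr partial xs f x\<bar> \<le> C)"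

lemma bounded_smooth_partial: "bounded_smooth f \<Longrightarrow> bounded_smooth (partial i f)"
  unfolding bounded_smooth_def
proof safe
  fix xs assume "\<forall>xs. \<exists>C. \<forall>x. \<bar>foldr partial xs f x\<bar> \<le> C"
  from spec[OF this, of "xs @ [i]"]
  show "\<exists>C. \<forall>x. \<bar>foldr partial xs (partial i f) x\<bar> \<le> C" by simp
qed (rule smooth_on_partial)

lemma bounded_smoothE:
  assumes "bounded_smooth f"
  obtains C where "\<And>x. \<bar>f x\<bar> \<le> C"
  using assms unfolding bounded_smooth_def by (metis foldr.simps(1) id_apply)

text \<open>The exceptional set is open by continuity, and an open set of measure zero is
  empty.\<close>

lemma continuous_AE_bounded:
  fixes f :: "real ^ 'n::finite \<Rightarrow> real"
  assumes "continuous_on UNIV f" "AE x in lebesgue. \<bar>f x\<bar> \<le> C"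
  shows "\<bar>f x\<bar> \<le> C"
proof -
  have "open {x. C < \<bar>f x\<bar>}"
    by (rule open_Collect_less) (intro continuous_intros assms)+
  moreover have "negligible {x. C < \<bar>f x\<bar>}"
    using assms(2) calculation by (auto simp: negligible_iff_null_sets AE_iff_null_sets not_le)
  ultimately have "{x. C < \<bar>f x\<bar>} = {}" using open_not_negligible by blast
  then show ?thesis by (force simp: not_less)
qed

lemma W_inf_inf_imp_bounded_smooth:
  fixes f :: "real ^ 'n::finite \<Rightarrow> real"
  assumes "f \<in> W_inf_inf"
  shows "bounded_smooth f"
  unfolding bounded_smooth_def
proof safe
  show smooth: "smooth_on UNIV f" using assms by (simp add: W_inf_inf_def)
  fix xs :: "'n list"
  \<comment> \<open>The rearrangement of \<open>xs\<close> that \<open>mpartial\<close> happens to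
    choose; the hypothesis bounds the derivative taken in this order.\<close>
  define ys where "ys = (SOME ys. \<forall>i. count_list ys i = count_list xs i)"
  have "\<forall>i. count_list ys i = count_list xs i"
    unfolding ys_def by (rule someI_ex) blast
  then have "mset ys = mset xs"
    by (intro multiset_eqI) (simp add: count_mset)
  then have eq: "mpartial (count_list xs) f = foldr partial xs f"
    unfolding mpartial_def ys_def[symmetric] by (rule foldr_partial_mset[OF smooth])
  then have "in_Linf (foldr partial xs f)"
    using assms by (auto simp: W_inf_inf_def simp flip: eq)
  then obtain C where "AE x in lebesgue. \<bar>foldr partial xs f x\<bar> \<le> C"
    by (auto simp: in_Linf_def)
  then have "\<bar>foldr partial xs f x\<bar> \<le> C" for x
    by (rule continuous_AE_bounded[OF smooth_on_continuous_on[OF smooth_on_foldr_partial[OF smooth]]])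
  then show "\<exists>C. \<forall>x. \<bar>foldr partial xs f x\<bar> \<le> C" by blast
qed

section \<open>Convolution with a finite measure\<close>

locale borel_prob = prob_space M for M :: "(real ^ 'n::finite) measure" +
  assumes sets_M: "sets M = sets borel"

lemma (in borel_prob) rescaled_measurable:
  fixes f :: "real ^ 'n \<Rightarrow> real" and \<epsilon> :: real
  assumes "continuous_on UNIV f"
  shows "(\<lambda>y. f ((x - y) /\<^sub>R \<epsilon>)) \<in> borel_measurable M"
  unfolding measurable_cong_sets[OF sets_M refl]
  by (intro borel_measurable_continuous_onI continuous_on_compose2[OF assms] continuous_intros) simp

lemma (in borel_prob) integrable_rescaled:
  fixes f :: "real ^ 'n \<Rightarrow> real" and \<epsilon> :: real
  assumes "continuous_on UNIV f" "\<And>x. \<bar>f x\<bar> \<le> B"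
  shows "integrable M (\<lambda>y. f ((x - y) /\<^sub>R \<epsilon>))"
  by (rule integrable_const_bound[of _ B]) (use assms rescaled_measurable in auto)

lemma (in borel_prob) continuous_on_rescaled_integral:
  fixes f :: "real ^ 'n \<Rightarrow> real" and \<epsilon> :: real
  assumes "continuous_on UNIV f" "\<And>x. \<bar>f x\<bar> \<le> C"
  shows "continuous_on UNIV (\<lambda>x. \<integral>y. f ((x - y) /\<^sub>R \<epsilon>) \<partial>M)"
proof (rule continuous_on_sequentiallyI)
  fix X :: "nat \<Rightarrow> real ^ 'n" and a assume X: "X \<longlonglongrightarrow> a"
  show "(\<lambda>n. \<integral>y. f ((X n - y) /\<^sub>R \<epsilon>) \<partial>M) \<longlonglongrightarrow> (\<integral>y. f ((a - y) /\<^sub>R \<epsilon>) \<partial>M)"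
  proof (rule integral_dominated_convergence[where w = "\<lambda>_. C"])
    show "AE y in M. (\<lambda>n. f ((X n - y) /\<^sub>R \<epsilon>)) \<longlonglongrightarrow> f ((a - y) /\<^sub>R \<epsilon>)"
      by (intro AE_I2 continuous_on_tendsto_compose[OF assms(1)] tendsto_intros X) auto
  qed (use rescaled_measurable assms in auto)
qed

lemma (in borel_prob) abs_rescaled_integral_le:
  fixes f :: "real ^ 'n \<Rightarrow> real" and \<epsilon> :: real
  assumes "continuous_on UNIV f" "\<And>x. \<bar>f x\<bar> \<le> B"
  shows "\<bar>\<integral>y. f ((x - y) /\<^sub>R \<epsilon>) \<partial>M\<bar> \<le> B"
proof -
  have "\<bar>\<integral>y. f ((x - y) /\<^sub>R \<epsilon>) \<partial>M\<bar> \<le> (\<integral>y. \<bar>f ((x - y) /\<^sub>R \<epsilon>)\<bar> \<partial>M)" by (rule integral_abs_bound)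
  also have "\<dots> \<le> (\<integral>y. B \<partial>M)"
  proof (rule integral_mono)
    show "integrable M (\<lambda>y. \<bar>f ((x - y) /\<^sub>R \<epsilon>)\<bar>)"
      by (intro integrable_abs integrable_rescaled[OF assms])
  qed (use assms(2) in auto)
  finally show ?thesis by (simp add: prob_space)
qed

text \<open>Differentiation under the integral: the bound on \<open>g\<close> makes the difference
  quotients at most \<open>C / \<epsilon>\<close>, and constants are integrable for a probability
  measure, so dominated convergence applies.\<close>

lemma (in borel_prob) has_partial_rescaled_integral:
  fixes f :: "real ^ 'n \<Rightarrow> real" and \<epsilon> :: real
  assumes "\<epsilon> > 0"
    and f: "continuous_on UNIV f" "\<And>x. \<bar>f x\<bar> \<le> B"
    and g: "continuous_on UNIV g" "\<And>x. \<bar>g x\<bar> \<le> C"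
    and fg: "\<And>x. has_partial i f (g x) x"
  shows "has_partial i (\<lambda>x. \<integral>y. f ((x - y) /\<^sub>R \<epsilon>) \<partial>M) ((\<integral>y. g ((x - y) /\<^sub>R \<epsilon>) \<partial>M) / \<epsilon>) x"
proof -
  \<comment> \<open>In the rescaled variable the point moves along the axis with parameter
    \<open>t / \<epsilon>\<close>, so the hypothesis on \<open>f\<close> applies directly and the
    chain rule yields the factor 1/\<epsilon>.\<close>
  define q where "q y t = f ((x - y) /\<^sub>R \<epsilon> + (t / \<epsilon>) *\<^sub>R axis i 1)" for y t
  have q: "q y t = f ((x + t *\<^sub>R axis i 1 - y) /\<^sub>R \<epsilon>)" for y t
    unfolding q_def by (simp add: algebra_simps divide_inverse)
  have int: "integrable M (\<lambda>y. q y t)" for t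
    unfolding q by (rule integrable_rescaled[OF f])
  have deriv: "(q y has_real_derivative g ((x - y) /\<^sub>R \<epsilon> + (t / \<epsilon>) *\<^sub>R axis i 1) / \<epsilon>) (at t)" for y t
  proof -
    have "((\<lambda>s. f ((x - y) /\<^sub>R \<epsilon> + s *\<^sub>R axis i 1)) has_real_derivative
        g ((x - y) /\<^sub>R \<epsilon> + (t / \<epsilon>) *\<^sub>R axis i 1)) (at (t / \<epsilon>))"
      by (rule has_partial_imp_DERIV[OF fg])
    moreover have "((\<lambda>t. t / \<epsilon>) has_real_derivative 1 / \<epsilon>) (at t)"
      by (rule DERIV_cdivide[OF DERIV_ident])
    ultimately show ?thesis unfolding q_def using DERIV_chain2 by fastforce
  qed
  have lip: "\<bar>q y t - q y 0\<bar> \<le> C / \<epsilon> * \<bar>t\<bar>" for y t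
  proof -
    have "norm (q y t - q y 0) \<le> (C / \<epsilon>) * norm (t - 0)"
      by (rule field_differentiable_bound[of UNIV "q y"
            "\<lambda>t. g ((x - y) /\<^sub>R \<epsilon> + (t / \<epsilon>) *\<^sub>R axis i 1) / \<epsilon>"])
        (use deriv g \<open>\<epsilon> > 0\<close> in \<open>auto intro!: divide_right_mono\<close>)
    then show ?thesis by simp
  qed
  have "((\<lambda>t. \<integral>y. q y t \<partial>M) has_real_derivative (\<integral>y. g ((x - y) /\<^sub>R \<epsilon>) / \<epsilon> \<partial>M)) (at 0)"
    unfolding DERIV_def tendsto_at_iff_sequentially
  proof (intro allI impI)
    fix X :: "nat \<Rightarrow> real" assume X: "\<forall>n. X n \<in> UNIV - {0}" "X \<longlonglongrightarrow> 0"
    have "(\<lambda>n. \<integral>y. (q y (X n) - q y 0) / X n \<partial>M) \<longlonglongrightarrow> (\<integral>y. g ((x - y) /\<^sub>R \<epsilon>) / \<epsilon> \<partial>M)"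
    proof (rule integral_dominated_convergence[where w = "\<lambda>_. C / \<epsilon>"])
      show "AE y in M. (\<lambda>n. (q y (X n) - q y 0) / X n) \<longlonglongrightarrow> g ((x - y) /\<^sub>R \<epsilon>) / \<epsilon>"
      proof (rule AE_I2)
        fix y
        have "((\<lambda>h. (q y (0 + h) - q y 0) / h) \<longlongrightarrow> g ((x - y) /\<^sub>R \<epsilon>) / \<epsilon>) (at 0)"
          using deriv[of y 0] by (simp add: DERIV_def)
        then show "(\<lambda>n. (q y (X n) - q y 0) / X n) \<longlonglongrightarrow> g ((x - y) /\<^sub>R \<epsilon>) / \<epsilon>"
          unfolding tendsto_at_iff_sequentially using X by (auto simp: o_def)
      qed
      show "AE y in M. norm ((q y (X n) - q y 0) / X n) \<le> C / \<epsilon>" for n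
        using lip[of _ "X n"] X(1) by (intro AE_I2) (auto simp: abs_divide divide_le_eq)
    qed (use int rescaled_measurable[OF g(1)] in auto)
    then show "((\<lambda>h. ((\<integral>y. q y (0 + h) \<partial>M) - (\<integral>y. q y 0 \<partial>M)) / h) \<circ> X)
        \<longlonglongrightarrow> (\<integral>y. g ((x - y) /\<^sub>R \<epsilon>) / \<epsilon> \<partial>M)"
      by (simp add: o_def int)
  qed
  then show ?thesis
    by (simp add: has_partial_def q has_real_derivative_iff_has_vector_derivative)
qed

text \<open>Stated for all \<open>f\<close> and \<open>c\<close> at once because each
  differentiation replaces \<open>f\<close> by \<open>partial i f\<close> and multiplies the
  coefficient by 1/\<epsilon>.\<close>

lemma (in borel_prob) temperate_rescaled_integral:
  fixes f :: "real ^ 'n \<Rightarrow> real"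
  shows "bounded_smooth f \<Longrightarrow> growth (\<lambda>\<epsilon> x :: real ^ 'n. c \<epsilon> :: real) \<Longrightarrow>
    temperate k (\<lambda>\<epsilon> x. c \<epsilon> * (\<integral>y. f ((x - y) /\<^sub>R \<epsilon>) \<partial>M))"
proof (induction k arbitrary: f c)
  case (0 f c)
  then have cont: "continuous_on UNIV f" by (simp add: bounded_smooth_def smooth_on_continuous_on)
  obtain B where B: "\<And>x. \<bar>f x\<bar> \<le> B" using bounded_smoothE[OF 0(1)] by blast
  have "growth (\<lambda>\<epsilon> x. \<integral>y. f ((x - y) /\<^sub>R \<epsilon>) \<partial>M)"
    using abs_rescaled_integral_le[OF cont B] by (intro growth_bounded[of _ B]) simp
  then show ?case
    using 0(2) continuous_on_rescaled_integral[OF cont B]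
    by (auto intro!: growth_mult continuous_on_mult)
next
  case (Suc k f c)
  have smooth: "smooth_on UNIV f" using Suc.prems by (simp add: bounded_smooth_def)
  obtain B where B: "\<And>x. \<bar>f x\<bar> \<le> B" using bounded_smoothE[OF Suc.prems(1)] by blast
  have "growth (\<lambda>\<epsilon> x :: real ^ 'n. 1 / \<epsilon> :: real)"
    by (rule growthI[of _ 1 1]) (auto simp: weight_def divide_right_mono)
  then have growth: "growth (\<lambda>\<epsilon> x :: real ^ 'n. c \<epsilon> * (1 / \<epsilon>))"
    by (rule growth_mult[OF Suc.prems(2)])
  have 0: "temperate k (\<lambda>\<epsilon> x. c \<epsilon> * (\<integral>y. f ((x - y) /\<^sub>R \<epsilon>) \<partial>M))"
    by (rule Suc.IH[OF Suc.prems])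
  show ?case
  proof (rule temperate_SucI)
    show "temperate k (\<lambda>\<epsilon> x. (c \<epsilon> * (1 / \<epsilon>)) * (\<integral>y. partial i f ((x - y) /\<^sub>R \<epsilon>) \<partial>M))" for i
      by (rule Suc.IH[OF bounded_smooth_partial[OF Suc.prems(1)] growth])
    show "has_partial i (\<lambda>x. c \<epsilon> * (\<integral>y. f ((x - y) /\<^sub>R \<epsilon>) \<partial>M))
        ((c \<epsilon> * (1 / \<epsilon>)) * (\<integral>y. partial i f ((x - y) /\<^sub>R \<epsilon>) \<partial>M)) x" if "\<epsilon> \<in> {0<..1}" for i \<epsilon> x
    proof -
      obtain C where C: "\<And>x. \<bar>partial i f x\<bar> \<le> C"
        using bounded_smoothE[OF bounded_smooth_partial[OF Suc.prems(1)]] by blast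
      have "has_partial i (\<lambda>x. \<integral>y. f ((x - y) /\<^sub>R \<epsilon>) \<partial>M) ((\<integral>y. partial i f ((x - y) /\<^sub>R \<epsilon>) \<partial>M) / \<epsilon>) x"
        by (rule has_partial_rescaled_integral[OF _ _ B _ C])
          (use that smooth in \<open>auto intro: smooth_on_continuous_on smooth_on_partial smooth_on_has_partial\<close>)
      from has_partial_linear[OF bounded_linear_mult_right this, of "c \<epsilon>"] show ?thesis by simp
    qed
  qed (use temperate_growth[OF 0] temperate_continuous[OF 0] in auto)
qed

lemma growth_rescaling: "growth (\<lambda>\<epsilon> x :: real ^ 'n::finite. 1 / \<epsilon> ^ N :: real)"
proof (rule growthI[of _ 1 N])
  fix \<epsilon> :: real and x :: "real ^ 'n" assume "\<epsilon> \<in> {0<..1}"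
  then have "(1 / \<epsilon>) ^ N \<le> weight \<epsilon> x ^ N"
    by (intro power_mono) (auto simp: weight_def divide_right_mono)
  then show "norm (1 / \<epsilon> ^ N) \<le> 1 * weight \<epsilon> x ^ N"
    using \<open>\<epsilon> \<in> {0<..1}\<close> by (simp add: power_divide)
qed

section \<open>Upper and lower bounds for the regularized measure\<close>

lemma measure_convolve_scaled:
  "measure_convolve \<mu> (scaled \<rho> \<epsilon>) x = 1 / \<epsilon> ^ CARD('n) * (\<integral>y. \<rho> ((x - y) /\<^sub>R \<epsilon>) \<partial>\<mu>)"
  for \<rho> :: "real ^ 'n::finite \<Rightarrow> real"
  by (simp add: measure_convolve_def scaled_def)

lemma (in borel_prob) temperate_measure_convolve:
  assumes "bounded_smooth \<rho>"
  shows "temperate k (\<lambda>\<epsilon>. measure_convolve M (scaled \<rho> \<epsilon>))"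
  unfolding measure_convolve_scaled[abs_def]
  by (rule temperate_rescaled_integral[OF assms growth_rescaling])

lemma powr_decay_lower_bound:
  fixes \<rho> :: "real ^ 'n::finite \<Rightarrow> real"
  assumes "continuous_on UNIV \<rho>" "\<And>x. \<rho> x > 0"
    and "\<And>x. norm x \<ge> 1 \<Longrightarrow> \<rho> x \<ge> norm x powr (- m)" "m \<ge> 0"
  obtains c a where "c > 0" "\<And>x. \<rho> x \<ge> c / (1 + norm x) ^ a"
proof -
  have "\<exists>z\<in>cball 0 1. \<forall>x\<in>cball 0 1. \<rho> z \<le> \<rho> x"
    by (rule continuous_attains_inf) (auto intro: continuous_on_subset[OF assms(1)])
  then obtain z where "\<forall>x\<in>cball 0 1. \<rho> z \<le> \<rho> x" by blast
  then have z: "\<rho> z \<le> \<rho> x" if "norm x \<le> 1" for x using that by simp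
  \<comment> \<open>Rounding up makes the exponent a natural number, as \<open>growth\<close>
    requires; with base 1 + |x| \<ge> 1 it only weakens the lower bound.\<close>
  define a where "a = nat \<lceil>m\<rceil>"
  show thesis
  \<comment> \<open>The minimum of \<rho> over the unit ball serves inside, the constant 1 of the
    decay hypothesis outside.\<close>
  proof (rule that[of "min 1 (\<rho> z)" a])
    fix x :: "real ^ 'n"
    show "\<rho> x \<ge> min 1 (\<rho> z) / (1 + norm x) ^ a"
    proof (cases "norm x \<le> 1")
      case True
      have "min 1 (\<rho> z) / (1 + norm x) ^ a \<le> min 1 (\<rho> z) / 1"
        by (rule divide_left_mono) (use assms(2)[of z] in \<open>auto intro!: one_le_power zero_less_power add_pos_nonneg\<close>)
      then show ?thesis using z[OF True] by simp
    next
      case False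
      have "min 1 (\<rho> z) / (1 + norm x) ^ a \<le> 1 / (1 + norm x) ^ a"
        by (intro divide_right_mono) auto
      also have "\<dots> = (1 + norm x) powr (- real a)"
        by (simp add: powr_minus powr_realpow add_pos_nonneg divide_inverse)
      also have "\<dots> \<le> (1 + norm x) powr (- m)"
        by (rule powr_mono) (simp_all add: a_def of_nat_ceiling)
      also have "\<dots> \<le> norm x powr (- m)"
          by (rule powr_mono2') (use \<open>m \<ge> 0\<close> False in auto)
      also have "\<dots> \<le> \<rho> x" using assms(3) False by simp
      finally show ?thesis .
    qed
  qed (use assms(2)[of z] in auto)
qed

lemma (in borel_prob) measure_convolve_lower_bound:
  fixes \<rho> :: "real ^ 'n \<Rightarrow> real"
  assumes \<rho>: "continuous_on UNIV \<rho>" "\<And>x. \<bar>\<rho> x\<bar> \<le> B"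
    and c: "c > 0" "\<And>x. \<rho> x \<ge> c / (1 + norm x) ^ a"
  obtains d where "d > 0"
    "\<And>\<epsilon> x. \<epsilon> \<in> {0<..1} \<Longrightarrow> measure_convolve M (scaled \<rho> \<epsilon>) x \<ge> d / weight \<epsilon> x ^ a"
proof -
  have "(\<lambda>n. measure M (cball 0 (real n))) \<longlonglongrightarrow> measure M (\<Union>n. cball 0 (real n))"
    by (rule finite_Lim_measure_incseq) (auto simp: sets_M incseq_def)
  also have "(\<Union>n. cball 0 (real n)) = space M"
    using sets_eq_imp_space_eq[OF sets_M] real_arch_simple by auto
  finally have "(\<lambda>n. measure M (cball 0 (real n))) \<longlonglongrightarrow> 1" by (simp add: prob_space)
  then have "eventually (\<lambda>n. measure M (cball 0 (real n)) > 1 / 2) sequentially"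
    by (rule order_tendstoD) simp
  then obtain R where R: "measure M (cball 0 (real R)) > 1 / 2"
    by (auto simp: eventually_sequentially)
  \<comment> \<open>The 2 accounts for the mass 1/2 of the ball, the power of 1 + R for replacing x
    - y by x.\<close>
  define d where "d = c / (2 * (1 + real R) ^ a)"
  show thesis
  proof (rule that[of d])
    show "d > 0" using c(1) by (simp add: d_def)
    fix \<epsilon> :: real and x :: "real ^ 'n" assume e: "\<epsilon> \<in> {0<..1}"
    have w: "weight \<epsilon> x \<ge> 1" by (rule weight_ge_1[OF e])
    have pos: "\<rho> z > 0" for z
      using c(2)[of z] by (rule less_le_trans[rotated]) (use c(1) in \<open>auto simp: add_pos_nonneg\<close>)
    \<comment> \<open>A lower bound for the integrand, valid for all y in the ball of radius R
      simultaneously; the remaining y contribute nonnegatively.\<close>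
    define l where "l = c / ((1 + real R) * weight \<epsilon> x) ^ a"
    have "l / 2 \<le> l * measure M (cball 0 (real R))"
      using R c(1) w by (auto simp: l_def divide_simps)
    also have "\<dots> = (\<integral>y. l * indicator (cball 0 (real R)) y \<partial>M)"
      by (simp add: sets_M)
    also have "\<dots> \<le> (\<integral>y. \<rho> ((x - y) /\<^sub>R \<epsilon>) \<partial>M)"
    proof (rule integral_mono)
      show "integrable M (\<lambda>y. l * indicator (cball 0 (real R)) y)"
        by (intro integrable_mult_right) (simp add: sets_M integrable_indicator_iff less_top[symmetric])
      show "integrable M (\<lambda>y. \<rho> ((x - y) /\<^sub>R \<epsilon>))"
        by (rule integrable_rescaled[OF \<rho>])
      fix y :: "real ^ 'n"
      show "l * indicator (cball 0 (real R)) y \<le> \<rho> ((x - y) /\<^sub>R \<epsilon>)"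
      proof (cases "norm y \<le> R")
        case True
        have "0 \<le> real R * norm x" by simp
        \<comment> \<open>The expanded right-hand side is 1 + |x| + R + R |x|; it dominates because
          \<epsilon> \<le> 1.\<close>
        with e have *: "\<epsilon> + (norm x + R) \<le> (1 + real R) * (1 + norm x)"
          unfolding distrib_left distrib_right greaterThanAtMost_iff by linarith
        have "1 + norm ((x - y) /\<^sub>R \<epsilon>) \<le> (\<epsilon> + (norm x + R)) / \<epsilon>"
          using e True norm_triangle_ineq4[of x y] by (auto simp: divide_simps)
        also have "\<dots> \<le> (1 + real R) * weight \<epsilon> x"
          unfolding weight_def times_divide_eq_right
          by (rule divide_right_mono[OF *]) (use e in auto)
        finally have "(1 + norm ((x - y) /\<^sub>R \<epsilon>)) ^ a \<le> ((1 + real R) * weight \<epsilon> x) ^ a"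
          by (rule power_mono) simp
        then have "l \<le> c / (1 + norm ((x - y) /\<^sub>R \<epsilon>)) ^ a"
          unfolding l_def using c(1) w by (intro divide_left_mono) (auto simp: add_pos_nonneg)
        also have "\<dots> \<le> \<rho> ((x - y) /\<^sub>R \<epsilon>)" by (rule c(2))
        finally show ?thesis using True by simp
      next
        case False
        then show ?thesis using pos by (simp add: less_imp_le)
      qed
    qed
    finally have "l / 2 \<le> (\<integral>y. \<rho> ((x - y) /\<^sub>R \<epsilon>) \<partial>M)" .
    moreover have "0 < l" using c(1) w by (simp add: l_def)
    \<comment> \<open>The normalizing factor helps the lower bound and is simply estimated by
      1.\<close>
    moreover have "1 \<le> 1 / \<epsilon> ^ CARD('n)" using e by (simp add: power_le_one)
    ultimately have "1 * (l / 2) \<le> 1 / \<epsilon> ^ CARD('n) * (\<integral>y. \<rho> ((x - y) /\<^sub>R \<epsilon>) \<partial>M)"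
      by (intro mult_mono) (use e in auto)
    moreover have "l / 2 = d / weight \<epsilon> x ^ a" by (simp add: l_def d_def power_mult_distrib)
    ultimately show "measure_convolve M (scaled \<rho> \<epsilon>) x \<ge> d / weight \<epsilon> x ^ a"
      by (simp add: measure_convolve_scaled)
  qed
qed

section \<open>Cutoff functions\<close>

text \<open>The parameter \<open>m\<close> makes the family closed under differentiation up to linear combinations.\<close>

definition flat :: "nat \<Rightarrow> real \<Rightarrow> real" where
  "flat m t = (if t > 0 then exp (- 1 / t) / t ^ m else 0)"

lemma flat_nonneg: "flat m t \<ge> 0"
  by (simp add: flat_def)

text \<open>From (1 + s/k)^k \<le> exp s with s = 1/t and k = m + 1: the exponential beats t^m with
  one power of t to spare. That spare power gives the derivative at 0.\<close>

lemma flat_le_linear: "flat m t \<le> real (Suc m) ^ Suc m * \<bar>t\<bar>"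
proof (cases "t > 0")
  case True
  have "(1 / (t * real (Suc m))) ^ Suc m \<le> (1 + (1 / t) / real (Suc m)) ^ Suc m"
    using True by (intro power_mono) auto
  also have "\<dots> \<le> exp (1 / t)"
    by (rule exp_ge_one_plus_x_over_n_power_n) (use True in \<open>auto intro: order_trans[of _ 0]\<close>)
  finally have "exp (- (1 / t)) \<le> (t * real (Suc m)) ^ Suc m"
    using True unfolding exp_minus power_divide power_one
    by (simp add: divide_le_eq le_divide_eq inverse_eq_divide mult.commute del: power_Suc of_nat_Suc)
  then have "exp (- 1 / t) / t ^ m \<le> (t * real (Suc m)) ^ Suc m / t ^ m"
    using True by (simp add: divide_right_mono)
  also have "\<dots> = real (Suc m) ^ Suc m * t"
    using True by (simp add: power_mult_distrib del: of_nat_Suc)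
  finally show ?thesis using True by (simp add: flat_def del: of_nat_Suc power_Suc)
next
  case False
  then have "flat m t = 0" by (simp add: flat_def)
  then show ?thesis by (metis abs_ge_zero mult_nonneg_nonneg of_nat_0_le_iff zero_le_power)
qed

lemma flat_le: "flat m t \<le> real (Suc m) ^ Suc m"
proof (cases "\<bar>t\<bar> \<le> 1")
  case True
  have "flat m t \<le> real (Suc m) ^ Suc m * \<bar>t\<bar>" by (rule flat_le_linear)
  also have "\<dots> \<le> real (Suc m) ^ Suc m" using True by (intro mult_left_le) auto
  finally show ?thesis .
next
  case False
  have "flat m t \<le> 1"
    using False by (auto simp: flat_def intro!: divide_le_eq_1_pos[THEN iffD2] order_trans[OF _ one_le_power])
  also have "\<dots> \<le> real (Suc m) ^ Suc m" by (rule one_le_power) simp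
  finally show ?thesis .
qed

text \<open>For t > 0 this is the derivative of exp (-1/t) t^(-m). Raising the exponent by one or
  two keeps it in the family, which makes every member infinitely differentiable.\<close>

lemma DERIV_flat: "(flat m has_real_derivative flat (m + 2) t - real m * flat (m + 1) t) (at t)"
proof -
  consider "t > 0" | "t < 0" | "t = 0" by linarith
  then show ?thesis
  proof cases
    case 1
    have "((\<lambda>t. exp (- 1 / t) / t ^ m) has_real_derivative flat (m + 2) t - real m * flat (m + 1) t) (at t)"
      using 1 by (auto intro!: derivative_eq_intros simp: flat_def divide_simps power2_eq_square)
        (cases m; simp add: algebra_simps)
    then show ?thesis
      by (rule has_field_derivative_transform_within_open[of _ _ _ "{0<..}"]) (use 1 in \<open>auto simp: flat_def\<close>)
  next
    case 2
    have "((\<lambda>t. 0) has_real_derivative flat (m + 2) t - real m * flat (m + 1) t) (at t)"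
      using 2 by (simp add: flat_def)
    then show ?thesis
      by (rule has_field_derivative_transform_within_open[of _ _ _ "{..<0}"]) (use 2 in \<open>auto simp: flat_def\<close>)
  next
    case 3
    have "((\<lambda>h. flat (m + 1) h) \<longlongrightarrow> 0) (at 0)"
    proof (rule Lim_null_comparison)
      show "\<forall>\<^sub>F h in at 0. norm (flat (m + 1) h) \<le> real (Suc (m + 1)) ^ Suc (m + 1) * \<bar>h\<bar>"
        using flat_le_linear[of "m + 1"] flat_nonneg[of "m + 1"] by (intro always_eventually) auto
      show "((\<lambda>h :: real. real (Suc (m + 1)) ^ Suc (m + 1) * \<bar>h\<bar>) \<longlongrightarrow> 0) (at 0)"
        by (rule tendsto_eq_intros refl tendsto_rabs_zero | simp)+
    qed
    \<comment> \<open>The difference quotient at 0 is again a member of the family, on both sides of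
      0.\<close>
    moreover have "flat (m + 1) h = (flat m (0 + h) - flat m 0) / h" for h
      by (simp add: flat_def)
    ultimately have "(flat m has_real_derivative 0) (at 0)" by (simp add: DERIV_def)
    then show ?thesis using 3 by (simp add: flat_def)
  qed
qed

text \<open>All functions \<open>flat m\<close> are bounded on the whole line, so composition
  creates no growth; the index is left free in the induction because differentiation raises
  it.\<close>

lemma temperate_flat:
  "temperate k u \<Longrightarrow> temperate k (\<lambda>\<epsilon> x. flat m (u \<epsilon> x))"
proof (induction k arbitrary: m)
  have growth: "growth (\<lambda>\<epsilon> x. flat m (u \<epsilon> x))" for m
    by (rule growth_bounded[of _ "real (Suc m) ^ Suc m"]) (use flat_nonneg flat_le in simp)
  have cont: "continuous_on UNIV (\<lambda>x. flat m (u \<epsilon> x))" if "continuous_on UNIV (u \<epsilon>)" for \<epsilon> m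
    by (rule continuous_on_compose2[OF _ that, of UNIV "flat m"])
      (auto intro!: DERIV_continuous_on DERIV_flat[THEN DERIV_subset])
  {
    case 0
    then show ?case using growth cont by simp
  next
    case (Suc k)
    obtain u' where u': "\<And>i. temperate k (u' i)"
      "\<And>i \<epsilon> x. \<epsilon> \<in> {0<..1} \<Longrightarrow> has_partial i (u \<epsilon>) (u' i \<epsilon> x) x"
      using temperate_SucE[OF Suc.prems(1)] by metis
    have IH: "temperate k (\<lambda>\<epsilon> x. flat m (u \<epsilon> x))" for m
      by (rule Suc.IH[OF temperate_Suc_imp[OF Suc.prems]])
    show ?case
    proof (rule temperate_SucI[of _ _
          "\<lambda>i \<epsilon> x. (flat (m + 2) (u \<epsilon> x) + (- real m) * flat (m + 1) (u \<epsilon> x)) * u' i \<epsilon> x"])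
      show "temperate k (\<lambda>\<epsilon> x. (flat (m + 2) (u \<epsilon> x) + (- real m) * flat (m + 1) (u \<epsilon> x)) * u' i \<epsilon> x)" for i
        by (intro temperate_mult temperate_add temperate_const IH u')
      show "has_partial i (\<lambda>x. flat m (u \<epsilon> x))
          ((flat (m + 2) (u \<epsilon> x) + (- real m) * flat (m + 1) (u \<epsilon> x)) * u' i \<epsilon> x) x"
        if "\<epsilon> \<in> {0<..1}" for i \<epsilon> x
        by (rule has_partial_compose[OF _ u'(2)[OF that]]) (use DERIV_flat[of m] in simp)
    qed (use growth cont temperate_continuous[OF Suc.prems] in auto)
  }
qed

text \<open>The usual quotient a/(a + b) of a smooth transition. The constants 4 and 1 are the
  squares of the radii 2 and 1: \<open>a\<close> vanishes where \<epsilon>|x| \<ge> 2,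
  \<open>b\<close> where \<epsilon>|x| \<le> 1.\<close>

definition cutoff :: "real \<Rightarrow> real ^ 'n::finite \<Rightarrow> real" where
  "cutoff \<epsilon> x = flat 0 (4 - (\<epsilon> * norm x)\<^sup>2) *
     inverse (flat 0 (4 - (\<epsilon> * norm x)\<^sup>2) + flat 0 ((\<epsilon> * norm x)\<^sup>2 - 1))"

text \<open>At least one of the two arguments is \<ge> 1, where \<open>flat 0\<close> is at least
  exp (-1). The reciprocal in \<open>cutoff\<close> is thus bounded uniformly in \<epsilon> and
  x.\<close>

lemma flat_sum_ge: "flat 0 (4 - s) + flat 0 (s - 1) \<ge> exp (-1)"
proof -
  have "flat 0 t \<ge> exp (-1)" if "t \<ge> 1" for t
    using that by (simp add: flat_def)
  then have "flat 0 (4 - s) \<ge> exp (-1) \<or> flat 0 (s - 1) \<ge> exp (-1)"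
    by (cases "s \<le> 2") auto
  then show ?thesis using flat_nonneg[of 0 "4 - s"] flat_nonneg[of 0 "s - 1"] by linarith
qed

lemma temperate_cutoff: "temperate k (cutoff :: real \<Rightarrow> real ^ 'n::finite \<Rightarrow> real)"
proof -
  have "growth (\<lambda>\<epsilon> x :: real ^ 'n. \<epsilon>\<^sup>2)"
    by (rule growth_bounded[of _ 1]) (simp add: power_le_one)
  then have "temperate k (\<lambda>\<epsilon> x :: real ^ 'n. \<epsilon>\<^sup>2 * (norm x)\<^sup>2)"
    by (intro temperate_mult temperate_norm_sq temperate_coeff)
  then have s: "temperate k (\<lambda>\<epsilon> x :: real ^ 'n. (\<epsilon> * norm x)\<^sup>2)"
    by (simp add: power_mult_distrib)
  have *: "temperate k (\<lambda>\<epsilon> x :: real ^ 'n. flat 0 (4 - (\<epsilon> * norm x)\<^sup>2))"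
    using temperate_flat[OF temperate_add[OF temperate_const[of k 4] temperate_mult[OF temperate_const[of k "-1"] s]]]
    by simp
  have "temperate k (\<lambda>\<epsilon> x :: real ^ 'n. flat 0 ((\<epsilon> * norm x)\<^sup>2 - 1))"
    using temperate_flat[OF temperate_add[OF s temperate_const[of k "-1"]]] by simp
  note ** = temperate_add[OF * this]
  have "temperate k (\<lambda>\<epsilon> x :: real ^ 'n.
      inverse (flat 0 (4 - (\<epsilon> * norm x)\<^sup>2) + flat 0 ((\<epsilon> * norm x)\<^sup>2 - 1)))"
  proof (rule temperate_inverse[OF growth_bounded _ **])
    fix \<epsilon> :: real and x :: "real ^ 'n"
    note ge = flat_sum_ge[of "(\<epsilon> * norm x)\<^sup>2"]
    moreover have "exp (-1) > (0 :: real)" by simp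
    ultimately show "flat 0 (4 - (\<epsilon> * norm x)\<^sup>2) + flat 0 ((\<epsilon> * norm x)\<^sup>2 - 1) \<noteq> 0" by linarith
    show "norm (inverse (flat 0 (4 - (\<epsilon> * norm x)\<^sup>2) + flat 0 ((\<epsilon> * norm x)\<^sup>2 - 1))) \<le> inverse (exp (-1))"
      using le_imp_inverse_le[OF ge] flat_nonneg by (simp add: add_nonneg_nonneg)
  qed
  from temperate_mult[OF * this] show ?thesis unfolding cutoff_def[abs_def] .
qed

lemma cutoff_eq_1: "0 \<le> \<epsilon> \<Longrightarrow> \<epsilon> * norm x \<le> 1 \<Longrightarrow> cutoff \<epsilon> x = 1"
proof -
  assume "0 \<le> \<epsilon>" "\<epsilon> * norm x \<le> 1"
  then have "(\<epsilon> * norm x)\<^sup>2 \<le> 1" by (simp add: power_le_one)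
  then show ?thesis by (simp add: cutoff_def flat_def)
qed

lemma cutoff_eq_0: "\<epsilon> * norm x \<ge> 2 \<Longrightarrow> cutoff \<epsilon> x = 0"
proof -
  assume "\<epsilon> * norm x \<ge> 2"
  then have "(\<epsilon> * norm x)\<^sup>2 \<ge> 2\<^sup>2" by (rule power_mono) simp
  then show ?thesis by (simp add: cutoff_def flat_def)
qed

lemma cutoff_bounds: "0 \<le> cutoff \<epsilon> x" "cutoff \<epsilon> x \<le> 1"
  using flat_nonneg[of 0 "4 - (\<epsilon> * norm x)\<^sup>2"] flat_nonneg[of 0 "(\<epsilon> * norm x)\<^sup>2 - 1"]
  by (auto simp: cutoff_def divide_le_eq simp flip: divide_inverse)

section \<open>Moderate and negligible nets\<close>

lemma eventually_01: "eventually (\<lambda>\<epsilon>::real. \<epsilon> \<in> {0<..1}) (at_right 0)"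
  by (auto simp: eventually_at_right_field intro: exI[of _ 1])

lemma mpartial_0 [simp]: "mpartial (\<lambda>_. 0) f = f"
proof -
  have "(SOME xs. \<forall>i::'a. count_list xs i = 0) = []"
  proof (rule some_equality)
    fix xs :: "'a list" assume "\<forall>i. count_list xs i = 0"
    then show "xs = []" by (metis count_list_0_iff list.set_intros(1) neq_Nil_conv)
  qed simp
  then show ?thesis by (simp add: mpartial_def)
qed

lemma temperate_smooth: "(\<And>k. temperate k u) \<Longrightarrow> \<epsilon> \<in> {0<..1} \<Longrightarrow> smooth_on UNIV (u \<epsilon>)"
  by (simp add: smooth_on_def temperate_Ck_on)

lemma mpartial_continuous_on: "smooth_on \<Omega> f \<Longrightarrow> continuous_on \<Omega> (mpartial \<alpha> f)"
  unfolding mpartial_def by (intro smooth_on_continuous_on smooth_on_foldr_partial)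

section \<open>The seminorms of \<open>C_inf\<close>\<close>

lemma elems_C_inf: "f \<in> elems (C_inf \<Omega>) \<longleftrightarrow> smooth_on \<Omega> f \<and> (\<forall>x. x \<notin> \<Omega> \<longrightarrow> f x = 0)"
  by (simp add: C_inf_def)

lemma seminorms_C_infE:
  assumes "p \<in> seminorms (C_inf \<Omega>)"
  obtains K \<alpha> where "p = (\<lambda>f. SUP x\<in>K. norm (mpartial \<alpha> f x))" "compact K" "K \<noteq> {}" "K \<subseteq> \<Omega>"
  using assms by (auto simp: C_inf_def)

lemma seminorms_C_infI:
  "compact K \<Longrightarrow> K \<noteq> {} \<Longrightarrow> K \<subseteq> \<Omega> \<Longrightarrow> (\<lambda>f. SUP x\<in>K. norm (mpartial \<alpha> f x)) \<in> seminorms (C_inf \<Omega>)"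
  by (auto simp: C_inf_def)

text \<open>A real supremum can be compared with its members once the set is bounded above;
  continuity on a compact set ensures this wherever \<open>SUP\<close> is used.\<close>

lemma bdd_above_mpartial:
  assumes "smooth_on \<Omega> f" "compact K" "K \<subseteq> \<Omega>"
  shows "bdd_above ((\<lambda>x. norm (mpartial \<alpha> f x)) ` K)"
proof -
  have "continuous_on K (\<lambda>x. norm (mpartial \<alpha> f x))"
    by (intro continuous_on_norm continuous_on_subset[OF mpartial_continuous_on[OF assms(1)] assms(3)])
  then show ?thesis
    by (intro bounded_imp_bdd_above compact_imp_bounded compact_continuous_image assms(2))
qed

lemma C_inf_elems_zero: "0 \<in> elems (C_inf \<Omega>)"
  using smooth_on_subset[OF temperate_smooth[of "\<lambda>_ _. 0" 1]]
  by (simp add: elems_C_inf zero_fun_def temperate_const)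

lemma mpartial_zero: "mpartial \<alpha> (0 :: real ^ 'n::finite \<Rightarrow> complex) x = 0"
proof -
  have "smooth_on UNIV (\<lambda>x :: real ^ 'n. 0 :: complex)"
    using C_inf_elems_zero by (simp add: elems_C_inf zero_fun_def)
  then show ?thesis
    unfolding mpartial_def zero_fun_def by (rule foldr_partial_linear[OF open_UNIV bounded_linear_zero _ UNIV_I])
qed

lemma C_inf_seminorm_zero:
  assumes "p \<in> seminorms (C_inf \<Omega>)"
  shows "p 0 = 0"
proof -
  obtain K \<alpha> where "p = (\<lambda>f. SUP x\<in>K. norm (mpartial \<alpha> f x))" "K \<noteq> {}"
    using seminorms_C_infE[OF assms] by blast
  then show ?thesis by (simp add: mpartial_zero)
qed

lemma C_inf_elems_add:
  "open \<Omega> \<Longrightarrow> f \<in> elems (C_inf \<Omega>) \<Longrightarrow> g \<in> elems (C_inf \<Omega>) \<Longrightarrow> f + g \<in> elems (C_inf \<Omega>)"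
  by (simp add: elems_C_inf plus_fun_def smooth_on_add)

lemma C_inf_elems_uminus: "open \<Omega> \<Longrightarrow> f \<in> elems (C_inf \<Omega>) \<Longrightarrow> - f \<in> elems (C_inf \<Omega>)"
  by (simp add: elems_C_inf fun_Compl_def smooth_on_linear[OF _ bounded_linear_minus[OF bounded_linear_ident]])

lemma C_inf_seminorm_nonneg:
  assumes "p \<in> seminorms (C_inf \<Omega>)" "f \<in> elems (C_inf \<Omega>)"
  shows "p f \<ge> 0"
proof -
  obtain K \<alpha> where K: "p = (\<lambda>f. SUP x\<in>K. norm (mpartial \<alpha> f x))" "compact K" "K \<noteq> {}" "K \<subseteq> \<Omega>"
    using seminorms_C_infE[OF assms(1)] by blast
  then obtain x where "x \<in> K" by blast
  then have "norm (mpartial \<alpha> f x) \<le> p f"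
    unfolding K(1) using assms(2) K by (intro cSUP_upper bdd_above_mpartial) (auto simp: elems_C_inf)
  then show ?thesis using norm_ge_zero order_trans by blast
qed

lemma C_inf_seminorm_add:
  assumes "open \<Omega>" "p \<in> seminorms (C_inf \<Omega>)" "f \<in> elems (C_inf \<Omega>)" "g \<in> elems (C_inf \<Omega>)"
  shows "p (f + g) \<le> p f + p g"
proof -
  obtain K \<alpha> where K: "p = (\<lambda>f. SUP x\<in>K. norm (mpartial \<alpha> f x))" "compact K" "K \<noteq> {}" "K \<subseteq> \<Omega>"
    using seminorms_C_infE[OF assms(2)] by blast
  have le: "norm (mpartial \<alpha> f x) \<le> p f" if "x \<in> K" "f \<in> elems (C_inf \<Omega>)" for f x
    unfolding K(1) using that K by (intro cSUP_upper bdd_above_mpartial) (auto simp: elems_C_inf)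
  show ?thesis unfolding K(1)
  proof (rule cSUP_least[OF K(3)])
    fix x assume x: "x \<in> K"
    have "mpartial \<alpha> (f + g) x = mpartial \<alpha> f x + mpartial \<alpha> g x"
      unfolding mpartial_def plus_fun_def
      using assms x K(4) by (intro foldr_partial_add[of \<Omega>]) (auto simp: elems_C_inf)
    then have "norm (mpartial \<alpha> (f + g) x) \<le> norm (mpartial \<alpha> f x) + norm (mpartial \<alpha> g x)"
      by (simp add: norm_triangle_ineq)
    also have "\<dots> \<le> p f + p g" using le[OF x assms(3)] le[OF x assms(4)] by simp
    finally show "norm (mpartial \<alpha> (f + g) x)
        \<le> (SUP x\<in>K. norm (mpartial \<alpha> f x)) + (SUP x\<in>K. norm (mpartial \<alpha> g x))"
      unfolding K(1) .
  qed
qed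

lemma C_inf_seminorm_uminus:
  assumes "open \<Omega>" "p \<in> seminorms (C_inf \<Omega>)" "f \<in> elems (C_inf \<Omega>)"
  shows "p (- f) = p f"
proof -
  obtain K \<alpha> where K: "p = (\<lambda>f. SUP x\<in>K. norm (mpartial \<alpha> f x))" "compact K" "K \<noteq> {}" "K \<subseteq> \<Omega>"
    using seminorms_C_infE[OF assms(2)] by blast
  have "mpartial \<alpha> (- f) x = - mpartial \<alpha> f x" if "x \<in> K" for x
    unfolding mpartial_def fun_Compl_def
    using assms that K(4)
    by (intro foldr_partial_linear[of \<Omega>, OF _ bounded_linear_minus[OF bounded_linear_ident]])
      (auto simp: elems_C_inf)
  then show ?thesis unfolding K(1) by (intro SUP_cong) auto
qed

lemma null_nets_C_inf_add:
  assumes "open \<Omega>" "u \<in> null_nets (C_inf \<Omega>)" "v \<in> null_nets (C_inf \<Omega>)"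
  shows "(\<lambda>\<epsilon>. u \<epsilon> + v \<epsilon>) \<in> null_nets (C_inf \<Omega>)"
proof -
  have elems: "u \<epsilon> \<in> elems (C_inf \<Omega>)" "v \<epsilon> \<in> elems (C_inf \<Omega>)" if "\<epsilon> \<in> {0<..1}" for \<epsilon>
    using assms(2,3) that by (auto simp: null_nets_def)
  have "(\<lambda>\<epsilon>. p (u \<epsilon> + v \<epsilon>)) \<in> O[at_right 0](\<lambda>\<epsilon>. \<epsilon> ^ q)" if p: "p \<in> seminorms (C_inf \<Omega>)" for p q
  proof (rule landau_o.big_trans[OF bigoI])
    show "\<forall>\<^sub>F \<epsilon> in at_right 0. norm (p (u \<epsilon> + v \<epsilon>)) \<le> 1 * norm (p (u \<epsilon>) + p (v \<epsilon>))"
      using eventually_01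
    proof eventually_elim
      case (elim \<epsilon>)
      show ?case
        using C_inf_seminorm_add[OF assms(1) p elems[OF elim]]
          C_inf_seminorm_nonneg[OF p C_inf_elems_add[OF assms(1) elems[OF elim]]] by simp
    qed
    show "(\<lambda>\<epsilon>. p (u \<epsilon>) + p (v \<epsilon>)) \<in> O[at_right 0](\<lambda>\<epsilon>. \<epsilon> ^ q)"
      using assms(2,3) p by (intro sum_in_bigo) (auto simp: null_nets_def)
  qed
  then show ?thesis using C_inf_elems_add[OF assms(1) elems] by (simp add: null_nets_def)
qed

lemma null_nets_C_inf_uminus:
  assumes "open \<Omega>" "u \<in> null_nets (C_inf \<Omega>)"
  shows "(\<lambda>\<epsilon>. - u \<epsilon>) \<in> null_nets (C_inf \<Omega>)"
proof -
  have elems: "u \<epsilon> \<in> elems (C_inf \<Omega>)" if "\<epsilon> \<in> {0<..1}" for \<epsilon>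
    using assms(2) that by (auto simp: null_nets_def)
  have "(\<lambda>\<epsilon>. p (- u \<epsilon>)) \<in> O[at_right 0](\<lambda>\<epsilon>. \<epsilon> ^ q)" if p: "p \<in> seminorms (C_inf \<Omega>)" for p q
  proof (rule landau_o.big.in_cong[THEN iffD2])
    show "\<forall>\<^sub>F \<epsilon> in at_right 0. p (- u \<epsilon>) = p (u \<epsilon>)"
      using eventually_01 by eventually_elim (rule C_inf_seminorm_uminus[OF assms(1) p elems])
    show "(\<lambda>\<epsilon>. p (u \<epsilon>)) \<in> O[at_right 0](\<lambda>\<epsilon>. \<epsilon> ^ q)" using assms(2) p by (auto simp: null_nets_def)
  qed
  then show ?thesis using C_inf_elems_uminus[OF assms(1) elems] by (simp add: null_nets_def)
qed

text \<open>Membership in the space is demanded for every \<epsilon> in ]0,1], whereas the estimates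
  concern small \<epsilon>; hence two separate hypotheses.\<close>

lemma eventually_zero_null_nets_C_inf:
  assumes "\<And>\<epsilon>. \<epsilon> \<in> {0<..1} \<Longrightarrow> u \<epsilon> \<in> elems (C_inf \<Omega>)" "\<forall>\<^sub>F \<epsilon> in at_right 0. u \<epsilon> = 0"
  shows "u \<in> null_nets (C_inf \<Omega>)"
proof -
  have "(\<lambda>\<epsilon>. p (u \<epsilon>)) \<in> O[at_right 0](\<lambda>\<epsilon>. \<epsilon> ^ q)" if p: "p \<in> seminorms (C_inf \<Omega>)" for p q
  proof (rule landau_o.big.in_cong[THEN iffD2])
    show "\<forall>\<^sub>F \<epsilon> in at_right 0. p (u \<epsilon>) = 0"
      using assms(2) by eventually_elim (simp add: C_inf_seminorm_zero[OF p])
  qed simp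
  then show ?thesis using assms(1) by (simp add: null_nets_def)
qed

section \<open>Equivalence of nets over \<open>C_inf\<close>\<close>

lemma refl_net_equiv_C_inf:
  assumes "open \<Omega>" "u \<in> moderate_nets (C_inf \<Omega>)"
  shows "(u, u) \<in> net_equiv (C_inf \<Omega>)"
proof -
  have "(\<lambda>\<epsilon>. u \<epsilon> + - u \<epsilon>) \<in> null_nets (C_inf \<Omega>)"
    using assms by (intro eventually_zero_null_nets_C_inf)
      (auto simp: C_inf_elems_zero)
  then show ?thesis using assms(2) by (simp add: net_equiv_def)
qed

lemma sym_net_equiv_C_inf:
  assumes "open \<Omega>" "(u, v) \<in> net_equiv (C_inf \<Omega>)"
  shows "(v, u) \<in> net_equiv (C_inf \<Omega>)"
  using null_nets_C_inf_uminus[OF assms(1), of "\<lambda>\<epsilon>. u \<epsilon> - v \<epsilon>"] assms(2)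
  by (simp add: net_equiv_def)

lemma trans_net_equiv_C_inf:
  assumes "open \<Omega>" "(u, v) \<in> net_equiv (C_inf \<Omega>)" "(v, w) \<in> net_equiv (C_inf \<Omega>)"
  shows "(u, w) \<in> net_equiv (C_inf \<Omega>)"
  using null_nets_C_inf_add[OF assms(1), of "\<lambda>\<epsilon>. u \<epsilon> - v \<epsilon>" "\<lambda>\<epsilon>. v \<epsilon> - w \<epsilon>"] assms(2,3)
  by (simp add: net_equiv_def)

lemma net_class_C_inf_eqI:
  assumes "open \<Omega>" "(u, v) \<in> net_equiv (C_inf \<Omega>)"
  shows "net_class (C_inf \<Omega>) u = net_class (C_inf \<Omega>) v"
  unfolding net_class_def
  using trans_net_equiv_C_inf[OF assms(1)] sym_net_equiv_C_inf[OF assms] assms(2) by blast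

section \<open>Restriction\<close>

lemma restr_elems: "open \<Omega> \<Longrightarrow> f \<in> elems (C_inf UNIV) \<Longrightarrow> restr \<Omega> f \<in> elems (C_inf \<Omega>)"
  using smooth_on_cong[OF smooth_on_subset[of UNIV f \<Omega>], of "restr \<Omega> f"]
  by (simp add: elems_C_inf restr_def)

text \<open>Derivatives at points of K do not see the values outside the open set \<Omega>, so a
  seminorm of the restriction is a seminorm of the function on the whole space. Moderate and null
  estimates are inherited at once.\<close>

lemma restr_seminorm:
  assumes "open \<Omega>" "p \<in> seminorms (C_inf \<Omega>)"
  obtains p' where "p' \<in> seminorms (C_inf UNIV)" "\<And>f. p (restr \<Omega> f) = p' f"
proof -
  obtain K \<alpha> where K: "p = (\<lambda>f. SUP x\<in>K. norm (mpartial \<alpha> f x))" "compact K" "K \<noteq> {}" "K \<subseteq> \<Omega>"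
    using seminorms_C_infE[OF assms(2)] by blast
  show thesis
  proof (rule that)
    show "(\<lambda>f. SUP x\<in>K. norm (mpartial \<alpha> f x)) \<in> seminorms (C_inf UNIV)"
      using K by (intro seminorms_C_infI) auto
    have "mpartial \<alpha> (restr \<Omega> f) x = mpartial \<alpha> f x" if "x \<in> K" for f x
      unfolding mpartial_def using that K(4)
      by (intro foldr_partial_cong[OF assms(1)]) (auto simp: restr_def)
    then show "p (restr \<Omega> f) = (SUP x\<in>K. norm (mpartial \<alpha> f x))" for f
      unfolding K(1) by (intro SUP_cong) auto
  qed
qed

lemma restr_moderate_nets:
  assumes "open \<Omega>" "u \<in> moderate_nets (C_inf UNIV)"
  shows "(\<lambda>\<epsilon>. restr \<Omega> (u \<epsilon>)) \<in> moderate_nets (C_inf \<Omega>)"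
  unfolding moderate_nets_def
proof (safe intro!: restr_elems assms(1))
  show "u \<epsilon> \<in> elems (C_inf UNIV)" if "\<epsilon> \<in> {0<..1}" for \<epsilon>
    using assms(2) that by (simp add: moderate_nets_def)
  fix p assume p: "p \<in> seminorms (C_inf \<Omega>)"
  obtain p' where "p' \<in> seminorms (C_inf UNIV)" "\<And>f. p (restr \<Omega> f) = p' f"
    using restr_seminorm[OF assms(1) p] by blast
  then show "\<exists>N. (\<lambda>\<epsilon>. p (restr \<Omega> (u \<epsilon>))) \<in> O[at_right 0](\<lambda>\<epsilon>. 1 / \<epsilon> ^ N)"
    using assms(2) by (simp add: moderate_nets_def)
qed

lemma restr_null_nets:
  assumes "open \<Omega>" "u \<in> null_nets (C_inf UNIV)"
  shows "(\<lambda>\<epsilon>. restr \<Omega> (u \<epsilon>)) \<in> null_nets (C_inf \<Omega>)"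
  unfolding null_nets_def
proof (safe intro!: restr_elems assms(1))
  show "u \<epsilon> \<in> elems (C_inf UNIV)" if "\<epsilon> \<in> {0<..1}" for \<epsilon>
    using assms(2) that by (simp add: null_nets_def)
  fix p q assume p: "p \<in> seminorms (C_inf \<Omega>)"
  obtain p' where "p' \<in> seminorms (C_inf UNIV)" "\<And>f. p (restr \<Omega> f) = p' f"
    using restr_seminorm[OF assms(1) p] by blast
  then show "(\<lambda>\<epsilon>. p (restr \<Omega> (u \<epsilon>))) \<in> O[at_right 0](\<lambda>\<epsilon>. \<epsilon> ^ q)"
    using assms(2) by (simp add: null_nets_def)
qed

lemma restr_net_equiv:
  assumes "open \<Omega>" "(u, v) \<in> net_equiv (C_inf UNIV)"
  shows "((\<lambda>\<epsilon>. restr \<Omega> (u \<epsilon>)), (\<lambda>\<epsilon>. restr \<Omega> (v \<epsilon>))) \<in> net_equiv (C_inf \<Omega>)"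
proof -
  have "restr \<Omega> (u \<epsilon>) - restr \<Omega> (v \<epsilon>) = restr \<Omega> (u \<epsilon> - v \<epsilon>)" for \<epsilon>
    by (auto simp: restr_def)
  then show ?thesis
    using assms restr_moderate_nets restr_null_nets[OF assms(1), of "\<lambda>\<epsilon>. u \<epsilon> - v \<epsilon>"]
    by (auto simp: net_equiv_def)
qed

text \<open>\<open>gen_restrict\<close> is a union over all representatives, but equivalent nets
  have equivalent restrictions. The union therefore consists of a single class, and it is not empty
  because \<open>u\<close> represents its own class.\<close>

lemma gen_restrict_eq_net_class:
  assumes "open \<Omega>" "u \<in> moderate_nets (C_inf UNIV)" "v \<in> moderate_nets (C_inf UNIV)"
    and "\<forall>\<^sub>F \<epsilon> in at_right 0. \<forall>x\<in>\<Omega>. v \<epsilon> x = u \<epsilon> x"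
  shows "net_class (C_inf \<Omega>) (\<lambda>\<epsilon>. restr \<Omega> (v \<epsilon>)) = gen_restrict \<Omega> (net_class (C_inf UNIV) u)"
proof -
  have "(\<lambda>\<epsilon>. restr \<Omega> (v \<epsilon>) + - restr \<Omega> (u \<epsilon>)) \<in> null_nets (C_inf \<Omega>)"
  proof (rule eventually_zero_null_nets_C_inf)
    show "restr \<Omega> (v \<epsilon>) + - restr \<Omega> (u \<epsilon>) \<in> elems (C_inf \<Omega>)" if "\<epsilon> \<in> {0<..1}" for \<epsilon>
      using assms(1-3) that
      by (intro C_inf_elems_add C_inf_elems_uminus restr_elems) (auto simp: moderate_nets_def)
    show "\<forall>\<^sub>F \<epsilon> in at_right 0. restr \<Omega> (v \<epsilon>) + - restr \<Omega> (u \<epsilon>) = 0"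
      using assms(4) by eventually_elim (auto simp: restr_def fun_eq_iff)
  qed
  then have vu: "((\<lambda>\<epsilon>. restr \<Omega> (v \<epsilon>)), (\<lambda>\<epsilon>. restr \<Omega> (u \<epsilon>))) \<in> net_equiv (C_inf \<Omega>)"
    using restr_moderate_nets[OF assms(1)] assms(2,3) by (simp add: net_equiv_def)
  have "net_class (C_inf \<Omega>) (\<lambda>\<epsilon>. restr \<Omega> (w \<epsilon>)) = net_class (C_inf \<Omega>) (\<lambda>\<epsilon>. restr \<Omega> (v \<epsilon>))"
    if "w \<in> net_class (C_inf UNIV) u" for w
    using that net_class_C_inf_eqI[OF assms(1) vu] net_class_C_inf_eqI[OF assms(1) restr_net_equiv[OF assms(1)]]
    by (auto simp: net_class_def)
  moreover have "u \<in> net_class (C_inf UNIV) u"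
    using refl_net_equiv_C_inf[OF _ assms(2)] by (simp add: net_class_def)
  ultimately show ?thesis unfolding gen_restrict_def by auto
qed

section \<open>Moderateness of temperate nets\<close>

lemma temperate_growth_mpartial:
  "(\<And>k. temperate k u) \<Longrightarrow> growth (\<lambda>\<epsilon>. mpartial \<alpha> (u \<epsilon>))"
  unfolding mpartial_def by (rule temperate_growth_foldr_partial) auto

lemma temperate_imp_moderate_C_inf:
  assumes "\<And>k. temperate k u"
  shows "u \<in> moderate_nets (C_inf UNIV)"
  unfolding moderate_nets_def
proof safe
  show "u \<epsilon> \<in> elems (C_inf UNIV)" if "\<epsilon> \<in> {0<..1}" for \<epsilon>
    using temperate_smooth[OF assms that] by (simp add: elems_C_inf)
  fix p :: "(real ^ 'a \<Rightarrow> complex) \<Rightarrow> real" assume p: "p \<in> seminorms (C_inf UNIV)"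
  then obtain K \<alpha> where K: "p = (\<lambda>f. SUP x\<in>K. norm (mpartial \<alpha> f x))" "compact K" "K \<noteq> {}"
    by (rule seminorms_C_infE)
  obtain C N where C: "C \<ge> 0" "\<And>\<epsilon> x. \<epsilon> \<in> {0<..1} \<Longrightarrow> norm (mpartial \<alpha> (u \<epsilon>) x) \<le> C * weight \<epsilon> x ^ N"
    using growthE[OF temperate_growth_mpartial[OF assms, of \<alpha>]] by blast
  \<comment> \<open>On K the weight is at most (1 + R)/\<epsilon>, which turns growth in x into a
    constant.\<close>
  obtain R where R: "\<And>x. x \<in> K \<Longrightarrow> norm x \<le> R"
    using compact_imp_bounded[OF K(2)] by (auto simp: bounded_iff)
  have "(\<lambda>\<epsilon>. p (u \<epsilon>)) \<in> O[at_right 0](\<lambda>\<epsilon>. 1 / \<epsilon> ^ N)"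
  proof (rule bigoI)
    show "\<forall>\<^sub>F \<epsilon> in at_right 0. norm (p (u \<epsilon>)) \<le> (C * (1 + R) ^ N) * norm (1 / \<epsilon> ^ N)"
      using eventually_01
    proof eventually_elim
      case (elim \<epsilon>)
      have "p (u \<epsilon>) \<le> C * (1 + R) ^ N * (1 / \<epsilon> ^ N)"
        unfolding K(1)
      proof (rule cSUP_least[OF K(3)])
        fix x assume "x \<in> K"
        then have "weight \<epsilon> x ^ N \<le> ((1 + R) / \<epsilon>) ^ N"
          using R elim unfolding weight_def by (intro power_mono divide_right_mono) auto
        then have "C * weight \<epsilon> x ^ N \<le> C * ((1 + R) / \<epsilon>) ^ N"
          by (rule mult_left_mono[OF _ C(1)])
        with C(2)[OF elim, of x]
        show "norm (mpartial \<alpha> (u \<epsilon>) x) \<le> C * (1 + R) ^ N * (1 / \<epsilon> ^ N)"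
          by (simp add: power_divide)
      qed
      moreover have "p (u \<epsilon>) \<ge> 0"
        using C_inf_seminorm_nonneg[OF p] temperate_smooth[OF assms elim] by (simp add: elems_C_inf)
      ultimately show ?case using elim by simp
    qed
  qed
  then show "\<exists>N. (\<lambda>\<epsilon>. p (u \<epsilon>)) \<in> O[at_right 0](\<lambda>\<epsilon>. 1 / \<epsilon> ^ N)" by blast
qed

section \<open>Sobolev norms of nets supported in balls of radius 2/\<epsilon>\<close>

lemma integrable_continuous_compact_support:
  fixes f :: "'a::euclidean_space \<Rightarrow> 'b::{banach, second_countable_topology}"
  assumes "continuous_on UNIV f" "compact K" "\<And>x. x \<notin> K \<Longrightarrow> f x = 0"
  shows "integrable lborel f" "integrable lebesgue f"
proof -
  have "integrable lborel (\<lambda>x. indicator K x *\<^sub>R f x)"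
    by (rule borel_integrable_compact[OF assms(2)]) (rule continuous_on_subset[OF assms(1)], simp)
  moreover have "(\<lambda>x. indicator K x *\<^sub>R f x) = f"
    using assms(3) by (auto simp: indicator_def)
  ultimately show "integrable lborel f" by simp
  then show "integrable lebesgue f" using integrable_completion[of f lborel] by auto
qed

lemma growth_sum:
  "finite I \<Longrightarrow> (\<And>j. j \<in> I \<Longrightarrow> growth (u j)) \<Longrightarrow> growth (\<lambda>\<epsilon> x. \<Sum>j\<in>I. u j \<epsilon> x)"
  by (induction I rule: finite_induct) (simp_all add: growth_add growth_bounded[of _ 0])

text \<open>On the supporting ball the weight is at most 3/\<epsilon>^2, and the volume is a
  multiple of \<epsilon>^(-n). The result is phrased as \<open>growth\<close> of a net constant in
  x, so that sums and square roots of such norms fall under the general closure rules.\<close>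

lemma growth_L2_norm_sq:
  assumes "growth u"
    and cont: "\<And>\<epsilon>. \<epsilon> \<in> {0<..1} \<Longrightarrow> continuous_on UNIV (u \<epsilon>)"
    and supp: "\<And>\<epsilon> x. \<epsilon> \<in> {0<..1} \<Longrightarrow> norm x > 2 / \<epsilon> \<Longrightarrow> u \<epsilon> x = 0"
  shows "\<epsilon> \<in> {0<..1} \<Longrightarrow> in_L2 (u \<epsilon>)"
    and "growth (\<lambda>\<epsilon> x :: real ^ 'n::finite. (L2_norm (u \<epsilon>))\<^sup>2)"
proof -
  have int: "integrable lebesgue (\<lambda>x. (norm (u \<epsilon> x))\<^sup>2)" if "\<epsilon> \<in> {0<..1}" for \<epsilon>
    by (rule integrable_continuous_compact_support(2)[of _ "cball 0 (2 / \<epsilon>)"])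
      (use cont[OF that] supp[OF that] in \<open>auto intro!: continuous_intros simp: not_le\<close>)
  show "in_L2 (u \<epsilon>)" if "\<epsilon> \<in> {0<..1}" for \<epsilon>
    unfolding in_L2_def
  proof
    show "u \<epsilon> \<in> borel_measurable lebesgue"
      using measurable_completion[of "u \<epsilon>" lborel borel] borel_measurable_continuous_onI[OF cont[OF that]] by simp
  qed (rule int[OF that])
  obtain C N where C: "C \<ge> 0" "\<And>\<epsilon> x. \<epsilon> \<in> {0<..1} \<Longrightarrow> norm (u \<epsilon> x) \<le> C * weight \<epsilon> x ^ N"
    using growthE[OF assms(1)] by blast
  define V where "V = unit_ball_vol (real CARD('a))"
  \<comment> \<open>Collects what is free of \<epsilon>: the squared pointwise bound contributes
    \<epsilon>^(-4N), the ball \<epsilon>^(-n).\<close>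
  define D where "D = (C * 3 ^ N)\<^sup>2 * (V * 2 ^ CARD('a))"
  have bound: "(L2_norm (u \<epsilon>))\<^sup>2 \<le> D * (1 / \<epsilon> ^ (4 * N + CARD('a)))" if e: "\<epsilon> \<in> {0<..1}" for \<epsilon>
  proof -
    have e': "0 < \<epsilon>" "\<epsilon> \<le> 1" using e by auto
    define B where "B = C * (3 / \<epsilon>\<^sup>2) ^ N"
    have le: "(norm (u \<epsilon> x))\<^sup>2 \<le> B\<^sup>2 * indicator (cball 0 (2 / \<epsilon>)) x" for x
    proof (cases "norm x > 2 / \<epsilon>")
      case False
      have "weight \<epsilon> x \<le> (1 / \<epsilon> + 2 / \<epsilon>) / \<epsilon>"
        unfolding weight_def using False e' by (intro divide_right_mono add_mono) auto
      then have "weight \<epsilon> x ^ N \<le> (3 / \<epsilon>\<^sup>2) ^ N"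
        using weight_ge_1[OF e, of x] by (intro power_mono) (auto simp: power2_eq_square field_simps)
      then have "norm (u \<epsilon> x) \<le> B"
        using C(2)[OF e, of x] mult_left_mono[OF _ C(1)] unfolding B_def by (meson order_trans)
      then show ?thesis using False by (simp add: power_mono)
    qed (use supp[OF e, of x] in simp)
    have "(L2_norm (u \<epsilon>))\<^sup>2 = (\<integral>x. (norm (u \<epsilon> x))\<^sup>2 \<partial>lebesgue)"
      unfolding L2_norm_def by (rule real_sqrt_pow2) (rule integral_nonneg_AE, simp)
    also have "\<dots> \<le> (\<integral>x. B\<^sup>2 * indicator (cball (0 :: real ^ 'a) (2 / \<epsilon>)) x \<partial>lebesgue)"
      by (rule integral_mono)
        (use int[OF e] le in \<open>simp_all add: lmeasurable_cball flip: lmeasurable_iff_integrable\<close>)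
    also have "\<dots> = B\<^sup>2 * measure lebesgue (cball (0 :: real ^ 'a) (2 / \<epsilon>))"
      by simp
    also have "\<dots> = B\<^sup>2 * (V * (2 / \<epsilon>) ^ CARD('a))"
      using e' by (simp add: content_cball V_def)
    also have "\<dots> = D * (1 / \<epsilon> ^ (4 * N + CARD('a)))"
      by (simp add: B_def D_def power_mult_distrib power_divide power_add flip: power_mult)
    finally show ?thesis .
  qed
  have D: "D \<ge> 0" by (simp add: D_def V_def)
  show "growth (\<lambda>\<epsilon> x :: real ^ 'n::finite. (L2_norm (u \<epsilon>))\<^sup>2)"
    by (rule growth_mono[OF growth_mult[OF growth_bounded[of "\<lambda>_ _. D" "norm D"] growth_rescaling[of "4 * N + CARD('a)"]]])
      (use bound D in auto)
qed

lemma temperate_imp_moderate_H_inf: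
  fixes u :: "real \<Rightarrow> real ^ 'n::finite \<Rightarrow> complex"
  assumes "\<And>k. temperate k u"
    and supp: "\<And>\<epsilon> x. \<epsilon> \<in> {0<..1} \<Longrightarrow> norm x > 2 / \<epsilon> \<Longrightarrow> u \<epsilon> x = 0"
  shows "u \<in> moderate_nets H_inf"
proof -
  have smooth: "smooth_on UNIV (u \<epsilon>)" if "\<epsilon> \<in> {0<..1}" for \<epsilon>
    by (rule temperate_smooth[OF assms(1) that])
  have supp': "mpartial \<alpha> (u \<epsilon>) x = 0" if "\<epsilon> \<in> {0<..1}" "norm x > 2 / \<epsilon>" for \<epsilon> x \<alpha>
  proof -
    \<comment> \<open>The complement of the ball is open and the net vanishes there, so its
      derivatives agree with those of the zero function.\<close>
    have "open (- cball (0 :: real ^ 'n) (2 / \<epsilon>))" by (simp add: open_Compl)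
    then have "mpartial \<alpha> (u \<epsilon>) x = mpartial \<alpha> 0 x"
      unfolding mpartial_def by (rule foldr_partial_cong) (use supp that in auto)
    then show ?thesis by (simp add: mpartial_zero)
  qed
  have cont: "continuous_on UNIV (mpartial \<alpha> (u \<epsilon>))" if "\<epsilon> \<in> {0<..1}" for \<alpha> \<epsilon>
    by (rule mpartial_continuous_on[OF smooth[OF that]])
  note L2 = growth_L2_norm_sq[OF temperate_growth_mpartial[OF assms(1)] cont supp']
  show ?thesis
    unfolding moderate_nets_def
  proof safe
    show "u \<epsilon> \<in> elems H_inf" if "\<epsilon> \<in> {0<..1}" for \<epsilon>
      using smooth[OF that] L2(1) that by (simp add: H_inf_def)
    fix p :: "(real ^ 'n \<Rightarrow> complex) \<Rightarrow> real" assume "p \<in> seminorms H_inf"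
    then obtain k where p: "p = H_norm k" by (auto simp: H_inf_def)
    have "growth (\<lambda>\<epsilon> x :: real ^ 'n. p (u \<epsilon>))"
      unfolding p H_norm_def
      by (intro growth_sqrt growth_sum finite_multi_indices L2(2) sum_nonneg) auto
    then obtain C N where C: "C \<ge> 0" "\<And>\<epsilon> x :: real ^ 'n. \<epsilon> \<in> {0<..1} \<Longrightarrow> norm (p (u \<epsilon>)) \<le> C * weight \<epsilon> x ^ N"
      by (rule growthE) blast
    have "(\<lambda>\<epsilon>. p (u \<epsilon>)) \<in> O[at_right 0](\<lambda>\<epsilon>. 1 / \<epsilon> ^ N)"
    proof (rule bigoI)
      \<comment> \<open>The left-hand side does not involve x, so the growth estimate may be read at
        x = 0, where the weight is 1/\<epsilon>.\<close>
      show "\<forall>\<^sub>F \<epsilon> in at_right 0. norm (p (u \<epsilon>)) \<le> C * norm (1 / \<epsilon> ^ N)"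
        using eventually_01
        by eventually_elim (use C(2)[where x = 0] in \<open>simp add: weight_def power_divide\<close>)
    qed
    then show "\<exists>N. (\<lambda>\<epsilon>. p (u \<epsilon>)) \<in> O[at_right 0](\<lambda>\<epsilon>. 1 / \<epsilon> ^ N)" by blast
  qed
qed

lemma refl_net_equiv_H_inf:
  assumes "u \<in> moderate_nets (H_inf :: (real ^ 'n::finite \<Rightarrow> complex) lcs)"
  shows "(u, u) \<in> net_equiv H_inf"
proof -
  have zero: "mpartial \<alpha> (0 :: real ^ 'n \<Rightarrow> complex) = 0" for \<alpha>
    by (rule ext) (simp add: mpartial_zero)
  have "(0 :: real ^ 'n \<Rightarrow> complex) \<in> elems H_inf"
    using C_inf_elems_zero[of UNIV] by (simp add: H_inf_def in_L2_def zero elems_C_inf) (simp add: zero_fun_def)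
  moreover have "H_norm k (0 :: real ^ 'n \<Rightarrow> complex) = 0" for k
    by (simp add: H_norm_def L2_norm_def zero)
  ultimately have "(\<lambda>\<epsilon>. u \<epsilon> - u \<epsilon>) \<in> null_nets H_inf"
    by (auto simp: null_nets_def) (auto simp: H_inf_def)
  then show ?thesis using assms by (simp add: net_equiv_def)
qed

section \<open>Association\<close>

lemma test_function_continuous: "\<psi> \<in> test_functions \<Omega> \<Longrightarrow> continuous_on UNIV \<psi>"
  by (auto simp: test_functions_def intro: smooth_on_continuous_on)

lemma test_function_support:
  assumes "\<psi> \<in> test_functions \<Omega>"
  obtains K where "compact K" "\<And>x. x \<notin> K \<Longrightarrow> \<psi> x = 0"
  by (rule that[of "closure {x. \<psi> x \<noteq> 0}"])
    (use assms closure_subset[of "{x. \<psi> x \<noteq> 0}"] in \<open>auto simp: test_functions_def\<close>)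

lemma test_function_bounded:
  assumes "\<psi> \<in> test_functions \<Omega>"
  obtains B where "\<And>x. norm (\<psi> x) \<le> B"
proof -
  obtain K where K: "compact K" "\<And>x. x \<notin> K \<Longrightarrow> \<psi> x = 0" using test_function_support[OF assms] by blast
  have "bounded (\<psi> ` K)"
    by (intro compact_imp_bounded compact_continuous_image K
        continuous_on_subset[OF test_function_continuous[OF assms]]) simp
  then obtain B where B: "B > 0" "\<And>x. x \<in> K \<Longrightarrow> norm (\<psi> x) \<le> B" unfolding bounded_pos by blast
  show thesis
  proof (rule that)
    show "norm (\<psi> x) \<le> B" for x using B K(2)[of x] by (cases "x \<in> K") auto
  qed
qed

lemma integrable_mult_test_function:
  assumes "\<psi> \<in> test_functions \<Omega>" "continuous_on UNIV f"
  shows "integrable lebesgue (\<lambda>x. f x * \<psi> x)"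
proof -
  obtain K where "compact K" "\<And>x. x \<notin> K \<Longrightarrow> \<psi> x = 0" using test_function_support[OF assms(1)] by blast
  then show ?thesis
    by (intro integrable_continuous_compact_support(2)[of _ K] continuous_on_mult assms
        test_function_continuous[OF assms(1)]) auto
qed

lemma integrable_mult_norm_test_function:
  fixes f :: "real ^ 'n::finite \<Rightarrow> real"
  assumes "\<psi> \<in> test_functions \<Omega>" "continuous_on UNIV f"
  shows "integrable lebesgue (\<lambda>x. f x * norm (\<psi> x))"
proof -
  obtain K where "compact K" "\<And>x. x \<notin> K \<Longrightarrow> \<psi> x = 0" using test_function_support[OF assms(1)] by blast
  then show ?thesis
    by (intro integrable_continuous_compact_support(2)[of _ K] continuous_on_mult continuous_on_norm assms
        test_function_continuous[OF assms(1)]) auto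
qed

section \<open>Smallness of null nets in weighted L2 integrals\<close>

definition weighted_L2_sq :: "(real ^ 'n::finite \<Rightarrow> complex) \<Rightarrow> (real ^ 'n \<Rightarrow> complex) \<Rightarrow> real" where
  "weighted_L2_sq \<psi> f = (\<integral>x. (norm (f x))\<^sup>2 * norm (\<psi> x) \<partial>lebesgue)"

text \<open>A common consequence of negligibility in \<open>C_inf\<close> and in
  \<open>H_inf\<close>, so that both associations follow from one argument. Squares are used because
  they are what the L2 norm controls.\<close>

definition locally_null :: "(real \<Rightarrow> real ^ 'n::finite \<Rightarrow> complex) \<Rightarrow> bool" where
  "locally_null u \<longleftrightarrow> (\<forall>\<epsilon>\<in>{0<..1}. continuous_on UNIV (u \<epsilon>)) \<and>
     (\<forall>\<psi>\<in>test_functions UNIV. \<forall>q::nat. (\<lambda>\<epsilon>. weighted_L2_sq \<psi> (u \<epsilon>)) \<in> O[at_right 0](\<lambda>\<epsilon>. \<epsilon> ^ q))"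

lemma weighted_L2_sq_nonneg: "weighted_L2_sq \<psi> f \<ge> 0"
  unfolding weighted_L2_sq_def by (rule integral_nonneg_AE) simp

lemma locally_nullI:
  assumes "\<And>\<epsilon>. \<epsilon> \<in> {0<..1} \<Longrightarrow> continuous_on UNIV (u \<epsilon>)"
    and "\<And>\<psi>. \<psi> \<in> test_functions UNIV \<Longrightarrow> \<exists>C s. (\<forall>q::nat. s \<in> O[at_right 0](\<lambda>\<epsilon>. \<epsilon> ^ q)) \<and>
      (\<forall>\<epsilon>\<in>{0<..1}. weighted_L2_sq \<psi> (u \<epsilon>) \<le> C * (s \<epsilon>)\<^sup>2)"
  shows "locally_null u"
  unfolding locally_null_def
proof safe
  fix \<psi> :: "real ^ 'a \<Rightarrow> complex" and q :: nat
  assume "\<psi> \<in> test_functions UNIV"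
  then obtain C s where s: "\<And>q::nat. s \<in> O[at_right 0](\<lambda>\<epsilon>. \<epsilon> ^ q)"
    and le: "\<And>\<epsilon>. \<epsilon> \<in> {0<..1} \<Longrightarrow> weighted_L2_sq \<psi> (u \<epsilon>) \<le> C * (s \<epsilon>)\<^sup>2"
    using assms(2) by blast
  have "(\<lambda>\<epsilon>. weighted_L2_sq \<psi> (u \<epsilon>)) \<in> O[at_right 0](\<lambda>\<epsilon>. s \<epsilon> * s \<epsilon>)"
  proof (rule bigoI)
    show "\<forall>\<^sub>F \<epsilon> in at_right 0. norm (weighted_L2_sq \<psi> (u \<epsilon>)) \<le> C * norm (s \<epsilon> * s \<epsilon>)"
      using eventually_01
    proof eventually_elim
      case (elim \<epsilon>)
      show ?case
        using le[OF elim] weighted_L2_sq_nonneg[of \<psi> "u \<epsilon>"] by (simp add: power2_eq_square)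
    qed
  qed
  \<comment> \<open>One factor provides the power q; boundedness of the other, the case of exponent
    0, suffices.\<close>
  also have "(\<lambda>\<epsilon>. s \<epsilon> * s \<epsilon>) \<in> O[at_right 0](\<lambda>\<epsilon>. \<epsilon> ^ q * \<epsilon> ^ 0)"
    by (rule landau_o.big.mult[OF s s])
  finally show "(\<lambda>\<epsilon>. weighted_L2_sq \<psi> (u \<epsilon>)) \<in> O[at_right 0](\<lambda>\<epsilon>. \<epsilon> ^ q)" by simp
qed (use assms(1) in simp)

lemma null_nets_C_inf_imp_locally_null:
  assumes "u \<in> null_nets (C_inf UNIV)"
  shows "locally_null u"
proof (rule locally_nullI)
  show cont: "continuous_on UNIV (u \<epsilon>)" if "\<epsilon> \<in> {0<..1}" for \<epsilon>
    using assms that by (auto simp: null_nets_def elems_C_inf intro: smooth_on_continuous_on)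
  fix \<psi> :: "real ^ 'a \<Rightarrow> complex" assume \<psi>: "\<psi> \<in> test_functions UNIV"
  obtain K0 where K0: "compact K0" "\<And>x. x \<notin> K0 \<Longrightarrow> \<psi> x = 0" using test_function_support[OF \<psi>] by blast
  \<comment> \<open>The seminorms of \<open>C_inf\<close> require a nonempty compact set, while
    \<open>K0\<close> may be empty when \<psi> vanishes.\<close>
  define K where "K = insert 0 K0"
  have K: "compact K" "K \<noteq> {}" "\<And>x. x \<notin> K \<Longrightarrow> \<psi> x = 0"
    using K0 by (auto simp: K_def)
  define p where "p = (\<lambda>f :: real ^ 'a \<Rightarrow> complex. SUP x\<in>K. norm (mpartial (\<lambda>_. 0) f x))"
  have p: "p \<in> seminorms (C_inf UNIV)"
    unfolding p_def by (rule seminorms_C_infI) (use K in auto)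
  have "weighted_L2_sq \<psi> (u \<epsilon>) \<le> (\<integral>x. 1 * norm (\<psi> x) \<partial>lebesgue) * (p (u \<epsilon>))\<^sup>2" if e: "\<epsilon> \<in> {0<..1}" for \<epsilon>
  proof -
    have "weighted_L2_sq \<psi> (u \<epsilon>) \<le> (\<integral>x. (p (u \<epsilon>))\<^sup>2 * norm (\<psi> x) \<partial>lebesgue)"
      unfolding weighted_L2_sq_def
    proof (rule integral_mono)
      show "integrable lebesgue (\<lambda>x. (norm (u \<epsilon> x))\<^sup>2 * norm (\<psi> x))"
        "integrable lebesgue (\<lambda>x. (p (u \<epsilon>))\<^sup>2 * norm (\<psi> x))"
        by (intro integrable_mult_norm_test_function[OF \<psi>] continuous_intros cont[OF e])+
      fix x
      show "(norm (u \<epsilon> x))\<^sup>2 * norm (\<psi> x) \<le> (p (u \<epsilon>))\<^sup>2 * norm (\<psi> x)"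
      proof (cases "x \<in> K")
        case True
        have "norm (mpartial (\<lambda>_. 0) (u \<epsilon>) x) \<le> p (u \<epsilon>)"
          unfolding p_def using assms e True K
          by (intro cSUP_upper bdd_above_mpartial[of UNIV]) (auto simp: null_nets_def elems_C_inf)
        then show ?thesis by (intro mult_right_mono power_mono) auto
      qed (use K in simp)
    qed
    then show ?thesis by (simp add: mult.commute)
  qed
  then show "\<exists>C s. (\<forall>q::nat. s \<in> O[at_right 0](\<lambda>\<epsilon>. \<epsilon> ^ q)) \<and>
      (\<forall>\<epsilon>\<in>{0<..1}. weighted_L2_sq \<psi> (u \<epsilon>) \<le> C * (s \<epsilon>)\<^sup>2)"
    using assms p by (intro exI[of _ "\<integral>x. 1 * norm (\<psi> x) \<partial>lebesgue"] exI[of _ "\<lambda>\<epsilon>. p (u \<epsilon>)"])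
      (auto simp: null_nets_def)
qed

lemma multi_indices_0: "multi_indices 0 = {\<lambda>_. 0}"
  by (auto simp: multi_indices_def)

text \<open>A test function is bounded, so the plain L2 norm, which is \<open>H_norm 0\<close>,
  dominates the weighted integral up to a constant.\<close>

lemma null_nets_H_inf_imp_locally_null:
  assumes "u \<in> null_nets H_inf"
  shows "locally_null u"
proof (rule locally_nullI)
  show cont: "continuous_on UNIV (u \<epsilon>)" if "\<epsilon> \<in> {0<..1}" for \<epsilon>
    using assms that by (auto simp: null_nets_def H_inf_def intro: smooth_on_continuous_on)
  fix \<psi> :: "real ^ 'a \<Rightarrow> complex" assume \<psi>: "\<psi> \<in> test_functions UNIV"
  obtain B where B: "\<And>x. norm (\<psi> x) \<le> B" using test_function_bounded[OF \<psi>] by blast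
  have p: "H_norm 0 \<in> seminorms H_inf" by (simp add: H_inf_def)
  have "weighted_L2_sq \<psi> (u \<epsilon>) \<le> B * (H_norm 0 (u \<epsilon>))\<^sup>2" if e: "\<epsilon> \<in> {0<..1}" for \<epsilon>
  proof -
    have "\<forall>\<alpha>. in_L2 (mpartial \<alpha> (u \<epsilon>))" using assms e by (auto simp: null_nets_def H_inf_def)
    from spec[OF this, of "\<lambda>_. 0"]
    have int: "integrable lebesgue (\<lambda>x. (norm (u \<epsilon> x))\<^sup>2)" by (simp add: in_L2_def)
    have "weighted_L2_sq \<psi> (u \<epsilon>) \<le> (\<integral>x. (norm (u \<epsilon> x))\<^sup>2 * B \<partial>lebesgue)"
      unfolding weighted_L2_sq_def
    proof (rule integral_mono)
      show "integrable lebesgue (\<lambda>x. (norm (u \<epsilon> x))\<^sup>2 * norm (\<psi> x))"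
        by (intro integrable_mult_norm_test_function[OF \<psi>] continuous_intros cont[OF e])
    qed (use int B in \<open>auto intro: mult_left_mono\<close>)
    also have "\<dots> = B * (H_norm 0 (u \<epsilon>))\<^sup>2"
      by (simp add: H_norm_def L2_norm_def multi_indices_0 integral_nonneg_AE)
    finally show ?thesis .
  qed
  then show "\<exists>C s. (\<forall>q::nat. s \<in> O[at_right 0](\<lambda>\<epsilon>. \<epsilon> ^ q)) \<and>
      (\<forall>\<epsilon>\<in>{0<..1}. weighted_L2_sq \<psi> (u \<epsilon>) \<le> C * (s \<epsilon>)\<^sup>2)"
    using assms p by (intro exI[of _ B] exI[of _ "\<lambda>\<epsilon>. H_norm 0 (u \<epsilon>)"]) (auto simp: null_nets_def)
qed

text \<open>The estimate with exponent N + 1 leaves one factor \<epsilon> after the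
  division.\<close>

lemma bigo_all_powers_imp_tendsto_0:
  assumes "\<And>q::nat. I \<in> O[at_right 0](\<lambda>\<epsilon>::real. \<epsilon> ^ q)"
  shows "((\<lambda>\<epsilon>. I \<epsilon> / \<epsilon> ^ N :: real) \<longlongrightarrow> 0) (at_right 0)"
proof -
  obtain c where "\<forall>\<^sub>F \<epsilon> in at_right 0. norm (I \<epsilon>) \<le> c * norm (\<epsilon> ^ Suc N)"
    using landau_o.bigE[OF assms[of "Suc N"]] by blast
  then have "\<forall>\<^sub>F \<epsilon> in at_right 0. norm (I \<epsilon> / \<epsilon> ^ N) \<le> c * \<epsilon>"
    using eventually_01 by eventually_elim (simp add: divide_le_eq mult_ac)
  moreover have "((\<lambda>\<epsilon>. c * \<epsilon>) \<longlongrightarrow> 0) (at_right 0)"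
    by (auto intro!: tendsto_eq_intros)
  ultimately show ?thesis by (rule Lim_null_comparison)
qed

text \<open>The terms linear in the perturbations are treated with \<open>2 t \<le> \<epsilon> + t\<^sup>2 / \<epsilon>\<close>, so that
  only squares of the perturbations have to be integrated.\<close>

lemma product_perturbation_le:
  fixes b n1 n2 n3 :: complex
  assumes "\<epsilon> > 0" "norm b \<le> \<beta>"
  shows "norm ((b - n1) * (b - n2) - n3 - b * b) \<le>
    2 * \<epsilon> + (\<beta>\<^sup>2 / \<epsilon> + 1) * ((norm n1)\<^sup>2 + (norm n2)\<^sup>2) + (norm n3)\<^sup>2 / \<epsilon>"
proof -
  have amgm: "2 * t \<le> \<epsilon> + t\<^sup>2 / \<epsilon>" for t
  proof -
    have "0 \<le> (t - \<epsilon>)\<^sup>2 / \<epsilon>" using assms(1) by simp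
    also have "\<dots> = \<epsilon> + t\<^sup>2 / \<epsilon> - 2 * t" using assms(1) by (simp add: power2_eq_square field_simps)
    finally show ?thesis by simp
  qed
  have "(b - n1) * (b - n2) - n3 - b * b = - (b * n1) - b * n2 + n1 * n2 - n3"
    by (simp add: algebra_simps)
  also have "norm \<dots> \<le> norm b * norm n1 + norm b * norm n2 + norm n1 * norm n2 + norm n3"
    unfolding norm_mult[symmetric]
    using norm_triangle_ineq4[of "- (b * n1) - b * n2 + n1 * n2" n3]
      norm_triangle_ineq[of "- (b * n1) - b * n2" "n1 * n2"]
      norm_triangle_ineq4[of "- (b * n1)" "b * n2"] norm_minus_cancel[of "b * n1"] by linarith
  also have "\<dots> \<le> \<beta> * norm n1 + \<beta> * norm n2 + norm n1 * norm n2 + norm n3"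
    using assms(2) by (intro add_mono mult_right_mono) auto
  also have "\<dots> \<le> \<beta> * norm n1 + \<beta> * norm n2 + ((norm n1)\<^sup>2 + (norm n2)\<^sup>2) + norm n3"
  proof -
    have "0 \<le> norm n1 * norm n2" by simp
    then have "norm n1 * norm n2 \<le> (norm n1)\<^sup>2 + (norm n2)\<^sup>2"
      using sum_squares_bound[of "norm n1" "norm n2"] unfolding mult.assoc by linarith
    then show ?thesis by simp
  qed
  finally have "norm ((b - n1) * (b - n2) - n3 - b * b)
      \<le> \<beta> * norm n1 + \<beta> * norm n2 + ((norm n1)\<^sup>2 + (norm n2)\<^sup>2) + norm n3" .
  moreover have "2 * (\<beta> * norm n1) \<le> \<epsilon> + \<beta>\<^sup>2 / \<epsilon> * (norm n1)\<^sup>2"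
    "2 * (\<beta> * norm n2) \<le> \<epsilon> + \<beta>\<^sup>2 / \<epsilon> * (norm n2)\<^sup>2"
    using amgm[of "\<beta> * norm n1"] amgm[of "\<beta> * norm n2"] by (simp_all add: power_mult_distrib)
  moreover have "2 * norm n3 \<le> \<epsilon> + (norm n3)\<^sup>2 / \<epsilon>" by (rule amgm)
  moreover have "0 \<le> \<beta>\<^sup>2 / \<epsilon> * (norm n1)\<^sup>2" "0 \<le> \<beta>\<^sup>2 / \<epsilon> * (norm n2)\<^sup>2" "0 \<le> (norm n3)\<^sup>2 / \<epsilon>"
    using assms(1) by simp_all
  ultimately show ?thesis using assms(1) unfolding distrib_left distrib_right by linarith
qed

text \<open>Reduces association of the whole product class to convergence for one representative
  \<open>b\<close>. The uniform bound on \<open>b\<close> by a power of 1/\<epsilon> is outweighed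
  by the null perturbations, which decrease faster than every power of \<epsilon>.\<close>

lemma associated_square:
  fixes E :: "(real ^ 'n::finite \<Rightarrow> complex) lcs" and C :: real
  assumes null: "\<And>u. u \<in> null_nets E \<Longrightarrow> locally_null u"
    and refl: "\<And>u. u \<in> moderate_nets E \<Longrightarrow> (u, u) \<in> net_equiv E"
    and b: "b \<in> moderate_nets E" "(\<lambda>\<epsilon>. b \<epsilon> * b \<epsilon>) \<in> moderate_nets E"
    and cont: "\<And>\<epsilon>. \<epsilon> \<in> {0<..1} \<Longrightarrow> continuous_on UNIV (b \<epsilon>)"
    and bound: "\<And>\<epsilon> x. \<epsilon> \<in> {0<..1} \<Longrightarrow> norm (b \<epsilon> x) \<le> C / \<epsilon> ^ N"
    and w: "w \<in> distributions UNIV"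
    and lim: "\<And>\<psi>. \<psi> \<in> test_functions UNIV \<Longrightarrow>
      ((\<lambda>\<epsilon>. fun_distr (b \<epsilon> * b \<epsilon>) \<psi>) \<longlongrightarrow> w \<psi>) (at_right 0)"
  shows "associated UNIV (gen_mult E (net_class E b) (net_class E b)) w"
  unfolding associated_def
proof (intro conjI ballI)
  have "(\<lambda>\<epsilon>. b \<epsilon> * b \<epsilon>) \<in> gen_mult E (net_class E b) (net_class E b)"
    unfolding gen_mult_def net_class_def using refl[OF b(1)] refl[OF b(2)] by blast
  then show "gen_mult E (net_class E b) (net_class E b) \<noteq> {}" by blast
next
  fix z and \<psi> :: "real ^ 'n \<Rightarrow> complex"
  assume "z \<in> gen_mult E (net_class E b) (net_class E b)" and \<psi>: "\<psi> \<in> test_functions UNIV"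
  then obtain u v where uv: "(b, u) \<in> net_equiv E" "(b, v) \<in> net_equiv E"
      "((\<lambda>\<epsilon>. u \<epsilon> * v \<epsilon>), z) \<in> net_equiv E"
    by (auto simp: gen_mult_def net_class_def)
  \<comment> \<open>Two errors come from changing the factors, the third from changing the
    representative of the product.\<close>
  define n1 n2 n3 where "n1 = (\<lambda>\<epsilon>. b \<epsilon> - u \<epsilon>)" and "n2 = (\<lambda>\<epsilon>. b \<epsilon> - v \<epsilon>)"
    and "n3 = (\<lambda>\<epsilon>. u \<epsilon> * v \<epsilon> - z \<epsilon>)"
  have n: "locally_null n1" "locally_null n2" "locally_null n3"
    using uv null by (auto simp: net_equiv_def n1_def n2_def n3_def)
  have z: "z \<epsilon> x = (b \<epsilon> x - n1 \<epsilon> x) * (b \<epsilon> x - n2 \<epsilon> x) - n3 \<epsilon> x" for \<epsilon> x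
    by (simp add: n1_def n2_def n3_def)
  let ?I = "\<lambda>n \<epsilon>. weighted_L2_sq \<psi> (n \<epsilon>)"
  define P where "P = (\<integral>x. 1 * norm (\<psi> x) \<partial>lebesgue)"
  \<comment> \<open>The exponent 2N + 1 comes from \<open>\<beta>\<^sup>2 / \<epsilon>\<close> with
    \<beta> = C/\<epsilon>^N. The trivial power \<open>\<epsilon> ^ 0\<close> is kept so that one
    limit rule treats all terms.\<close>
  let ?R = "\<lambda>\<epsilon>. 2 * \<epsilon> * P + (C\<^sup>2 * (?I n1 \<epsilon> / \<epsilon> ^ (2 * N + 1) + ?I n2 \<epsilon> / \<epsilon> ^ (2 * N + 1))
    + (?I n1 \<epsilon> / \<epsilon> ^ 0 + ?I n2 \<epsilon> / \<epsilon> ^ 0)) + ?I n3 \<epsilon> / \<epsilon> ^ 1"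
  have le: "norm (fun_distr (z \<epsilon>) \<psi> - fun_distr (b \<epsilon> * b \<epsilon>) \<psi>) \<le> ?R \<epsilon>" if e: "\<epsilon> \<in> {0<..1}" for \<epsilon>
  proof -
    have e': "\<epsilon> > 0" using e by simp
    have c: "continuous_on UNIV (n1 \<epsilon>)" "continuous_on UNIV (n2 \<epsilon>)" "continuous_on UNIV (n3 \<epsilon>)"
      using n e by (auto simp: locally_null_def)
    have cz: "continuous_on UNIV (z \<epsilon>)"
      unfolding z[abs_def] by (intro continuous_intros c cont[OF e])
    have cb: "continuous_on UNIV (b \<epsilon> * b \<epsilon>)"
      unfolding times_fun_def by (intro continuous_intros cont[OF e])
    note int = integrable_mult_norm_test_function[OF \<psi>]
    let ?k = "(C / \<epsilon> ^ N)\<^sup>2 / \<epsilon> + 1"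
    have ints: "integrable lebesgue (\<lambda>x. 1 * norm (\<psi> x))"
      "integrable lebesgue (\<lambda>x. (norm (n1 \<epsilon> x))\<^sup>2 * norm (\<psi> x))"
      "integrable lebesgue (\<lambda>x. (norm (n2 \<epsilon> x))\<^sup>2 * norm (\<psi> x))"
      "integrable lebesgue (\<lambda>x. (norm (n3 \<epsilon> x))\<^sup>2 * norm (\<psi> x))"
      by (intro int continuous_intros c)+
    let ?g = "\<lambda>x. 2 * \<epsilon> * (1 * norm (\<psi> x)) + ?k * ((norm (n1 \<epsilon> x))\<^sup>2 * norm (\<psi> x) + (norm (n2 \<epsilon> x))\<^sup>2 * norm (\<psi> x))
          + (1 / \<epsilon>) * ((norm (n3 \<epsilon> x))\<^sup>2 * norm (\<psi> x))"
    have "fun_distr (z \<epsilon>) \<psi> - fun_distr (b \<epsilon> * b \<epsilon>) \<psi>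
        = (\<integral>x. (z \<epsilon> x - b \<epsilon> x * b \<epsilon> x) * \<psi> x \<partial>lebesgue)"
      unfolding fun_distr_def
      using integrable_mult_test_function[OF \<psi> cz] integrable_mult_test_function[OF \<psi> cb]
      by (simp add: left_diff_distrib)
    also have "norm \<dots> \<le> (\<integral>x. norm ((z \<epsilon> x - b \<epsilon> x * b \<epsilon> x) * \<psi> x) \<partial>lebesgue)"
      by (rule integral_norm_bound)
    also have "\<dots> \<le> integral\<^sup>L lebesgue ?g"
    proof (rule integral_mono)
      show "integrable lebesgue (\<lambda>x. norm ((z \<epsilon> x - b \<epsilon> x * b \<epsilon> x) * \<psi> x))"
        unfolding norm_mult by (intro int continuous_intros cz cont[OF e])
      show "integrable lebesgue ?g"
        by (intro Bochner_Integration.integrable_add integrable_mult_right ints)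
      fix x
      have "norm (z \<epsilon> x - b \<epsilon> x * b \<epsilon> x) \<le> 2 * \<epsilon> + ?k * ((norm (n1 \<epsilon> x))\<^sup>2 + (norm (n2 \<epsilon> x))\<^sup>2)
          + (norm (n3 \<epsilon> x))\<^sup>2 / \<epsilon>"
        unfolding z by (rule product_perturbation_le[OF e' bound[OF e]])
      from mult_right_mono[OF this norm_ge_zero[of "\<psi> x"]]
      show "norm ((z \<epsilon> x - b \<epsilon> x * b \<epsilon> x) * \<psi> x) \<le> ?g x"
        unfolding norm_mult by (simp add: algebra_simps)
    qed
    also have "\<dots> = 2 * \<epsilon> * P + ?k * (?I n1 \<epsilon> + ?I n2 \<epsilon>) + (1 / \<epsilon>) * ?I n3 \<epsilon>"
      unfolding weighted_L2_sq_def P_def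
      using ints by simp
    also have "\<dots> = ?R \<epsilon>"
      using e' by (simp add: field_simps power_divide power_add flip: power_mult)
    finally show ?thesis .
  qed
  have I: "((\<lambda>\<epsilon>. ?I n \<epsilon> / \<epsilon> ^ m) \<longlongrightarrow> 0) (at_right 0)" if "locally_null n" for n m
    by (rule bigo_all_powers_imp_tendsto_0) (use that \<psi> in \<open>auto simp: locally_null_def\<close>)
  have "(?R \<longlongrightarrow> 2 * 0 * P + (C\<^sup>2 * (0 + 0) + (0 + 0)) + 0) (at_right 0)"
    by (intro tendsto_intros I n)
  then have R: "(?R \<longlongrightarrow> 0) (at_right 0)" by simp
  have "((\<lambda>\<epsilon>. fun_distr (z \<epsilon>) \<psi> - fun_distr (b \<epsilon> * b \<epsilon>) \<psi>) \<longlongrightarrow> 0) (at_right 0)"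
    by (rule Lim_null_comparison[OF _ R]) (use eventually_01 le in \<open>auto elim: eventually_mono\<close>)
  from tendsto_add[OF this lim[OF \<psi>]]
  show "((\<lambda>\<epsilon>. fun_distr (z \<epsilon>) \<psi>) \<longlongrightarrow> w \<psi>) (at_right 0)" by simp
qed (rule w)

section \<open>Convergence of the regularizations\<close>

lemma lborel_integral_affine:
  fixes F :: "'a::euclidean_space \<Rightarrow> 'b::{banach, second_countable_topology}"
  assumes "F \<in> borel_measurable borel" "c > 0"
  shows "(\<integral>x. F x \<partial>lborel) = c ^ DIM('a) *\<^sub>R (\<integral>z. F (t + c *\<^sub>R z) \<partial>lborel)"
proof -
  have "(\<integral>x. F x \<partial>lborel) = (\<integral>x. F x \<partial>density (distr lborel borel (\<lambda>x. t + c *\<^sub>R x)) (\<lambda>_. ennreal (\<bar>c\<bar> ^ DIM('a))))"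
    by (subst lborel_affine[of c t]) (use assms(2) in simp_all)
  also have "\<dots> = (\<integral>x. (\<bar>c\<bar> ^ DIM('a)) *\<^sub>R F x \<partial>distr lborel borel (\<lambda>x. t + c *\<^sub>R x))"
    by (rule integral_density) (use assms in auto)
  also have "\<dots> = (\<integral>z. (\<bar>c\<bar> ^ DIM('a)) *\<^sub>R F (t + c *\<^sub>R z) \<partial>lborel)"
    by (rule integral_distr) (use assms in auto)
  finally show ?thesis using assms(2) by simp
qed

text \<open>Fubini and the substitution x = y + \<epsilon> z move the mollification from the measure
  to the test function: the pairing becomes the integral over \<mu> of an average of \<psi> near y,
  which tends to \<psi>(y) because \<rho> has integral 1.\<close>

lemma (in borel_prob) tendsto_integral_measure_convolve:
  fixes \<rho> :: "real ^ 'n \<Rightarrow> real"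
  assumes \<rho>: "continuous_on UNIV \<rho>" "\<And>x. \<bar>\<rho> x\<bar> \<le> B" "\<And>x. \<rho> x > 0"
    "integrable lebesgue \<rho>" "(\<integral>x. \<rho> x \<partial>lebesgue) = 1"
    and \<psi>: "\<psi> \<in> test_functions UNIV"
  shows "((\<lambda>\<epsilon>. fun_distr (\<lambda>x. complex_of_real (measure_convolve M (scaled \<rho> \<epsilon>) x)) \<psi>)
    \<longlongrightarrow> measure_distr M \<psi>) (at_right 0)"
proof -
  note cont\<psi> = test_function_continuous[OF \<psi>]
  obtain K where K: "compact K" "\<And>x. x \<notin> K \<Longrightarrow> \<psi> x = 0" using test_function_support[OF \<psi>] by blast
  obtain D where D: "\<And>x. norm (\<psi> x) \<le> D" using test_function_bounded[OF \<psi>] by blast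
  have \<rho>_meas: "\<rho> \<in> borel_measurable borel" by (rule borel_measurable_continuous_onI[OF \<rho>(1)])
  have \<rho>_int: "integrable lborel \<rho>" "(\<integral>x. \<rho> x \<partial>lborel) = 1"
    using \<rho>(4,5) \<rho>_meas by (simp_all add: integrable_completion integral_completion)
  define G where "G \<epsilon> y = (\<integral>z. \<rho> z *\<^sub>R \<psi> (y + \<epsilon> *\<^sub>R z) \<partial>lborel)" for \<epsilon> y
  have int_G: "integrable lborel (\<lambda>z. \<rho> z *\<^sub>R \<psi> (y + \<epsilon> *\<^sub>R z))" for \<epsilon> y
  proof (rule Bochner_Integration.integrable_bound)
    show "integrable lborel (\<lambda>z. \<rho> z * D)" by (intro integrable_mult_left \<rho>_int)
    show "(\<lambda>z. \<rho> z *\<^sub>R \<psi> (y + \<epsilon> *\<^sub>R z)) \<in> borel_measurable lborel"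
      unfolding measurable_lborel2
      by (intro borel_measurable_continuous_onI continuous_on_scaleR \<rho>(1)
          continuous_on_compose2[OF cont\<psi>] continuous_intros) simp
    show "AE z in lborel. norm (\<rho> z *\<^sub>R \<psi> (y + \<epsilon> *\<^sub>R z)) \<le> norm (\<rho> z * D)"
      using D \<rho>(3) order_trans[OF norm_ge_zero D] by (intro AE_I2) (auto simp: abs_mult intro!: mult_mono)
  qed
  have G_bound: "norm (G \<epsilon> y) \<le> D" for \<epsilon> y
  proof -
    have "norm (G \<epsilon> y) \<le> (\<integral>z. norm (\<rho> z *\<^sub>R \<psi> (y + \<epsilon> *\<^sub>R z)) \<partial>lborel)"
      unfolding G_def by (rule integral_norm_bound)
    also have "\<dots> \<le> (\<integral>z. \<rho> z * D \<partial>lborel)"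
    proof (rule integral_mono)
      show "norm (\<rho> z *\<^sub>R \<psi> (y + \<epsilon> *\<^sub>R z)) \<le> \<rho> z * D" for z
        using D \<rho>(3)[of z] by (simp add: mult_left_mono)
      show "integrable lborel (\<lambda>z. norm (\<rho> z *\<^sub>R \<psi> (y + \<epsilon> *\<^sub>R z)))" by (rule integrable_norm[OF int_G])
    qed (use \<rho>_int in simp)
    finally show ?thesis by (simp add: \<rho>_int)
  qed
  \<comment> \<open>A parameter integral is measurable once its integrand is jointly measurable, and
    here the integrand is jointly continuous.\<close>
  have G_meas: "G \<epsilon> \<in> borel_measurable M" for \<epsilon>
  proof -
    have "(\<lambda>p. \<rho> (snd p) *\<^sub>R \<psi> (fst p + \<epsilon> *\<^sub>R snd p)) \<in> borel_measurable (borel \<Otimes>\<^sub>M (borel :: (real ^ 'n) measure))"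
      unfolding borel_prod
      by (intro borel_measurable_continuous_onI continuous_on_scaleR continuous_on_compose2[OF \<rho>(1)]
          continuous_on_compose2[OF cont\<psi>] continuous_intros) auto
    also have "borel_measurable (borel \<Otimes>\<^sub>M (borel :: (real ^ 'n) measure))
        = borel_measurable (M \<Otimes>\<^sub>M lborel)"
      by (intro measurable_cong_sets sets_pair_measure_cong) (simp_all add: sets_M)
    finally show ?thesis
      unfolding G_def using sigma_finite_lborel
      by (intro sigma_finite_measure.borel_measurable_lebesgue_integral) (auto simp: case_prod_beta')
  qed
  have eq: "fun_distr (\<lambda>x. complex_of_real (measure_convolve M (scaled \<rho> \<epsilon>) x)) \<psi> = (\<integral>y. G \<epsilon> y \<partial>M)"
    if "\<epsilon> > 0" for \<epsilon>
  proof -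
    let ?c = "1 / \<epsilon> ^ CARD('n)"
    define f where "f x y = (?c * \<rho> ((x - y) /\<^sub>R \<epsilon>)) *\<^sub>R \<psi> x" for x y
    have c: "?c > 0" using that by simp
    have \<rho>_int_M: "integrable M (\<lambda>y. \<rho> ((x - y) /\<^sub>R \<epsilon>))" for x
      by (rule integrable_rescaled[OF \<rho>(1,2)])
    have h_cont: "continuous_on UNIV (\<lambda>x. \<integral>y. \<rho> ((x - y) /\<^sub>R \<epsilon>) \<partial>M)"
      by (rule continuous_on_rescaled_integral[OF \<rho>(1,2)])
    have f_meas: "(\<lambda>p. f (fst p) (snd p)) \<in> borel_measurable (lborel \<Otimes>\<^sub>M M)"
    proof -
      have "(\<lambda>p. f (fst p) (snd p)) \<in> borel_measurable (borel \<Otimes>\<^sub>M borel)"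
        unfolding borel_prod f_def
        by (intro borel_measurable_continuous_onI continuous_on_scaleR continuous_on_compose2[OF \<rho>(1)]
            continuous_on_compose2[OF cont\<psi>] continuous_intros) auto
      also have "borel_measurable (borel \<Otimes>\<^sub>M borel) = borel_measurable (lborel \<Otimes>\<^sub>M M)"
        by (intro measurable_cong_sets sets_pair_measure_cong) (simp_all add: sets_M)
      finally show ?thesis .
    qed
    interpret P: pair_sigma_finite lborel M
      by (rule pair_sigma_finite.intro) (simp_all add: sigma_finite_lborel sigma_finite_measure_axioms)
    have "integrable (lborel \<Otimes>\<^sub>M M) (\<lambda>p. f (fst p) (snd p))"
    proof (rule P.Fubini_integrable[OF f_meas])
      \<comment> \<open>For Fubini, absolute values are integrated over y first: by positivity of
        \<rho> this gives the regularization times |\<psi>|, continuous with compact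
        support.\<close>
      have "(\<integral>y. norm (f x y) \<partial>M) = (?c * (\<integral>y. \<rho> ((x - y) /\<^sub>R \<epsilon>) \<partial>M)) * norm (\<psi> x)" for x
      proof -
        have "norm (f x y) = (?c * \<rho> ((x - y) /\<^sub>R \<epsilon>)) * norm (\<psi> x)" for y
          using c \<rho>(3) by (simp add: f_def abs_of_pos abs_mult del: divide_pos_pos)
        then show ?thesis by simp
      qed
      moreover have "integrable lborel (\<lambda>x. (?c * (\<integral>y. \<rho> ((x - y) /\<^sub>R \<epsilon>) \<partial>M)) * norm (\<psi> x))"
        by (rule integrable_continuous_compact_support(1)[OF _ K(1)])
          (intro continuous_intros h_cont cont\<psi>, simp add: K(2))
      ultimately show "integrable lborel (\<lambda>x. \<integral>y. norm (f (fst (x, y)) (snd (x, y))) \<partial>M)" by simp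
      show "AE x in lborel. integrable M (\<lambda>y. f (fst (x, y)) (snd (x, y)))"
        unfolding f_def fst_conv snd_conv by (intro AE_I2 integrable_scaleR_left integrable_mult_right \<rho>_int_M)
    qed
    then have "integrable (lborel \<Otimes>\<^sub>M M) (case_prod f)" by (simp add: case_prod_beta')
    from P.Fubini_integral[OF this]
    have fubini: "(\<integral>x. (\<integral>y. f x y \<partial>M) \<partial>lborel) = (\<integral>y. (\<integral>x. f x y \<partial>lborel) \<partial>M)" by simp
    have inner: "(\<integral>x. f x y \<partial>lborel) = G \<epsilon> y" for y
    proof -
      have "(\<lambda>x. f x y) \<in> borel_measurable borel"
        unfolding f_def
        by (intro borel_measurable_continuous_onI continuous_on_scaleR continuous_on_mult continuous_on_const
            continuous_on_compose2[OF \<rho>(1)] cont\<psi> continuous_intros) simp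
      \<comment> \<open>The substitution contributes \<epsilon>^n, which cancels the normalization
        \<open>?c\<close>.\<close>
      then have "(\<integral>x. f x y \<partial>lborel) = \<epsilon> ^ DIM(real ^ 'n) *\<^sub>R (\<integral>z. f (y + \<epsilon> *\<^sub>R z) y \<partial>lborel)"
        using that by (rule lborel_integral_affine)
      also have "(\<lambda>z. f (y + \<epsilon> *\<^sub>R z) y) = (\<lambda>z. ?c *\<^sub>R (\<rho> z *\<^sub>R \<psi> (y + \<epsilon> *\<^sub>R z)))"
        using that by (simp add: f_def)
      also have "(\<integral>z. ?c *\<^sub>R (\<rho> z *\<^sub>R \<psi> (y + \<epsilon> *\<^sub>R z)) \<partial>lborel) = ?c *\<^sub>R G \<epsilon> y"
        unfolding G_def by (rule integral_scaleR_right)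
      finally show ?thesis using that by simp
    qed
    have "fun_distr (\<lambda>x. complex_of_real (measure_convolve M (scaled \<rho> \<epsilon>) x)) \<psi>
        = (\<integral>x. (\<integral>y. f x y \<partial>M) \<partial>lebesgue)"
      unfolding fun_distr_def
    proof (rule Bochner_Integration.integral_cong[OF refl])
      fix x
      have "(\<integral>y. f x y \<partial>M) = (?c * (\<integral>y. \<rho> ((x - y) /\<^sub>R \<epsilon>) \<partial>M)) *\<^sub>R \<psi> x"
        unfolding f_def using \<rho>_int_M by simp
      then show "complex_of_real (measure_convolve M (scaled \<rho> \<epsilon>) x) * \<psi> x = (\<integral>y. f x y \<partial>M)"
        by (simp add: measure_convolve_scaled scaleR_conv_of_real)
    qed
    \<comment> \<open>The pairing is defined with the completed measure, Fubini was applied to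
      \<open>lborel\<close>; for Borel integrands both integrals agree.\<close>
    also have "\<dots> = (\<integral>x. (\<integral>y. f x y \<partial>M) \<partial>lborel)"
    proof (rule integral_completion)
      have "(\<lambda>x. (?c * (\<integral>y. \<rho> ((x - y) /\<^sub>R \<epsilon>) \<partial>M)) *\<^sub>R \<psi> x) \<in> borel_measurable lborel"
        unfolding measurable_lborel2
        by (intro borel_measurable_continuous_onI continuous_intros h_cont cont\<psi>)
      then show "(\<lambda>x. \<integral>y. f x y \<partial>M) \<in> borel_measurable lborel"
        unfolding f_def using \<rho>_int_M by simp
    qed
    finally show ?thesis unfolding fubini inner .
  qed
  \<comment> \<open>Dominated convergence along sequences is used twice: in z with majorant
    \<rho>(z) D, then in y with the constant D.\<close>
  have lim: "((\<lambda>\<epsilon>. \<integral>y. G \<epsilon> y \<partial>M) \<longlongrightarrow> (\<integral>y. \<psi> y \<partial>M)) (at_right 0)"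
    unfolding tendsto_at_iff_sequentially o_def
  proof (intro allI impI)
    fix X :: "nat \<Rightarrow> real" assume X: "X \<longlonglongrightarrow> 0"
    have G_lim: "(\<lambda>n. G (X n) y) \<longlonglongrightarrow> \<psi> y" for y
    proof -
      have "(\<lambda>n. G (X n) y) \<longlonglongrightarrow> (\<integral>z. \<rho> z *\<^sub>R \<psi> y \<partial>lborel)"
        unfolding G_def
      proof (rule integral_dominated_convergence[where w = "\<lambda>z. \<rho> z * D"])
        show "(\<lambda>z. \<rho> z *\<^sub>R \<psi> y) \<in> borel_measurable lborel" using \<rho>_meas by simp
        show "AE z in lborel. (\<lambda>n. \<rho> z *\<^sub>R \<psi> (y + X n *\<^sub>R z)) \<longlonglongrightarrow> \<rho> z *\<^sub>R \<psi> y"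
        proof (rule AE_I2)
          fix z
          have "(\<lambda>n. y + X n *\<^sub>R z) \<longlonglongrightarrow> y + 0 *\<^sub>R z" by (intro tendsto_intros X)
          then have "(\<lambda>n. \<psi> (y + X n *\<^sub>R z)) \<longlonglongrightarrow> \<psi> y"
            by (intro continuous_on_tendsto_compose[OF cont\<psi>]) auto
          then show "(\<lambda>n. \<rho> z *\<^sub>R \<psi> (y + X n *\<^sub>R z)) \<longlonglongrightarrow> \<rho> z *\<^sub>R \<psi> y" by (intro tendsto_intros)
        qed
        show "AE z in lborel. norm (\<rho> z *\<^sub>R \<psi> (y + X n *\<^sub>R z)) \<le> \<rho> z * D" for n
          using D \<rho>(3) by (intro AE_I2) (simp add: mult_left_mono less_imp_le)
      qed (use int_G \<rho>_int in auto)
      then show ?thesis using \<rho>_int by simp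
    qed
    show "(\<lambda>n. \<integral>y. G (X n) y \<partial>M) \<longlonglongrightarrow> (\<integral>y. \<psi> y \<partial>M)"
    proof (rule integral_dominated_convergence[where w = "\<lambda>_. D"])
      show "\<psi> \<in> borel_measurable M"
        unfolding measurable_cong_sets[OF sets_M refl] by (rule borel_measurable_continuous_onI[OF cont\<psi>])
    qed (use G_lim G_meas G_bound in auto)
  qed
  show ?thesis
    unfolding measure_distr_def
    by (rule Lim_transform_eventually[OF lim])
      (use eventually_01 in \<open>auto elim!: eventually_mono simp: eq\<close>)
qed

text \<open>A probability measure is a distribution of order 0: C = 1 and k = 0 serve every compact
  set, since the integral is bounded by the supremum norm.\<close>

lemma (in borel_prob) measure_distr_distribution: "measure_distr M \<in> distributions UNIV"
proof -
  have int: "integrable M \<psi>" if \<psi>: "\<psi> \<in> test_functions UNIV" for \<psi> :: "real ^ 'n \<Rightarrow> complex"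
  proof -
    obtain D where D: "\<And>x. norm (\<psi> x) \<le> D" using test_function_bounded[OF \<psi>] by blast
    have "\<psi> \<in> borel_measurable M"
      unfolding measurable_cong_sets[OF sets_M refl]
      by (rule borel_measurable_continuous_onI[OF test_function_continuous[OF \<psi>]])
    then show ?thesis by (intro integrable_const_bound[of _ D]) (use D in auto)
  qed
  have "norm (measure_distr M \<psi>) \<le> 1 * (\<Sum>\<alpha>\<in>multi_indices 0. SUP x. norm (mpartial \<alpha> \<psi> x))"
    if \<psi>: "\<psi> \<in> test_functions UNIV" for \<psi> :: "real ^ 'n \<Rightarrow> complex"
  proof -
    obtain D where "\<And>x. norm (\<psi> x) \<le> D" using test_function_bounded[OF \<psi>] by blast
    then have "norm (\<psi> x) \<le> (SUP x. norm (\<psi> x))" for x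
      by (intro cSUP_upper) (auto simp: bdd_above_def)
    then have "norm (integral\<^sup>L M \<psi>) \<le> (\<integral>x. (SUP x. norm (\<psi> x)) \<partial>M)"
      by (intro order_trans[OF integral_norm_bound] integral_mono integrable_norm int[OF \<psi>]) auto
    then show ?thesis by (simp add: measure_distr_def multi_indices_0 prob_space)
  qed
  then have "\<exists>C k. \<forall>\<psi>\<in>test_functions UNIV. closure {x. \<psi> x \<noteq> 0} \<subseteq> K \<longrightarrow>
      norm (measure_distr M \<psi>) \<le> C * (\<Sum>\<alpha>\<in>multi_indices k. SUP x. norm (mpartial \<alpha> \<psi> x))" for K
    by blast
  then show ?thesis
    unfolding distributions_def by (simp add: measure_distr_def int)
qed

theorem proposition2p1:
  fixes \<mu> :: "(real ^ 'n::finite) measure"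
    and \<rho> :: "real ^ 'n \<Rightarrow> real"
    and m0 :: real
    and h :: "real \<Rightarrow> real ^ 'n \<Rightarrow> real"
    and \<phi>_net :: "real \<Rightarrow> real ^ 'n \<Rightarrow> complex"
    and \<phi> :: "(real \<Rightarrow> real ^ 'n \<Rightarrow> complex) set"
  assumes "prob_space \<mu>" and "sets \<mu> = sets borel"
    and "integrable lebesgue \<rho>" and "\<rho> \<in> W_inf_inf"
    and "\<And>x. \<rho> x > 0"
    and "(\<integral>x. \<rho> x \<partial>lebesgue) = 1"
    and "m0 > real CARD('n)"
    and "\<And>x. norm x \<ge> 1 \<Longrightarrow> \<rho> x \<ge> norm x powr (- m0)"
  defines "h \<equiv> \<lambda>\<epsilon>. measure_convolve \<mu> (scaled \<rho> \<epsilon>)"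
    and "\<phi>_net \<equiv> \<lambda>\<epsilon> x. complex_of_real (sqrt (h \<epsilon> x))"
    and "\<phi> \<equiv> net_class (C_inf UNIV) \<phi>_net"
  shows "((\<forall>\<epsilon>\<in>{0<..1}. \<forall>x. h \<epsilon> x > 0) \<and>
      \<phi>_net \<in> moderate_nets (C_inf UNIV) \<and>
      \<phi> \<in> gen_functions (C_inf UNIV) \<and>
      associated UNIV (gen_mult (C_inf UNIV) \<phi> \<phi>) (measure_distr \<mu>)) \<and>
    (\<exists>g \<in> gen_functions H_inf. \<exists>g_net \<in> g.
      associated UNIV (gen_mult H_inf g g) (measure_distr \<mu>) \<and>
      (\<forall>\<Omega>. open \<Omega> \<and> bounded \<Omega> \<longrightarrow>
        (\<lambda>\<epsilon>. restr \<Omega> (g_net \<epsilon>)) \<in> moderate_nets (C_inf \<Omega>) \<and>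
        net_class (C_inf \<Omega>) (\<lambda>\<epsilon>. restr \<Omega> (g_net \<epsilon>)) = gen_restrict \<Omega> \<phi>))"
proof -
  interpret borel_prob \<mu>
    using assms(1,2) by (simp add: borel_prob_def borel_prob_axioms_def)
  have bs: "bounded_smooth \<rho>" by (rule W_inf_inf_imp_bounded_smooth[OF assms(4)])
  then have \<rho>_cont: "continuous_on UNIV \<rho>" by (simp add: bounded_smooth_def smooth_on_continuous_on)
  obtain B where B: "\<And>x. \<bar>\<rho> x\<bar> \<le> B" using bounded_smoothE[OF bs] by blast
  have m0: "m0 \<ge> 0" using assms(7) by linarith
  obtain c a where c: "c > 0" "\<And>x. \<rho> x \<ge> c / (1 + norm x) ^ a"
    using powr_decay_lower_bound[OF \<rho>_cont assms(5,8) m0] by blast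
  obtain d where d: "d > 0" "\<And>\<epsilon> x. \<epsilon> \<in> {0<..1} \<Longrightarrow> h \<epsilon> x \<ge> d / weight \<epsilon> x ^ a"
    using measure_convolve_lower_bound[OF \<rho>_cont B c] unfolding h_def by blast
  have h_pos: "h \<epsilon> x > 0" if "\<epsilon> \<in> {0<..1}" for \<epsilon> x
  proof -
    have "0 < d / weight \<epsilon> x ^ a" using d(1) weight_ge_1[OF that, of x] by simp
    then show ?thesis using d(2)[OF that, of x] by linarith
  qed
  have h_temp: "temperate k h" for k
    unfolding h_def by (rule temperate_measure_convolve[OF bs])
  \<comment> \<open>Taking reciprocals turns the lower bound by a negative power of the weight into
    growth with exponent \<open>a\<close>, the input for inverses and square roots.\<close>
  have h_inv: "growth (\<lambda>\<epsilon> x. inverse (h \<epsilon> x))"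
  proof (rule growthI[of _ "1 / d" a])
    fix \<epsilon> :: real and x :: "real ^ 'n" assume e: "\<epsilon> \<in> {0<..1}"
    have "0 < d / weight \<epsilon> x ^ a" using d(1) weight_ge_1[OF e, of x] by simp
    from le_imp_inverse_le[OF d(2)[OF e] this]
    show "norm (inverse (h \<epsilon> x)) \<le> 1 / d * weight \<epsilon> x ^ a"
      using h_pos[OF e, of x] by simp
  qed
  note of_real_temp = temperate_linear[OF bounded_linear_of_real]
  have \<phi>_temp: "temperate k \<phi>_net" for k
    unfolding \<phi>_net_def by (rule of_real_temp[OF temperate_sqrt[OF h_inv h_pos h_temp]])
  have \<phi>_sq: "\<phi>_net \<epsilon> x * \<phi>_net \<epsilon> x = complex_of_real (h \<epsilon> x)" if "\<epsilon> \<in> {0<..1}" for \<epsilon> x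
    using h_pos[OF that, of x] by (simp add: \<phi>_net_def flip: of_real_mult)
  \<comment> \<open>\<open>associated_square\<close> requires a bound uniform in x. It comes from
    sqrt h \<le> 1 + h, where h \<le> B/\<epsilon>^n and 1 \<le> 1/\<epsilon>^n.\<close>
  have \<phi>_bound: "norm (\<phi>_net \<epsilon> x) \<le> (B + 1) / \<epsilon> ^ CARD('n)" if e: "\<epsilon> \<in> {0<..1}" for \<epsilon> x
  proof -
    have eps: "0 < 1 / \<epsilon> ^ CARD('n)" "1 \<le> 1 / \<epsilon> ^ CARD('n)" using e by (simp_all add: power_le_one)
    have h0: "0 \<le> h \<epsilon> x" using h_pos[OF e, of x] by simp
    have "h \<epsilon> x \<le> 1 / \<epsilon> ^ CARD('n) * B"
      unfolding h_def measure_convolve_scaled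
      by (rule mult_left_mono) (use abs_rescaled_integral_le[OF \<rho>_cont B, of \<epsilon> x] eps in auto)
    moreover have "sqrt (h \<epsilon> x) \<le> 1 + h \<epsilon> x"
      using h0 by (intro real_le_lsqrt) (auto simp: power2_eq_square algebra_simps)
    ultimately have "sqrt (h \<epsilon> x) \<le> (B + 1) / \<epsilon> ^ CARD('n)"
      using eps(2) by (simp add: add_divide_distrib)
    then show ?thesis using h0 by (simp add: \<phi>_net_def)
  qed
  define g_net where "g_net \<epsilon> x = complex_of_real (cutoff \<epsilon> x) * \<phi>_net \<epsilon> x" for \<epsilon> x
  have g_temp: "temperate k g_net" for k
    unfolding g_net_def[abs_def] by (rule temperate_mult[OF of_real_temp[OF temperate_cutoff] \<phi>_temp])
  have g_supp: "g_net \<epsilon> x = 0" if "\<epsilon> \<in> {0<..1}" "norm x > 2 / \<epsilon>" for \<epsilon> x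
    using that cutoff_eq_0[of \<epsilon> x] by (simp add: g_net_def divide_less_eq mult.commute)
  have g_eq: "g_net \<epsilon> x = \<phi>_net \<epsilon> x" if "\<epsilon> \<in> {0<..1}" "\<epsilon> * norm x \<le> 1" for \<epsilon> x
    using that cutoff_eq_1[of \<epsilon> x] by (simp add: g_net_def)
  \<comment> \<open>On a set of radius R the cutoff equals 1 once \<epsilon> < 1/R. This serves
    twice: on \<Omega> for the restrictions, and on the support of a test function for the
    limit.\<close>
  have g_eventually: "\<forall>\<^sub>F \<epsilon> in at_right 0. \<forall>x\<in>A. g_net \<epsilon> x = \<phi>_net \<epsilon> x" if "bounded A" for A
  proof -
    obtain R where R: "R > 0" "\<And>x. x \<in> A \<Longrightarrow> norm x \<le> R" using \<open>bounded A\<close> bounded_pos by blast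
    have "\<forall>\<^sub>F \<epsilon> in at_right 0. \<epsilon> < 1 / R"
      by (rule order_tendstoD(2)[OF tendsto_ident_at]) (use R(1) in simp)
    with eventually_01 show ?thesis
    proof eventually_elim
      case (elim \<epsilon>)
      show ?case
      proof
        fix x assume "x \<in> A"
        then have "\<epsilon> * norm x \<le> (1 / R) * R"
          using elim R by (intro mult_mono) auto
        then show "g_net \<epsilon> x = \<phi>_net \<epsilon> x" using R(1) elim(1) by (intro g_eq) auto
      qed
    qed
  qed
  have \<phi>_mod: "\<phi>_net \<in> moderate_nets (C_inf UNIV)"
    and g_mod: "g_net \<in> moderate_nets (C_inf UNIV)"
    and g_mod_H: "g_net \<in> moderate_nets H_inf"
    by (rule temperate_imp_moderate_C_inf[OF \<phi>_temp] temperate_imp_moderate_C_inf[OF g_temp]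
        temperate_imp_moderate_H_inf[OF g_temp g_supp]; assumption)+
  have \<phi>_lim: "((\<lambda>\<epsilon>. fun_distr (\<phi>_net \<epsilon> * \<phi>_net \<epsilon>) \<psi>) \<longlongrightarrow> measure_distr \<mu> \<psi>) (at_right 0)"
    if "\<psi> \<in> test_functions UNIV" for \<psi>
  proof (rule Lim_transform_eventually)
    show "((\<lambda>\<epsilon>. fun_distr (\<lambda>x. complex_of_real (h \<epsilon> x)) \<psi>) \<longlongrightarrow> measure_distr \<mu> \<psi>) (at_right 0)"
      unfolding h_def by (rule tendsto_integral_measure_convolve[OF \<rho>_cont B assms(5,3,6) that])
    show "\<forall>\<^sub>F \<epsilon> in at_right 0. fun_distr (\<lambda>x. complex_of_real (h \<epsilon> x)) \<psi> = fun_distr (\<phi>_net \<epsilon> * \<phi>_net \<epsilon>) \<psi>"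
      using eventually_01 by eventually_elim (simp add: fun_distr_def \<phi>_sq)
  qed
  have g_lim: "((\<lambda>\<epsilon>. fun_distr (g_net \<epsilon> * g_net \<epsilon>) \<psi>) \<longlongrightarrow> measure_distr \<mu> \<psi>) (at_right 0)"
    if \<psi>: "\<psi> \<in> test_functions UNIV" for \<psi>
  proof (rule Lim_transform_eventually[OF \<phi>_lim[OF \<psi>]])
    obtain K where K: "compact K" "\<And>x. x \<notin> K \<Longrightarrow> \<psi> x = 0" using test_function_support[OF \<psi>] by blast
    show "\<forall>\<^sub>F \<epsilon> in at_right 0. fun_distr (\<phi>_net \<epsilon> * \<phi>_net \<epsilon>) \<psi> = fun_distr (g_net \<epsilon> * g_net \<epsilon>) \<psi>"
      using g_eventually[OF compact_imp_bounded[OF K(1)]]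
    proof eventually_elim
      case (elim \<epsilon>)
      \<comment> \<open>Inside K the nets coincide, outside K the test function vanishes.\<close>
      then have "(\<phi>_net \<epsilon> * \<phi>_net \<epsilon>) x * \<psi> x = (g_net \<epsilon> * g_net \<epsilon>) x * \<psi> x" for x
        using K(2)[of x] by (cases "x \<in> K") auto
      then show ?case by (simp only: fun_distr_def)
    qed
  qed
  have \<phi>_assoc: "associated UNIV (gen_mult (C_inf UNIV) \<phi> \<phi>) (measure_distr \<mu>)"
    unfolding \<phi>_def
  proof (rule associated_square[where C = "B + 1" and N = "CARD('n)"])
    show "(\<lambda>\<epsilon>. \<phi>_net \<epsilon> * \<phi>_net \<epsilon>) \<in> moderate_nets (C_inf UNIV)"
      unfolding times_fun_def by (rule temperate_imp_moderate_C_inf[OF temperate_mult[OF \<phi>_temp \<phi>_temp]])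
  qed (use null_nets_C_inf_imp_locally_null refl_net_equiv_C_inf \<phi>_mod temperate_continuous[OF \<phi>_temp]
      \<phi>_bound measure_distr_distribution \<phi>_lim in auto)
  define g where "g = net_class H_inf g_net"
  have g_assoc: "associated UNIV (gen_mult H_inf g g) (measure_distr \<mu>)"
    unfolding g_def
  proof (rule associated_square[where C = "B + 1" and N = "CARD('n)"])
    show "(\<lambda>\<epsilon>. g_net \<epsilon> * g_net \<epsilon>) \<in> moderate_nets H_inf"
      unfolding times_fun_def
      by (rule temperate_imp_moderate_H_inf[OF temperate_mult[OF g_temp g_temp]]) (simp add: g_supp)
    \<comment> \<open>The cutoff takes values in [0,1], so the bound for \<phi> carries over with
      the same constants.\<close>
    show "norm (g_net \<epsilon> x) \<le> (B + 1) / \<epsilon> ^ CARD('n)" if "\<epsilon> \<in> {0<..1}" for \<epsilon> x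
    proof -
      have "norm (g_net \<epsilon> x) \<le> norm (\<phi>_net \<epsilon> x)"
        using cutoff_bounds[of \<epsilon> x] by (simp add: g_net_def norm_mult mult_left_le_one_le)
      then show ?thesis using \<phi>_bound[OF that, of x] by linarith
    qed
  qed (use null_nets_H_inf_imp_locally_null refl_net_equiv_H_inf g_mod_H temperate_continuous[OF g_temp]
      measure_distr_distribution g_lim in auto)
  have \<phi>_gen: "\<phi> \<in> gen_functions (C_inf UNIV)"
    unfolding \<phi>_def gen_functions_def net_class_def by (rule quotientI[OF \<phi>_mod])
  have g_gen: "g \<in> gen_functions H_inf"
    unfolding g_def gen_functions_def net_class_def by (rule quotientI[OF g_mod_H])
  have g_mem: "g_net \<in> g"
    using refl_net_equiv_H_inf[OF g_mod_H] by (simp add: g_def net_class_def)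
  have restrict: "(\<lambda>\<epsilon>. restr \<Omega> (g_net \<epsilon>)) \<in> moderate_nets (C_inf \<Omega>) \<and>
      net_class (C_inf \<Omega>) (\<lambda>\<epsilon>. restr \<Omega> (g_net \<epsilon>)) = gen_restrict \<Omega> \<phi>"
    if "open \<Omega>" "bounded \<Omega>" for \<Omega>
    unfolding \<phi>_def
    using restr_moderate_nets[OF that(1) g_mod]
      gen_restrict_eq_net_class[OF that(1) \<phi>_mod g_mod g_eventually[OF that(2)]] by blast
  show ?thesis
    using h_pos \<phi>_mod \<phi>_gen \<phi>_assoc g_gen g_mem g_assoc restrict by blast
qed

end
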